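(* Let $M\subset \mathbb C^{n+1}$ and $M'\subset \mathbb C^{n'+1}$ be connected real-analytic hypersurfaces and let $U$ be an open neighborhood of $M$ in $\mathbb C^{n+1}$. Assume that $M$ is holomorphically nondegenerate and that at least one of the following two conditions holds: $$e(M',p')+e_0(M',p')\le n-1\quad \text{for all } p'\in M',$$ or $$n'+e_0(M',p')\le 2n\quad \text{for all } p'\in M'.$$ If $H\colon U\to\mathbb C^{n'+1}$ is a holomorphic mapping with $H(M)\subset M'$, then one of the following two mutually exclusive conditions holds: (i) There is an open subset $V\subset U$ with $M\subset V$ and $H(V)\subset M'$. (ii) $H$ is transversal to $M'$ at $H(p)$ for all $p\in M$ outside a proper real-analytic subset of $M$.
   Context: Hypersurface means real hypersurface. For a real-analytic hypersurface $M\subset\mathbb C^{n+1}$ with local defining function $\rho$ near $p\in M$ (real-valued, real-analytic, $d\rho\ne0$), the Levi form of $M$ at $p$ is represented by the hermitian form $\mathcal L(u,v)=\sum_{j,k}\rho_{Z_j\bar Z_k}(p)u_j\bar v_k$ restricted to the $n$-dimensional space $\{u\in\mathbb C^{n+1}:\sum_j\rho_{Z_j}(p)u_j=0\}$. Let $e_+,e_-,e_0$ be the numbers of positive, negative and zero eigenvalues of $\mathcal L$; set $e(M,p):=\min(e_+,e_-)$ and $e_0(M,p):=e_0$ (independent of the choice of $\rho$). A connected real-analytic hypersurface $M\subset \mathbb C^{n+1}$ is holomorphically nondegenerate if there is no point of $M$ at which there is a germ of a nontrivial (not identically zero) holomorphic $(1,0)$-vector field $\sum_j a_j(Z)\,\partial/\partial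 Z_j$ ($a_j$ holomorphic) tangent to $M$. If $H$ is a holomorphic mapping from an open set $U\subset\mathbb C^{n+1}$ to $\mathbb C^{n'+1}$ and $M'$ is a real hypersurface through $H(p)$, $p\in U$, then $H$ is transversal to $M'$ at $H(p)$ if $T_{H(p)}M'+dH(T_p\mathbb C^{n+1})=T_{H(p)}\mathbb C^{n'+1}$ (real tangent spaces; $dH$ taken at $p$). *)

theory Defs
  imports "HOL-Analysis.Analysis"
begin

text \<open>
  The space \<open>\<complex>\<^sup>m\<close> is the type \<open>complex ^ 'm\<close>, which is at the same time a real Euclidean space
  (with basis vectors \<open>axis j 1\<close> and \<open>axis j \<i>\<close>) and a complex vector space with scalar
  multiplication \<open>*s\<close>.
\<close>

subsection \<open>Real-analytic functions and holomorphic maps\<close>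

text \<open>
  Multi-indices are the extensional functions on \<open>Basis\<close>. The convergence expressed by
  \<open>has_sum\<close> is unconditional, hence absolute.
\<close>

definition real_analytic_at :: "('a::euclidean_space \<Rightarrow> real) \<Rightarrow> 'a \<Rightarrow> bool" where
  "real_analytic_at f p \<longleftrightarrow>
     (\<exists>r>0. \<exists>c :: ('a \<Rightarrow> nat) \<Rightarrow> real. \<forall>x\<in>ball p r.
        ((\<lambda>\<alpha>. c \<alpha> * (\<Prod>b\<in>Basis. ((x - p) \<bullet> b) ^ \<alpha> b)) has_sum f x) (Basis \<rightarrow>\<^sub>E UNIV))"

definition real_analytic_on :: "('a::euclidean_space \<Rightarrow> real) \<Rightarrow> 'a set \<Rightarrow> bool" where
  "real_analytic_on f S \<longleftrightarrow> (\<forall>x\<in>S. real_analytic_at f x)"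

text \<open>For maps on open sets: the real derivative exists and is complex linear.\<close>

definition holomorphic_map_on :: "(complex ^ 'm \<Rightarrow> complex ^ 'k) \<Rightarrow> (complex ^ 'm) set \<Rightarrow> bool" where
  "holomorphic_map_on F U \<longleftrightarrow>
     (\<forall>z\<in>U. \<exists>A :: complex ^ 'm ^ 'k. (F has_derivative (\<lambda>v. A *v v)) (at z))"

subsection \<open>Real-analytic hypersurfaces\<close>

definition local_defining_function ::
    "(complex ^ 'm) set \<Rightarrow> complex ^ 'm \<Rightarrow> (complex ^ 'm) set \<Rightarrow> (complex ^ 'm \<Rightarrow> real) \<Rightarrow> bool" where
  "local_defining_function M p W \<rho> \<longleftrightarrow>
     open W \<and> p \<in> W \<and> real_analytic_on \<rho> W \<and>
     (\<forall>z\<in>W. frechet_derivative \<rho> (at z) \<noteq> (\<lambda>v. 0)) \<and>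
     M \<inter> W = {z\<in>W. \<rho> z = 0}"

definition real_analytic_hypersurface :: "(complex ^ 'm) set \<Rightarrow> bool" where
  "real_analytic_hypersurface M \<longleftrightarrow> (\<forall>p\<in>M. \<exists>W \<rho>. local_defining_function M p W \<rho>)"

text \<open>
  An arbitrary choice of local defining function. The tangent space and the numbers
  \<open>levi_e\<close>, \<open>levi_e0\<close> below do not depend on it.
\<close>

definition defining_function_at :: "(complex ^ 'm) set \<Rightarrow> complex ^ 'm \<Rightarrow> complex ^ 'm \<Rightarrow> real" where
  "defining_function_at M p = (SOME \<rho>. \<exists>W. local_defining_function M p W \<rho>)"

definition real_tangent_space :: "(complex ^ 'm) set \<Rightarrow> complex ^ 'm \<Rightarrow> (complex ^ 'm) set" where
  "real_tangent_space M p = {v. frechet_derivative (defining_function_at M p) (at p) v = 0}"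

definition real_analytic_subset :: "(complex ^ 'm) set \<Rightarrow> (complex ^ 'm) set \<Rightarrow> bool" where
  "real_analytic_subset M A \<longleftrightarrow>
     A \<subseteq> M \<and>
     (\<forall>p\<in>M. \<exists>W F. open W \<and> p \<in> W \<and> finite F \<and> (\<forall>f\<in>F. real_analytic_on f W) \<and>
        A \<inter> W = {z \<in> M \<inter> W. \<forall>f\<in>F. f z = 0})"

subsection \<open>Wirtinger derivatives and the Levi form\<close>

definition wirtinger :: "'m \<Rightarrow> (complex ^ 'm \<Rightarrow> complex) \<Rightarrow> complex ^ 'm \<Rightarrow> complex" where
  "wirtinger j f z =
     (frechet_derivative f (at z) (axis j 1) - \<i> * frechet_derivative f (at z) (axis j \<i>)) / 2"

definition wirtinger_bar :: "'m \<Rightarrow> (complex ^ 'm \<Rightarrow> complex) \<Rightarrow> complex ^ 'm \<Rightarrow> complex" where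
  "wirtinger_bar j f z =
     (frechet_derivative f (at z) (axis j 1) + \<i> * frechet_derivative f (at z) (axis j \<i>)) / 2"

definition levi_space :: "(complex ^ 'm \<Rightarrow> real) \<Rightarrow> complex ^ 'm \<Rightarrow> (complex ^ 'm) set" where
  "levi_space \<rho> p = {u. (\<Sum>j\<in>UNIV. wirtinger j (\<lambda>z. complex_of_real (\<rho> z)) p * u $ j) = 0}"

definition levi_form ::
    "(complex ^ 'm \<Rightarrow> real) \<Rightarrow> complex ^ 'm \<Rightarrow> complex ^ 'm \<Rightarrow> complex ^ 'm \<Rightarrow> complex" where
  "levi_form \<rho> p u v =
     (\<Sum>j\<in>UNIV. \<Sum>k\<in>UNIV.
        wirtinger_bar k (wirtinger j (\<lambda>z. complex_of_real (\<rho> z))) p * u $ j * cnj (v $ k))"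

text \<open>
  Eigenvalues of the hermitian form restricted to \<open>levi_space\<close> are taken with respect to the
  standard hermitian inner product: \<open>u\<close> is an eigenvector for \<open>\<mu>\<close> if
  \<open>\<L>(u, v) = \<mu> \<langle>u, v\<rangle>\<close> for all \<open>v\<close> in the space. Eigenvalues are counted with multiplicity,
  i.e. with the complex dimension of the eigenspace.
\<close>

definition levi_eigenspace ::
    "(complex ^ 'm \<Rightarrow> real) \<Rightarrow> complex ^ 'm \<Rightarrow> real \<Rightarrow> (complex ^ 'm) set" where
  "levi_eigenspace \<rho> p \<mu> =
     {u \<in> levi_space \<rho> p. \<forall>v\<in>levi_space \<rho> p.
        levi_form \<rho> p u v = complex_of_real \<mu> * (\<Sum>j\<in>UNIV. u $ j * cnj (v $ j))}"

definition num_levi_eigenvalues ::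
    "(complex ^ 'm \<Rightarrow> real) \<Rightarrow> complex ^ 'm \<Rightarrow> real set \<Rightarrow> nat" where
  "num_levi_eigenvalues \<rho> p S =
     (\<Sum>\<mu> | \<mu> \<in> S \<and> levi_eigenspace \<rho> p \<mu> \<noteq> {0}. vec.dim (levi_eigenspace \<rho> p \<mu>))"

definition levi_e :: "(complex ^ 'm) set \<Rightarrow> complex ^ 'm \<Rightarrow> nat" where
  "levi_e M p =
     min (num_levi_eigenvalues (defining_function_at M p) p {0<..})
         (num_levi_eigenvalues (defining_function_at M p) p {..<0})"

definition levi_e0 :: "(complex ^ 'm) set \<Rightarrow> complex ^ 'm \<Rightarrow> nat" where
  "levi_e0 M p = num_levi_eigenvalues (defining_function_at M p) p {0}"

subsection \<open>Holomorphic nondegeneracy and transversality\<close>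

text \<open>
  \<open>a\<close> is the coefficient vector of a \<open>(1,0)\<close>-field; it is tangent to \<open>M\<close> if it annihilates
  \<open>\<rho>\<close> along \<open>M\<close>. Nontriviality is that of the germ of \<open>a\<close> at \<open>p\<close>, as \<open>W\<close> need not be connected.
\<close>

definition holomorphically_nondegenerate :: "(complex ^ 'm) set \<Rightarrow> bool" where
  "holomorphically_nondegenerate M \<longleftrightarrow>
     \<not> (\<exists>p\<in>M. \<exists>W \<rho>. \<exists>a :: complex ^ 'm \<Rightarrow> complex ^ 'm.
          local_defining_function M p W \<rho> \<and> holomorphic_map_on a W \<and>
          \<not> (\<forall>\<^sub>F z in nhds p. a z = 0) \<and>
          (\<forall>z\<in>M \<inter> W. (\<Sum>j\<in>UNIV. a z $ j * wirtinger j (\<lambda>w. complex_of_real (\<rho> w)) z) = 0))"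

definition transversal_at ::
    "(complex ^ 'm \<Rightarrow> complex ^ 'k) \<Rightarrow> (complex ^ 'k) set \<Rightarrow> complex ^ 'm \<Rightarrow> bool" where
  "transversal_at H M' p \<longleftrightarrow>
     {t + frechet_derivative H (at p) v | t v. t \<in> real_tangent_space M' (H p)} = UNIV"

end

theory Submission
  imports Defs "HOL-Complex_Analysis.Conformal_Mappings"
begin

text \<open>
  \<open>H\<close> is transversal to \<open>M'\<close> at \<open>p\<close> iff \<open>d(\<rho>' \<circ> H)\<close> does not vanish at \<open>p\<close>, so the nontransversal
  points form a real-analytic subset \<open>A\<close> of \<open>M\<close>. It remains to show that \<open>A = M\<close> forces
  \<open>g = \<rho>' \<circ> H\<close> to vanish near each \<open>p \<in> M\<close>; suppose it does not. If \<open>dH\<close> were generically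
  non-injective near \<open>p\<close>, there would be a nontrivial holomorphic field \<open>a\<close> with \<open>dH(a) = 0\<close> near some
  point of \<open>M\<close>. Where \<open>a\<close> is not tangent to \<open>M\<close>, the transport equation \<open>a g = 0\<close> with \<open>g = 0\<close> on \<open>M\<close>
  gives \<open>g = 0\<close> on an open set, hence near \<open>p\<close> by analyticity; so \<open>a\<close> is tangent to \<open>M\<close>, against holomorphic
  nondegeneracy. Therefore \<open>J = dH\<close> is injective at some point of \<open>M\<close>. There \<open>g\<close> vanishes to
  second order along \<open>M\<close>, so the Levi form of \<open>M'\<close> pulls back under \<open>J\<close> to \<open>\<lambda> |\<partial>\<rho>|\<^sup>2\<close> with a real \<open>\<lambda>\<close>.
  It is semidefinite on an \<open>(n+1)\<close>-dimensional space and zero on an \<open>n\<close>-dimensional one, hence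
  \<open>e\<^sub>\<plusminus> + e\<^sub>0 \<ge> n + 1\<close> for one sign and \<open>\<ge> n\<close> for the other, which contradicts either
  condition on \<open>M'\<close>.
\<close>

section \<open>Separately holomorphic functions on polydiscs\<close>

text \<open>Real-analyticity is given by convergent power series, whereas the argument uses other
  properties: partial derivatives that are again analytic, symmetry of second derivatives,
  composition with holomorphic maps, an identity theorem. These reduce to complex analysis in one
  variable once a real-analytic function is replaced by a bounded, separately holomorphic extension
  to a polydisc. Multiple power series serve to translate between the two descriptions and to
  restrict an extension to holomorphic curves. The passage from open sets to \<open>M\<close> rests
  on one fact: a real hypersurface is a set of uniqueness for holomorphic functions. A determinant
  that is not identically zero is therefore nonzero somewhere on \<open>M\<close>, so the generic
  rank of dH can be tested at points of \<open>M\<close>, where the tangency condition and the Levi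
  form make sense. Local defining functions are a matter of choice. Tangent spaces are compared
  through the common zero set, and the eigenvalue count is carried out for the very function that
  \<open>defining_function_at\<close> picks.\<close>

lemma deriv_bound_ball:
  assumes "f holomorphic_on ball z r" "\<And>w. w \<in> ball z r \<Longrightarrow> norm (f w) \<le> M" "0 < s" "s < r"
  shows "norm ((deriv ^^ k) f z) \<le> fact k * M / s ^ k"
proof (rule Cauchy_inequality)
  have sub: "cball z s \<subseteq> ball z r" using assms by auto
  show "f holomorphic_on ball z s" using assms(1) by (rule holomorphic_on_subset) (use sub in auto)
  show "continuous_on (cball z s) f"
    using holomorphic_on_imp_continuous_on[OF assms(1)] sub by (rule continuous_on_subset)
  show "norm (f x) \<le> M" if "norm (z - x) = s" for x using assms that by (auto simp: dist_norm)
qed (use assms in auto)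

text \<open>The tail of the Taylor series is dominated by a geometric series of ratio |h|/s \<le>
  1/2, whose sum accounts for the factor 2.\<close>

lemma taylor_remainder_bound:
  assumes hol: "f holomorphic_on ball z r" and bd: "\<And>w. w \<in> ball z r \<Longrightarrow> norm (f w) \<le> M"
    and s: "0 < s" "s < r" and h: "norm h \<le> s / 2"
  shows "norm (f (z + h) - (\<Sum>j<k. (deriv ^^ j) f z / fact j * h ^ j)) \<le> 2 * M * (norm h / s) ^ k"
proof -
  let ?a = "\<lambda>j. (deriv ^^ j) f z / fact j"
  let ?q = "norm h / s"
  have q: "0 \<le> ?q" "?q \<le> 1/2" using s h by (auto simp: field_simps)
  have M: "0 \<le> M" using bd[of z] s by (meson centre_in_ball norm_ge_zero order_trans order_less_trans)
  have a: "norm (?a j) \<le> M / s ^ j" for j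
    using divide_right_mono[OF deriv_bound_ball[OF hol bd s, of j], of "fact j"] by (simp add: norm_divide)
  have "z + h \<in> ball z r" using h s by (auto simp: dist_norm)
  from holomorphic_power_series[OF hol this] have sm: "(\<lambda>j. ?a j * h ^ j) sums f (z + h)" by simp
  have "(\<lambda>j. ?a (j + k) * h ^ (j + k)) sums (f (z + h) - (\<Sum>j<k. ?a j * h ^ j))"
    using sums_split_initial_segment[OF sm] by simp
  then have eq: "f (z + h) - (\<Sum>j<k. ?a j * h ^ j) = (\<Sum>j. ?a (j + k) * h ^ (j + k))" by (simp add: sums_iff)
  have t: "norm (?a (j + k) * h ^ (j + k)) \<le> M * ?q ^ k * ?q ^ j" for j
  proof -
    have "norm (?a (j + k) * h ^ (j + k)) \<le> M / s ^ (j+k) * norm h ^ (j+k)"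
      unfolding norm_mult norm_power by (intro mult_right_mono a) auto
    then show ?thesis by (simp add: power_add power_divide mult_ac)
  qed
  have gs: "(\<lambda>j. M * ?q ^ k * ?q ^ j) sums (M * ?q ^ k * (1 / (1 - ?q)))"
    by (intro sums_mult geometric_sums) (use q s in \<open>simp add: real_norm_def\<close>)
  have "norm (\<Sum>j. ?a (j + k) * h ^ (j + k)) \<le> M * ?q ^ k * (1 / (1 - ?q))"
    using norm_suminf_le[OF t sums_summable[OF gs]] unfolding sums_unique[OF gs] .
  also have "\<dots> \<le> M * ?q ^ k * 2"
    using q s M by (intro mult_left_mono mult_nonneg_nonneg zero_le_power) (auto simp: divide_simps)
  finally show ?thesis unfolding eq by (simp add: mult_ac)
qed

text \<open>Boundedness in \<open>\<zeta>\<close> replaces joint continuity: the coefficient is a uniform limit of divided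
  differences.\<close>

lemma holomorphic_higher_deriv_parameter:
  assumes "open T" and s: "0 < r"
    and hol1: "\<And>\<eta>. \<eta> \<in> T \<Longrightarrow> (\<lambda>\<zeta>. F \<zeta> \<eta>) holomorphic_on ball z r"
    and hol2: "\<And>\<zeta>. \<zeta> \<in> ball z r \<Longrightarrow> F \<zeta> holomorphic_on T"
    and bd: "\<And>\<zeta> \<eta>. \<zeta> \<in> ball z r \<Longrightarrow> \<eta> \<in> T \<Longrightarrow> norm (F \<zeta> \<eta>) \<le> M"
  shows "(\<lambda>\<eta>. (deriv ^^ k) (\<lambda>\<zeta>. F \<zeta> \<eta>) z) holomorphic_on T"
proof (induction k rule: less_induct)
  case (less k)
  define s where "s = r / 2"
  have s: "0 < s" "s < r" using assms by (auto simp: s_def)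
  \<comment> \<open>Nonzero steps tending to 0 whose modulus never exceeds \<open>s / 2\<close>, the
    range of the Taylor estimate.\<close>
  define h :: "nat \<Rightarrow> complex" where "h N = of_real (s / (2 * real (Suc N)))" for N
  have h0: "h N \<noteq> 0" for N using s by (simp add: h_def del: of_nat_Suc)
  have hs: "norm (h N) \<le> s / 2" for N
  proof -
    have "s / (2 * real (Suc N)) \<le> s / 2" using s by (simp add: divide_simps)
    then show ?thesis unfolding h_def norm_of_real using s by (simp add: abs_of_nonneg)
  qed
  let ?a = "\<lambda>j \<eta>. (deriv ^^ j) (\<lambda>\<zeta>. F \<zeta> \<eta>) z / fact j"
  \<comment> \<open>By strong induction the coefficients of order below \<open>k\<close> are
    holomorphic in \<open>\<eta>\<close>. Removing them before dividing by \<open>h N ^ k\<close>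
    isolates the coefficient of order \<open>k\<close> up to an error of size |h N|, uniformly in
    \<open>\<eta>\<close>.\<close>
  define f where "f N \<eta> = (F (z + h N) \<eta> - (\<Sum>j<k. ?a j \<eta> * h N ^ j)) / h N ^ k" for N \<eta>
  have zh: "z + h N \<in> ball z r" for N using hs[of N] s by (auto simp: dist_norm)
  have fh: "f N holomorphic_on T" for N
    unfolding f_def using h0 zh less hol2
    by (intro holomorphic_intros hol2) auto
  have est: "norm (f N \<eta> - ?a k \<eta>) \<le> 2 * M / s ^ Suc k * norm (h N)" if "\<eta> \<in> T" for N \<eta>
  proof -
    have "norm (F (z + h N) \<eta> - (\<Sum>j<Suc k. ?a j \<eta> * h N ^ j)) \<le> 2 * M * (norm (h N) / s) ^ Suc k"
      by (rule taylor_remainder_bound[OF hol1[OF that] bd[OF _ that] s hs])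
    moreover have "f N \<eta> - ?a k \<eta> = (F (z + h N) \<eta> - (\<Sum>j<Suc k. ?a j \<eta> * h N ^ j)) / h N ^ k"
      using h0[of N] by (simp add: f_def diff_divide_distrib add_divide_distrib)
    moreover have "2 * M * (norm (h N) / s) ^ Suc k / norm (h N) ^ k = 2 * M / s ^ Suc k * norm (h N)"
      using h0[of N] by (simp add: power_divide)
    ultimately show ?thesis
      using divide_right_mono[of "norm (F (z + h N) \<eta> - (\<Sum>j<Suc k. ?a j \<eta> * h N ^ j))"
          "2 * M * (norm (h N) / s) ^ Suc k" "norm (h N) ^ k"]
      by (simp only: norm_divide norm_power zero_le_power norm_ge_zero simp_thms)
  qed
  have lim0: "(\<lambda>N. 2 * M / s ^ Suc k * norm (h N)) \<longlonglongrightarrow> 0"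
  proof -
    have "(\<lambda>N. s / 2 * inverse (real (Suc N))) \<longlonglongrightarrow> s / 2 * 0"
      by (intro tendsto_intros LIMSEQ_inverse_real_of_nat)
    then have "(\<lambda>N. norm (h N)) \<longlonglongrightarrow> 0" unfolding h_def norm_of_real using s
      by (simp add: abs_of_nonneg field_simps del: of_nat_Suc)
    from tendsto_mult_right_zero[OF this] show ?thesis .
  qed
  have ul: "uniform_limit T f (?a k) sequentially"
  proof (rule uniform_limitI)
    fix e :: real assume "e > 0"
    from order_tendstoD(2)[OF lim0 this]
    show "\<forall>\<^sub>F N in sequentially. \<forall>\<eta>\<in>T. dist (f N \<eta>) (?a k \<eta>) < e"
      by eventually_elim (use est in \<open>auto simp: dist_norm intro: le_less_trans\<close>)
  qed
  have "?a k holomorphic_on T"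
  proof (rule holomorphic_uniform_sequence[OF \<open>open T\<close> fh])
    fix x assume "x \<in> T"
    then obtain d where "0 < d" "cball x d \<subseteq> T" using \<open>open T\<close> open_contains_cball by blast
    then show "\<exists>d>0. cball x d \<subseteq> T \<and> uniform_limit (cball x d) f (?a k) sequentially"
      using uniform_limit_on_subset[OF ul] by blast
  qed
  then have "(\<lambda>\<eta>. ?a k \<eta> * fact k) holomorphic_on T" by (rule holomorphic_on_mult) (rule holomorphic_on_const)
  moreover have "(\<lambda>\<eta>. ?a k \<eta> * fact k) = (\<lambda>\<eta>. (deriv ^^ k) (\<lambda>\<zeta>. F \<zeta> \<eta>) z)" by auto
  ultimately show ?case by simp
qed

text \<open>Coordinates outside \<open>B\<close> are pinned to 0, so polydiscs in different numbers
  of variables share one type, the slice where coordinate \<open>b\<close> is 0 is again a polydisc,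
  and inductions over \<open>B\<close> can add one variable at a time.\<close>

definition polydisc :: "'i set \<Rightarrow> real \<Rightarrow> ('i \<Rightarrow> complex) set" where
  "polydisc B r = {w. \<forall>b. if b \<in> B then norm (w b) < r else w b = 0}"

text \<open>Holomorphy is asked on full discs in each coordinate, so one-variable theorems apply
  directly; the uniform bound \<open>M\<close> is what turns separate holomorphy into a joint power
  series.\<close>

definition sep_holo :: "'i set \<Rightarrow> real \<Rightarrow> real \<Rightarrow> (('i \<Rightarrow> complex) \<Rightarrow> complex) \<Rightarrow> bool" where
  "sep_holo B r M F \<longleftrightarrow>
     (\<forall>w\<in>polydisc B r. norm (F w) \<le> M \<and> (\<forall>b\<in>B. (\<lambda>\<zeta>. F (w(b := \<zeta>))) holomorphic_on ball 0 r))"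

definition dcoord :: "'i \<Rightarrow> (('i \<Rightarrow> complex) \<Rightarrow> complex) \<Rightarrow> ('i \<Rightarrow> complex) \<Rightarrow> complex" where
  "dcoord b F w = deriv (\<lambda>\<zeta>. F (w(b := \<zeta>))) (w b)"

lemma polydisc_upd: "w \<in> polydisc B r \<Longrightarrow> b \<in> B \<Longrightarrow> norm \<zeta> < r \<Longrightarrow> w(b := \<zeta>) \<in> polydisc B r"
  by (auto simp: polydisc_def)

lemma polydisc_mono:
  assumes "s \<le> r" shows "polydisc B s \<subseteq> polydisc B r"
proof
  fix w assume w: "w \<in> polydisc B s"
  have "if b \<in> B then norm (w b) < r else w b = 0" for b
    using w assms unfolding polydisc_def by (cases "b \<in> B") (auto dest!: spec[of _ b])
  then show "w \<in> polydisc B r" by (simp add: polydisc_def)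
qed

lemma zero_in_polydisc: "0 < r \<Longrightarrow> (\<lambda>_. 0) \<in> polydisc B r"
  by (auto simp: polydisc_def)

lemma sep_holo_bound: "sep_holo B r M F \<Longrightarrow> w \<in> polydisc B r \<Longrightarrow> norm (F w) \<le> M"
  by (auto simp: sep_holo_def)

lemma sep_holo_coord:
  "sep_holo B r M F \<Longrightarrow> w \<in> polydisc B r \<Longrightarrow> b \<in> B \<Longrightarrow> (\<lambda>\<zeta>. F (w(b := \<zeta>))) holomorphic_on ball 0 r"
  by (auto simp: sep_holo_def)

lemma sep_holo_higher_deriv:
  assumes F: "sep_holo B r M F" and b: "b \<in> B" and w: "w \<in> polydisc B r" and d: "0 < d" "d + norm (w b) \<le> r"
    and c: "c \<in> B" "c \<noteq> b"
  shows "(\<lambda>\<eta>. (deriv ^^ k) (\<lambda>\<zeta>. F (w(c := \<eta>, b := \<zeta>))) (w b)) holomorphic_on ball 0 r"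
proof (rule holomorphic_higher_deriv_parameter[where M = M and r = d])
  have sub: "ball (w b) d \<subseteq> ball 0 r" using d by (simp add: ball_subset_ball_iff)
  show "(\<lambda>\<zeta>. F (w(c := \<eta>, b := \<zeta>))) holomorphic_on ball (w b) d" if "\<eta> \<in> ball 0 r" for \<eta>
    using that sub by (intro holomorphic_on_subset[OF sep_holo_coord[OF F _ b]]) (auto intro!: polydisc_upd w c)
  show "(\<lambda>\<eta>. F (w(c := \<eta>, b := \<zeta>))) holomorphic_on ball 0 r" if "\<zeta> \<in> ball (w b) d" for \<zeta>
  proof -
    have "\<zeta> \<in> ball 0 r" using sub that by blast
    then have "(\<lambda>\<eta>. F ((w(b := \<zeta>))(c := \<eta>))) holomorphic_on ball 0 r"
      by (intro sep_holo_coord[OF F]) (auto intro!: polydisc_upd w c b)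
    then show ?thesis using c by (simp add: fun_upd_twist)
  qed
  show "norm (F (w(c := \<eta>, b := \<zeta>))) \<le> M" if "\<zeta> \<in> ball (w b) d" "\<eta> \<in> ball 0 r" for \<zeta> \<eta>
  proof -
    have "\<zeta> \<in> ball 0 r" using sub that by blast
    with that show ?thesis by (intro sep_holo_bound[OF F]) (auto intro!: polydisc_upd w c b)
  qed
qed (use d in auto)

text \<open>Around a coordinate of modulus below \<open>s\<close> there is room for a disc of radius
  \<open>r - s\<close>; Cauchy's estimate on half that radius gives the constant 2M/(r - s).\<close>

lemma sep_holo_dcoord:
  assumes F: "sep_holo B r M F" and b: "b \<in> B" and s: "0 < s" "s < r"
  shows "sep_holo B s (2 * M / (r - s)) (dcoord b F)"
  unfolding sep_holo_def
proof (intro ballI conjI)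
  fix w assume ws: "w \<in> polydisc B s"
  then have w: "w \<in> polydisc B r" using s polydisc_mono[of s r B] by auto
  have wb: "norm (w b) < s" using ws b by (auto simp: polydisc_def)
  have sub: "ball (w b) (r - s) \<subseteq> ball 0 r" using wb by (simp add: ball_subset_ball_iff)
  have "norm ((deriv ^^ 1) (\<lambda>\<zeta>. F (w(b := \<zeta>))) (w b)) \<le> fact 1 * M / ((r - s) / 2) ^ 1"
  proof (rule deriv_bound_ball[where r = "r - s"])
    show "(\<lambda>\<zeta>. F (w(b := \<zeta>))) holomorphic_on ball (w b) (r - s)"
      by (rule holomorphic_on_subset[OF sep_holo_coord[OF F w b] sub])
    show "norm (F (w(b := \<zeta>))) \<le> M" if "\<zeta> \<in> ball (w b) (r - s)" for \<zeta>
    proof -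
      have "\<zeta> \<in> ball 0 r" using that sub by blast
      then show ?thesis by (intro sep_holo_bound[OF F] polydisc_upd w b) auto
    qed
  qed (use s in auto)
  then show "norm (dcoord b F w) \<le> 2 * M / (r - s)" by (simp add: dcoord_def mult.commute)
  fix c assume c: "c \<in> B"
  show "(\<lambda>\<zeta>. dcoord b F (w(c := \<zeta>))) holomorphic_on ball 0 s"
  proof (cases "c = b")
    case True
    have "deriv (\<lambda>\<zeta>. F (w(b := \<zeta>))) holomorphic_on ball 0 r"
      by (intro holomorphic_deriv sep_holo_coord[OF F w b]) auto
    then show ?thesis using True s by (auto simp: dcoord_def elim: holomorphic_on_subset)
  next
    case False
    have "(\<lambda>\<eta>. (deriv ^^ 1) (\<lambda>\<zeta>. F (w(c := \<eta>, b := \<zeta>))) (w b)) holomorphic_on ball 0 r"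
      by (rule sep_holo_higher_deriv[OF F b w, of "r - s"]) (use c False s wb in auto)
    then show ?thesis using False s by (auto simp: dcoord_def elim: holomorphic_on_subset)
  qed
qed

lemma sep_holo_slice:
  assumes "sep_holo (insert b B) r M F" "0 < r" "b \<notin> B"
  shows "sep_holo B r M F"
  unfolding sep_holo_def
proof (intro ballI conjI)
  fix w assume "w \<in> polydisc B r"
  then have "w \<in> polydisc (insert b B) r" using assms by (auto simp: polydisc_def)
  then show "norm (F w) \<le> M" "\<And>c. c \<in> B \<Longrightarrow> (\<lambda>\<zeta>. F (w(c := \<zeta>))) holomorphic_on ball 0 r"
    using sep_holo_bound[OF assms(1)] sep_holo_coord[OF assms(1)] by auto
qed

text \<open>Taylor coefficients in the variable \<open>b\<close> depend on the remaining variables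
  only and are of the same kind as \<open>F\<close>, with Cauchy's bound. This drives the inductions
  over the set of variables.\<close>

lemma sep_holo_slice_deriv:
  assumes F: "sep_holo (insert b B) r M F" and b: "b \<notin> B" and s: "0 < s" "s < r"
  shows "sep_holo B r (M / s ^ k) (\<lambda>w. (deriv ^^ k) (\<lambda>\<zeta>. F (w(b := \<zeta>))) 0 / fact k)"
  unfolding sep_holo_def
proof (intro ballI conjI)
  fix w assume w: "w \<in> polydisc B r"
  then have w': "w \<in> polydisc (insert b B) r" and wb: "w b = 0" using b s by (auto simp: polydisc_def)
  have "norm ((deriv ^^ k) (\<lambda>\<zeta>. F (w(b := \<zeta>))) 0) \<le> fact k * M / s ^ k"
  proof (rule deriv_bound_ball[where r = r])
    show "(\<lambda>\<zeta>. F (w(b := \<zeta>))) holomorphic_on ball 0 r"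
      by (rule sep_holo_coord[OF F w']) auto
    show "norm (F (w(b := \<zeta>))) \<le> M" if "\<zeta> \<in> ball 0 r" for \<zeta>
      using that by (intro sep_holo_bound[OF F] polydisc_upd w') auto
  qed (use s in auto)
  from divide_right_mono[OF this, of "fact k"]
  show "norm ((deriv ^^ k) (\<lambda>\<zeta>. F (w(b := \<zeta>))) 0 / fact k) \<le> M / s ^ k"
    by (simp add: norm_divide)
  fix c assume c: "c \<in> B"
  have "(\<lambda>\<eta>. (deriv ^^ k) (\<lambda>\<zeta>. F (w(c := \<eta>, b := \<zeta>))) (w b)) holomorphic_on ball 0 r"
    by (rule sep_holo_higher_deriv[OF F _ w', of b r]) (use c b s wb in auto)
  then show "(\<lambda>\<zeta>. (deriv ^^ k) (\<lambda>\<zeta>'. F (w(c := \<zeta>, b := \<zeta>'))) 0 / fact k) holomorphic_on ball 0 r"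
    using wb by (intro holomorphic_intros) auto
qed

lemma polydisc_empty [simp]: "polydisc {} r = {\<lambda>_. 0}"
  unfolding polydisc_def by (simp add: set_eq_iff fun_eq_iff)

lemma polydiscI: "(\<And>b. b \<in> B \<Longrightarrow> norm (w b) < r) \<Longrightarrow> (\<And>b. b \<notin> B \<Longrightarrow> w b = 0) \<Longrightarrow> w \<in> polydisc B r"
  by (simp add: polydisc_def)

lemma polydiscD: "w \<in> polydisc B r \<Longrightarrow> b \<in> B \<Longrightarrow> norm (w b) < r"
  unfolding polydisc_def by (drule CollectD, drule spec[of _ b], simp)

lemma polydisc_outside: "w \<in> polydisc B r \<Longrightarrow> b \<notin> B \<Longrightarrow> w b = 0"
  unfolding polydisc_def by (drule CollectD, drule spec[of _ b], simp)

lemma polydisc_slice: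
  assumes "w \<in> polydisc (insert b B) r" "b \<notin> B" shows "w(b := 0) \<in> polydisc B r"
  using assms(2) polydiscD[OF assms(1)] polydisc_outside[OF assms(1)] by (intro polydiscI) auto

section \<open>Taylor and power series expansions\<close>

lemma prod_power_insert_upd:
  assumes "finite B" "b \<notin> B"
  shows "(\<Prod>b'\<in>insert b B. q b' ^ ((\<beta>(b := k)) b')) = q b ^ k * (\<Prod>b'\<in>B. q b' ^ \<beta> b')"
proof -
  have "(\<Prod>b'\<in>B. q b' ^ ((\<beta>(b := k)) b')) = (\<Prod>b'\<in>B. q b' ^ \<beta> b')"
    using assms by (intro prod.cong) auto
  then show ?thesis using assms by simp
qed

text \<open>Cauchy's radius is taken to be r/2; the remainder estimate then allows increments up to
  half of it, hence the polydisc of radius r/4.\<close>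

lemma sep_holo_taylor:
  assumes F: "sep_holo B r M F" and "0 < r" and w: "w \<in> polydisc B (r/4)" and b: "b \<in> B"
  shows "norm (F w - (\<Sum>j<k. (deriv ^^ j) (\<lambda>\<zeta>. F (w(b := \<zeta>))) 0 / fact j * w b ^ j))
    \<le> 2 * M * (norm (w b) / (r/2)) ^ k"
proof -
  have w': "w \<in> polydisc B r" using w assms polydisc_mono[of "r/4" r B] by auto
  have "norm (F (w(b := 0 + w b)) - (\<Sum>j<k. (deriv ^^ j) (\<lambda>\<zeta>. F (w(b := \<zeta>))) 0 / fact j * w b ^ j))
    \<le> 2 * M * (norm (w b) / (r/2)) ^ k"
  proof (rule taylor_remainder_bound[where r = r])
    show "(\<lambda>\<zeta>. F (w(b := \<zeta>))) holomorphic_on ball 0 r" by (rule sep_holo_coord[OF F w' b])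
    show "norm (F (w(b := \<zeta>))) \<le> M" if "\<zeta> \<in> ball 0 r" for \<zeta>
      using that by (intro sep_holo_bound[OF F] polydisc_upd w' b) auto
    show "norm (w b) \<le> r / 2 / 2" using polydiscD[OF w b] by simp
  qed (use assms in auto)
  then show ?thesis by simp
qed

lemma sep_holo_taylor1:
  assumes "sep_holo B r M F" "0 < r" "w \<in> polydisc B (r/4)" "b \<in> B"
  shows "norm (F w - F (w(b := 0))) \<le> 4 * M / r * norm (w b)"
  using sep_holo_taylor[OF assms, of 1] by (simp add: field_simps del: fun_upd_apply)

lemma sep_holo_taylor2:
  assumes "sep_holo B r M F" "0 < r" "w \<in> polydisc B (r/4)" "b \<in> B"
  shows "norm (F w - F (w(b := 0)) - deriv (\<lambda>\<zeta>. F (w(b := \<zeta>))) 0 * w b) \<le> 2 * M * (2 / r)\<^sup>2 * (norm (w b))\<^sup>2"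
  using sep_holo_taylor[OF assms, of 2] by (simp add: numeral_2_eq_2 field_simps del: fun_upd_apply)

text \<open>A multi-index on \<open>insert b B\<close> is a pair of an exponent for \<open>b\<close>
  and a multi-index on \<open>B\<close>, so the sum factors into geometric series.\<close>

lemma summable_on_geometric_PiE:
  fixes q :: "'i \<Rightarrow> real"
  assumes "finite B" "\<And>b. b \<in> B \<Longrightarrow> 0 \<le> q b \<and> q b < 1"
  shows "(\<lambda>\<alpha>. \<Prod>b\<in>B. q b ^ \<alpha> b) summable_on (B \<rightarrow>\<^sub>E UNIV)"
  using assms
proof (induction B rule: finite_induct)
  case empty
  show ?case by (simp add: PiE_empty_domain summable_on_finite)
next
  case (insert b B)
  let ?J = "\<lambda>(k::nat, \<beta>). \<beta>(b := k)"
  have inj: "inj_on ?J (UNIV \<times> (B \<rightarrow>\<^sub>E UNIV))"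
    using inj_combinator[OF insert(2), of "\<lambda>_. UNIV"] by simp
  obtain S where S: "((\<lambda>\<alpha>. \<Prod>b\<in>B. q b ^ \<alpha> b) has_sum S) (B \<rightarrow>\<^sub>E UNIV)"
    using insert summable_on_def by blast
  have "(\<lambda>(k, \<beta>). q b ^ k * (\<Prod>b\<in>B. q b ^ \<beta> b)) summable_on (UNIV \<times> (B \<rightarrow>\<^sub>E UNIV))"
  proof (rule summable_on_SigmaI)
    show "((\<lambda>\<beta>. (case (k, \<beta>) of (k, \<beta>) \<Rightarrow> q b ^ k * (\<Prod>b\<in>B. q b ^ \<beta> b))) has_sum (q b ^ k * S)) (B \<rightarrow>\<^sub>E UNIV)" for k
      using has_sum_cmult_right[OF S] by simp
    have "summable (\<lambda>k. norm (q b ^ k * S))"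
      using insert(4)[of b] unfolding norm_mult norm_power by (intro summable_mult2 summable_geometric) auto
    then show "(\<lambda>k. q b ^ k * S) summable_on UNIV" by (rule norm_summable_imp_summable_on)
  qed (use insert in \<open>auto intro!: mult_nonneg_nonneg prod_nonneg\<close>)
  also have "?this \<longleftrightarrow> ((\<lambda>\<alpha>. \<Prod>b\<in>insert b B. q b ^ \<alpha> b) \<circ> ?J) summable_on (UNIV \<times> (B \<rightarrow>\<^sub>E UNIV))"
    by (intro summable_on_cong) (simp only: o_def split_beta prod_power_insert_upd[OF insert(1,2)])
  also have "\<dots> \<longleftrightarrow> (\<lambda>\<alpha>. \<Prod>b\<in>insert b B. q b ^ \<alpha> b) summable_on (?J ` (UNIV \<times> (B \<rightarrow>\<^sub>E UNIV)))"
    by (rule summable_on_reindex[OF inj, symmetric])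
  finally show ?case by (simp add: PiE_insert_eq)
qed

text \<open>Expand in one variable; the coefficients are bounded separately holomorphic functions of
  the others, to which the induction hypothesis applies with bound M/s^k. The coefficient estimate
  is carried through the induction because it gives the absolute convergence needed to merge the
  iterated series.\<close>

theorem sep_holo_power_series:
  assumes "finite B" "0 < s" "s < r" "sep_holo B r M F"
  shows "\<exists>c. (\<forall>\<alpha>\<in>B \<rightarrow>\<^sub>E UNIV. norm (c \<alpha>) \<le> M * (\<Prod>b\<in>B. (1 / s) ^ \<alpha> b)) \<and>
     (\<forall>w\<in>polydisc B s. ((\<lambda>\<alpha>. c \<alpha> * (\<Prod>b\<in>B. w b ^ \<alpha> b)) has_sum F w) (B \<rightarrow>\<^sub>E (UNIV :: nat set)))"
  using assms(1,4)
proof (induction B arbitrary: M F rule: finite_induct)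
  case empty
  show ?case
    by (rule exI[of _ "\<lambda>_. F (\<lambda>_. 0)"])
      (use empty sep_holo_bound[OF empty, of "\<lambda>_. 0"] in \<open>auto simp: PiE_empty_domain intro!: has_sum_finiteI\<close>)
next
  case (insert b B)
  define a where "a k w = (deriv ^^ k) (\<lambda>\<zeta>. F (w(b := \<zeta>))) 0 / fact k" for k w
  have sep: "sep_holo B r (M / s ^ k) (a k)" for k
    unfolding a_def by (rule sep_holo_slice_deriv) (use insert assms in auto)
  have "\<forall>k. \<exists>c. (\<forall>\<alpha>\<in>B \<rightarrow>\<^sub>E UNIV. norm (c \<alpha>) \<le> M / s ^ k * (\<Prod>b\<in>B. (1 / s) ^ \<alpha> b)) \<and>
     (\<forall>w\<in>polydisc B s. ((\<lambda>\<alpha>. c \<alpha> * (\<Prod>b\<in>B. w b ^ \<alpha> b)) has_sum a k w) (B \<rightarrow>\<^sub>E UNIV))"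
    by (intro allI insert.IH sep)
  from choice[OF this] obtain c where
    c: "\<forall>k. (\<forall>\<alpha>\<in>B \<rightarrow>\<^sub>E UNIV. norm (c k \<alpha>) \<le> M / s ^ k * (\<Prod>b\<in>B. (1 / s) ^ \<alpha> b)) \<and>
     (\<forall>w\<in>polydisc B s. ((\<lambda>\<alpha>. c k \<alpha> * (\<Prod>b\<in>B. w b ^ \<alpha> b)) has_sum a k w) (B \<rightarrow>\<^sub>E UNIV))" ..
  have cb: "norm (c k \<alpha>) \<le> M / s ^ k * (\<Prod>b\<in>B. (1 / s) ^ \<alpha> b)" if "\<alpha> \<in> B \<rightarrow>\<^sub>E UNIV" for k \<alpha>
    using c that by simp
  have cs: "((\<lambda>\<alpha>. c k \<alpha> * (\<Prod>b\<in>B. w b ^ \<alpha> b)) has_sum a k w) (B \<rightarrow>\<^sub>E UNIV)" if "w \<in> polydisc B s" for k w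
    using c that by simp
  let ?J = "\<lambda>(k::nat, \<beta>). \<beta>(b := k)"
  let ?X = "(UNIV :: nat set) \<times> (B \<rightarrow>\<^sub>E (UNIV :: nat set))"
  have inj: "inj_on ?J ?X" using inj_combinator[OF insert(2), of "\<lambda>_. UNIV"] by simp
  have img: "?J ` ?X = insert b B \<rightarrow>\<^sub>E UNIV" by (simp add: PiE_insert_eq)
  \<comment> \<open>Multi-indices are extensional: resetting the value at \<open>b\<close> to
    \<open>undefined\<close> recovers the multi-index on \<open>B\<close>.\<close>
  define C where "C \<alpha> = c (\<alpha> b) (\<alpha>(b := undefined))" for \<alpha>
  have C: "C (\<beta>(b := k)) = c k \<beta>" if "\<beta> \<in> B \<rightarrow>\<^sub>E UNIV" for k \<beta>
  proof -
    have "\<beta> b = undefined" using that insert(2) by (auto simp: PiE_def extensional_def)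
    then have "\<beta>(b := undefined) = \<beta>" by (metis fun_upd_triv)
    then show ?thesis by (simp add: C_def)
  qed
  have bound: "norm (C (?J x)) \<le> M * (\<Prod>b\<in>insert b B. (1 / s) ^ (?J x) b)" if xX: "x \<in> ?X" for x
  proof -
    obtain k \<beta> where x: "x = (k, \<beta>)" "\<beta> \<in> B \<rightarrow>\<^sub>E UNIV" using xX by (cases x) auto
    have "norm (C (?J x)) \<le> M / s ^ k * (\<Prod>b\<in>B. (1 / s) ^ \<beta> b)"
      using cb[OF x(2)] by (simp add: x C)
    also have "\<dots> = M * ((1 / s) ^ k * (\<Prod>b\<in>B. (1 / s) ^ \<beta> b))" by (simp add: power_one_over)
    finally show ?thesis by (simp only: x prod.case prod_power_insert_upd[OF insert(1,2)])
  qed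
  show ?case
  proof (intro exI[of _ C] conjI ballI)
    fix \<alpha> :: "'a \<Rightarrow> nat" assume "\<alpha> \<in> insert b B \<rightarrow>\<^sub>E UNIV"
    then have "\<alpha> \<in> ?J ` ?X" unfolding img .
    then obtain x where x: "\<alpha> = ?J x" "x \<in> ?X" by (rule imageE)
    show "norm (C \<alpha>) \<le> M * (\<Prod>b\<in>insert b B. (1 / s) ^ \<alpha> b)" unfolding x(1) by (rule bound[OF x(2)])
  next
    fix w assume w: "w \<in> polydisc (insert b B) s"
    define w0 where "w0 = w(b := 0)"
    have w0: "w0 \<in> polydisc B s" unfolding w0_def by (rule polydisc_slice[OF w insert(2)])
    have w0r: "w0 \<in> polydisc (insert b B) r"
      using w assms polydisc_mono[of s r "insert b B"] by (auto simp: w0_def intro!: polydisc_upd)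
    have wb: "norm (w b) < s" using w by (auto simp: polydisc_def)
    have ww: "w0(b := w b) = w" by (auto simp: w0_def)
    have hol: "(\<lambda>\<zeta>. F (w0(b := \<zeta>))) holomorphic_on ball 0 r"
      by (rule sep_holo_coord[OF insert.prems w0r insertI1])
    have "(\<lambda>k. (deriv ^^ k) (\<lambda>\<zeta>. F (w0(b := \<zeta>))) 0 / fact k * (w b - 0) ^ k) sums F (w0(b := w b))"
      by (rule holomorphic_power_series[OF hol]) (use wb assms in auto)
    then have sm: "(\<lambda>k. a k w0 * w b ^ k) sums F w" unfolding ww by (simp add: a_def)
    have w0p: "w0 \<in> polydisc B r" using w0 polydisc_mono[of s r B] assms by auto
    have ab: "norm (a k w0) \<le> M / s ^ k" for k by (rule sep_holo_bound[OF sep w0p])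
    let ?q = "\<lambda>b. norm (w b) / s"
    have q: "0 \<le> ?q b' \<and> ?q b' < 1" if "b' \<in> insert b B" for b'
    proof -
      have "norm (w b') < s" by (rule polydiscD[OF w that])
      then show ?thesis using assms by auto
    qed
    have "summable (\<lambda>k. norm (a k w0 * w b ^ k))"
    proof (rule summable_comparison_test')
      show "summable (\<lambda>k. M * ?q b ^ k)"
        using q[of b] by (intro summable_mult summable_geometric) auto
      show "norm (norm (a k w0 * w b ^ k)) \<le> M * ?q b ^ k" if "0 \<le> k" for k
        using mult_right_mono[OF ab[of k], of "norm (w b) ^ k"] by (simp add: norm_mult norm_power power_divide)
    qed
    from norm_summable_imp_has_sum[OF this sm]
    have outer: "((\<lambda>k. a k w0 * w b ^ k) has_sum F w) UNIV" .
    let ?f = "\<lambda>(k, \<beta>). c k \<beta> * (\<Prod>b'\<in>B. w0 b' ^ \<beta> b') * w b ^ k"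
    have eqf: "?f x = ((\<lambda>\<alpha>. C \<alpha> * (\<Prod>b\<in>insert b B. w b ^ \<alpha> b)) \<circ> ?J) x" if xX: "x \<in> ?X" for x
    proof -
      obtain k \<beta> where x: "x = (k, \<beta>)" "\<beta> \<in> B \<rightarrow>\<^sub>E UNIV" using xX by (cases x) auto
      have "(\<Prod>b'\<in>B. w0 b' ^ \<beta> b') = (\<Prod>b'\<in>B. w b' ^ \<beta> b')" using insert(2) by (intro prod.cong) (auto simp: w0_def)
      then show ?thesis unfolding x o_def prod.case prod_power_insert_upd[OF insert(1,2)] C[OF x(2)] by simp
    qed
    \<comment> \<open>The coefficient bound dominates the family by a product of geometric series
      with ratios |w b|/s < 1. Summability over all pairs is what allows the iterated sum to be read
      as a sum over multi-indices.\<close>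
    have "(\<lambda>x. M * ((\<lambda>\<alpha>. \<Prod>b\<in>insert b B. ?q b ^ \<alpha> b) \<circ> ?J) x) summable_on ?X"
    proof (rule summable_on_cmult_right)
      have "(\<lambda>\<alpha>. \<Prod>b\<in>insert b B. ?q b ^ \<alpha> b) summable_on (?J ` ?X)"
        unfolding img by (rule summable_on_geometric_PiE) (use insert(1) q in auto)
      then show "((\<lambda>\<alpha>. \<Prod>b\<in>insert b B. ?q b ^ \<alpha> b) \<circ> ?J) summable_on ?X"
        by (rule summable_on_reindex[OF inj, THEN iffD1])
    qed
    then have "(\<lambda>x. norm (?f x)) summable_on ?X"
    proof (rule summable_on_comparison_test)
      fix x assume x: "x \<in> ?X"
      have "norm (?f x) = norm (C (?J x)) * (\<Prod>b\<in>insert b B. norm (w b) ^ (?J x) b)"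
        unfolding eqf[OF x] by (simp add: norm_mult norm_power flip: prod_norm del: prod.insert)
      also have "\<dots> \<le> M * (\<Prod>b\<in>insert b B. (1 / s) ^ (?J x) b) * (\<Prod>b\<in>insert b B. norm (w b) ^ (?J x) b)"
        by (intro mult_right_mono bound x prod_nonneg) auto
      also have "\<dots> = M * (\<Prod>b\<in>insert b B. ?q b ^ (?J x) b)"
        unfolding mult.assoc prod.distrib[symmetric] by (simp add: power_divide)
      finally show "norm (?f x) \<le> M * ((\<lambda>\<alpha>. \<Prod>b\<in>insert b B. ?q b ^ \<alpha> b) \<circ> ?J) x" by (simp only: o_def)
    qed auto
    then have "?f summable_on ?X" by (rule abs_summable_summable)
    moreover have "((\<lambda>\<beta>. ?f (k, \<beta>)) has_sum a k w0 * w b ^ k) (B \<rightarrow>\<^sub>E UNIV)" for k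
      using has_sum_cmult_left[OF cs[OF w0, of k], of "w b ^ k"] by simp
    ultimately have fs: "(?f has_sum F w) ?X"
      by (intro has_sum_SigmaI[where g = "\<lambda>k. a k w0 * w b ^ k", OF _ outer])
    have "(?f has_sum F w) ?X \<longleftrightarrow> ((\<lambda>\<alpha>. C \<alpha> * (\<Prod>b\<in>insert b B. w b ^ \<alpha> b)) \<circ> ?J has_sum F w) ?X"
      by (rule has_sum_cong) (rule eqf)
    with fs have "(((\<lambda>\<alpha>. C \<alpha> * (\<Prod>b\<in>insert b B. w b ^ \<alpha> b)) \<circ> ?J) has_sum F w) ?X"
      by (rule iffD1[rotated])
    then show "((\<lambda>\<alpha>. C \<alpha> * (\<Prod>b\<in>insert b B. w b ^ \<alpha> b)) has_sum F w) (insert b B \<rightarrow>\<^sub>E UNIV)"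
      unfolding img[symmetric] by (rule has_sum_reindex[OF inj, THEN iffD2])
  qed
qed

text \<open>The partial sums form a net over finite sets of multi-indices. The M-test along this net
  gives a uniform limit, and uniform limits of holomorphic functions are holomorphic.\<close>

lemma power_series_compose:
  fixes c :: "('i \<Rightarrow> nat) \<Rightarrow> complex"
  assumes sm: "(\<lambda>\<alpha>. norm (c \<alpha>) * (\<Prod>b\<in>B. s ^ \<alpha> b)) summable_on (B \<rightarrow>\<^sub>E UNIV)" and "0 \<le> s"
    and "open S" and hol: "\<And>b. b \<in> B \<Longrightarrow> G b holomorphic_on S"
    and bd: "\<And>b \<zeta>. b \<in> B \<Longrightarrow> \<zeta> \<in> S \<Longrightarrow> norm (G b \<zeta>) \<le> s"
  shows "(\<lambda>\<zeta>. \<Sum>\<^sub>\<infinity>\<alpha>\<in>B \<rightarrow>\<^sub>E UNIV. c \<alpha> * (\<Prod>b\<in>B. G b \<zeta> ^ \<alpha> b)) holomorphic_on S"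
proof -
  let ?g = "\<lambda>\<zeta>. \<Sum>\<^sub>\<infinity>\<alpha>\<in>B \<rightarrow>\<^sub>E UNIV. c \<alpha> * (\<Prod>b\<in>B. G b \<zeta> ^ \<alpha> b)"
  let ?f = "\<lambda>X \<zeta>. \<Sum>\<alpha>\<in>X. c \<alpha> * (\<Prod>b\<in>B. G b \<zeta> ^ \<alpha> b)"
  have ul: "uniform_limit S ?f ?g (finite_subsets_at_top (B \<rightarrow>\<^sub>E UNIV))"
  proof (rule Weierstrass_m_test_general[OF _ sm])
    fix \<alpha> \<zeta> assume "\<zeta> \<in> S"
    then show "norm (c \<alpha> * (\<Prod>b\<in>B. G b \<zeta> ^ \<alpha> b)) \<le> norm (c \<alpha>) * (\<Prod>b\<in>B. s ^ \<alpha> b)"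
      unfolding norm_mult prod_norm[symmetric] norm_power
      by (intro mult_left_mono prod_mono conjI power_mono bd norm_ge_zero zero_le_power)
  qed
  have fh: "?f X holomorphic_on S" for X
    by (rule holomorphic_on_sum, rule holomorphic_on_mult[OF holomorphic_on_const],
        rule holomorphic_on_prod, rule holomorphic_on_power, erule hol)
  have "?g field_differentiable (at x)" if x: "x \<in> S" for x
  proof -
    obtain d where d: "0 < d" "cball x d \<subseteq> S" using x \<open>open S\<close> open_contains_cball by blast
    have bc: "ball x d \<subseteq> S" using d ball_subset_cball by blast
    have ul': "uniform_limit (cball x d) ?f ?g (finite_subsets_at_top (B \<rightarrow>\<^sub>E UNIV))"
      by (rule uniform_limit_on_subset[OF ul d(2)])
    have c: "continuous_on (cball x d) (?f X)" for X
      by (rule continuous_on_subset[OF holomorphic_on_imp_continuous_on[OF fh] d(2)])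
    have h: "?f X holomorphic_on ball x d" for X by (rule holomorphic_on_subset[OF fh bc])
    have ev: "\<forall>\<^sub>F X in finite_subsets_at_top (B \<rightarrow>\<^sub>E UNIV). continuous_on (cball x d) (?f X) \<and> ?f X holomorphic_on ball x d"
      using c h by (intro always_eventually allI conjI)
    have "?g holomorphic_on ball x d"
      by (rule holomorphic_uniform_limit[OF ev ul' finite_subsets_at_top_neq_bot])
    moreover have "x \<in> ball x d" using d by simp
    ultimately show ?thesis by (rule holomorphic_on_imp_differentiable_at[OF _ open_ball])
  qed
  then show ?thesis unfolding holomorphic_on_def using field_differentiable_at_within by blast
qed

section \<open>First-order approximation at the centre of a polydisc\<close>

lemma sep_holo_lipschitz:
  assumes "finite B" "0 < r" "sep_holo B r M F"
  shows "\<exists>C\<ge>0. \<forall>w\<in>polydisc B (r/4). norm (F w - F (\<lambda>_. 0)) \<le> C * (\<Sum>b\<in>B. norm (w b))"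
  using assms(1,3)
proof (induction B arbitrary: F rule: finite_induct)
  case empty
  then show ?case by auto
next
  case (insert b B)
  have "sep_holo B r M F" by (rule sep_holo_slice) (use insert assms in auto)
  then obtain C where C: "C \<ge> 0" "\<And>w. w \<in> polydisc B (r/4) \<Longrightarrow> norm (F w - F (\<lambda>_. 0)) \<le> C * (\<Sum>b\<in>B. norm (w b))"
    using insert.IH by blast
  have M: "0 \<le> M" using sep_holo_bound[OF insert.prems zero_in_polydisc] assms by (metis norm_ge_zero order_trans)
  show ?case
  proof (intro exI[of _ "C + 4 * M / r"] conjI ballI)
    show "0 \<le> C + 4 * M / r" using C M assms by auto
    fix w assume w: "w \<in> polydisc (insert b B) (r/4)"
    define w0 where "w0 = w(b := 0)"
    have w0: "w0 \<in> polydisc B (r/4)" unfolding w0_def by (rule polydisc_slice[OF w insert(2)])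
    have 1: "norm (F w - F w0) \<le> 4 * M / r * norm (w b)"
      unfolding w0_def by (rule sep_holo_taylor1[OF insert.prems assms(2) w insertI1])
    have 2: "norm (F w0 - F (\<lambda>_. 0)) \<le> C * (\<Sum>b\<in>B. norm (w b))"
    proof -
      have "(\<Sum>b\<in>B. norm (w0 b)) = (\<Sum>b\<in>B. norm (w b))"
        using insert(2) by (intro sum.cong) (auto simp: w0_def)
      then show ?thesis using C(2)[OF w0] by simp
    qed
    have "norm (F w - F (\<lambda>_. 0)) \<le> norm (F w - F w0) + norm (F w0 - F (\<lambda>_. 0))" by norm
    also have "\<dots> \<le> 4 * M / r * norm (w b) + C * (\<Sum>b\<in>B. norm (w b))" using 1 2 by linarith
    also have "\<dots> \<le> (C + 4 * M / r) * (norm (w b) + (\<Sum>b\<in>B. norm (w b)))"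
    proof -
      have "0 \<le> 4 * M / r" "0 \<le> (\<Sum>b\<in>B. norm (w b))" using M assms by (auto intro: sum_nonneg)
      from mult_nonneg_nonneg[OF this]
      have "0 \<le> C * norm (w b)" "0 \<le> 4 * M / r * (\<Sum>b\<in>B. norm (w b))" using C by auto
      then show ?thesis by (simp add: algebra_simps)
    qed
    finally show "norm (F w - F (\<lambda>_. 0)) \<le> (C + 4 * M / r) * (\<Sum>b\<in>insert b B. norm (w b))"
      using insert by simp
  qed
qed

text \<open>Coordinates are switched off one after another. Each step leaves a second-order Taylor
  error and a linear coefficient that still depends on the other coordinates; replacing it by its
  value at 0 is again a quadratic error, by the Lipschitz estimate for that coefficient.\<close>

lemma sep_holo_linear_approx:
  assumes "finite B" "0 < r" "sep_holo B r M F"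
  shows "\<exists>l. \<exists>C\<ge>0. \<forall>w\<in>polydisc B (r/4).
    norm (F w - F (\<lambda>_. 0) - (\<Sum>b\<in>B. l b * w b)) \<le> C * (\<Sum>b\<in>B. norm (w b))\<^sup>2"
  using assms(1,3)
proof (induction B arbitrary: M F rule: finite_induct)
  case empty
  then show ?case by auto
next
  case (insert b B)
  let ?S = "\<lambda>w. \<Sum>b\<in>B. norm (w b)"
  have F: "sep_holo B r M F" by (rule sep_holo_slice) (use insert assms in auto)
  define a where "a w = (deriv ^^ 1) (\<lambda>\<zeta>. F (w(b := \<zeta>))) 0 / fact 1" for w
  have "sep_holo B r (M / (r/2) ^ 1) a"
    unfolding a_def by (rule sep_holo_slice_deriv) (use insert assms in auto)
  from sep_holo_lipschitz[OF insert(1) assms(2) this]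
  obtain C1 where C1: "C1 \<ge> 0" "\<And>w. w \<in> polydisc B (r/4) \<Longrightarrow> norm (a w - a (\<lambda>_. 0)) \<le> C1 * ?S w"
    by blast
  obtain l C where C: "C \<ge> 0"
    "\<And>w. w \<in> polydisc B (r/4) \<Longrightarrow> norm (F w - F (\<lambda>_. 0) - (\<Sum>b\<in>B. l b * w b)) \<le> C * (?S w)\<^sup>2"
    using insert.IH[OF F] by auto
  have M: "0 \<le> M" using sep_holo_bound[OF insert.prems zero_in_polydisc] assms by (metis norm_ge_zero order_trans)
  define C2 where "C2 = 2 * M * (2 / r)\<^sup>2"
  have C2: "C2 \<ge> 0" using M by (simp add: C2_def)
  show ?case
  proof (intro exI[of _ "l(b := a (\<lambda>_. 0))"] exI[of _ "C + C1 + C2"] conjI ballI)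
    show "0 \<le> C + C1 + C2" using C C1 C2 by auto
    fix w assume w: "w \<in> polydisc (insert b B) (r/4)"
    define w0 where "w0 = w(b := 0)"
    have w0: "w0 \<in> polydisc B (r/4)" unfolding w0_def by (rule polydisc_slice[OF w insert(2)])
    have S0: "?S w0 = ?S w" using insert(2) by (intro sum.cong) (auto simp: w0_def)
    have L0: "(\<Sum>b\<in>B. l b * w0 b) = (\<Sum>b\<in>B. l b * w b)" using insert(2) by (intro sum.cong) (auto simp: w0_def)
    have 1: "norm (F w - F w0 - a w0 * w b) \<le> C2 * (norm (w b))\<^sup>2"
    proof -
      have "a w0 = deriv (\<lambda>\<zeta>. F (w(b := \<zeta>))) 0" by (simp add: a_def w0_def)
      then show ?thesis unfolding C2_def w0_def
        using sep_holo_taylor2[OF insert.prems assms(2) w insertI1] by (simp only:)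
    qed
    have 2: "norm (F w0 - F (\<lambda>_. 0) - (\<Sum>b\<in>B. l b * w b)) \<le> C * (?S w)\<^sup>2"
      using C(2)[OF w0] by (simp add: S0 L0)
    have 3: "norm ((a w0 - a (\<lambda>_. 0)) * w b) \<le> C1 * ?S w * norm (w b)"
      using C1(2)[OF w0] by (simp add: norm_mult mult_right_mono S0)
    have S: "(\<Sum>b'\<in>insert b B. (l(b := a (\<lambda>_. 0))) b' * w b') = a (\<lambda>_. 0) * w b + (\<Sum>b\<in>B. l b * w b)"
      using insert(1,2) by (auto intro!: sum.cong)
    have "F w - F (\<lambda>_. 0) - (\<Sum>b'\<in>insert b B. (l(b := a (\<lambda>_. 0))) b' * w b') =
      (F w - F w0 - a w0 * w b) + (F w0 - F (\<lambda>_. 0) - (\<Sum>b\<in>B. l b * w b)) + (a w0 - a (\<lambda>_. 0)) * w b"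
      unfolding S by (simp add: algebra_simps)
    then have "norm (F w - F (\<lambda>_. 0) - (\<Sum>b'\<in>insert b B. (l(b := a (\<lambda>_. 0))) b' * w b')) \<le>
      C2 * (norm (w b))\<^sup>2 + C * (?S w)\<^sup>2 + C1 * ?S w * norm (w b)"
      by (simp only:) (intro norm_triangle_mono 1 2 3)
    also have "\<dots> \<le> (C + C1 + C2) * (norm (w b) + ?S w)\<^sup>2"
    proof -
      have S: "0 \<le> ?S w" by (simp add: sum_nonneg)
      have "(norm (w b))\<^sup>2 \<le> (norm (w b) + ?S w)\<^sup>2" "(?S w)\<^sup>2 \<le> (norm (w b) + ?S w)\<^sup>2"
        using S by (auto intro!: power_mono)
      moreover have "?S w * norm (w b) \<le> (norm (w b) + ?S w)\<^sup>2"
        using S by (simp add: power2_eq_square algebra_simps)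
      ultimately have "C2 * (norm (w b))\<^sup>2 \<le> C2 * (norm (w b) + ?S w)\<^sup>2" "C * (?S w)\<^sup>2 \<le> C * (norm (w b) + ?S w)\<^sup>2"
        "C1 * (?S w * norm (w b)) \<le> C1 * (norm (w b) + ?S w)\<^sup>2"
        using C C1 C2 by (auto intro!: mult_left_mono)
      then show ?thesis by (simp add: algebra_simps)
    qed
    finally show "norm (F w - F (\<lambda>_. 0) - (\<Sum>b'\<in>insert b B. (l(b := a (\<lambda>_. 0))) b' * w b')) \<le>
      (C + C1 + C2) * (\<Sum>b\<in>insert b B. norm (w b))\<^sup>2"
      using insert by simp
  qed
qed

section \<open>Holomorphic extensions of real-analytic functions\<close>

text \<open>Separate holomorphy speaks of coordinate directions only; substituting into the power
  series extends it to every holomorphic curve. Complex lines and composition of extensions are both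
  treated this way.\<close>

lemma sep_holo_curve:
  assumes "finite B" and F: "sep_holo B r M F" and t: "0 \<le> t" "t < r" and "open S"
    and hol: "\<And>b. b \<in> B \<Longrightarrow> G b holomorphic_on S"
    and bd: "\<And>b \<zeta>. b \<in> B \<Longrightarrow> \<zeta> \<in> S \<Longrightarrow> norm (G b \<zeta>) \<le> t"
  shows "(\<lambda>\<zeta>. F (\<lambda>b. if b \<in> B then G b \<zeta> else 0)) holomorphic_on S"
proof -
  \<comment> \<open>Strictly between \<open>t\<close> and \<open>r\<close>: the coefficients are of
    size s^-|\<alpha>| and the monomials on the curve of size t^|\<alpha>|, so the majorant is
    geometric with ratio t/s < 1.\<close>
  define s where "s = (t + r) / 2"
  have s: "t < s" "0 < s" "s < r" using t by (auto simp: s_def)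
  obtain c where cb: "\<And>\<alpha>. \<alpha> \<in> B \<rightarrow>\<^sub>E UNIV \<Longrightarrow> norm (c \<alpha>) \<le> M * (\<Prod>b\<in>B. (1 / s) ^ \<alpha> b)"
    and cs: "\<And>w. w \<in> polydisc B s \<Longrightarrow> ((\<lambda>\<alpha>. c \<alpha> * (\<Prod>b\<in>B. w b ^ \<alpha> b)) has_sum F w) (B \<rightarrow>\<^sub>E UNIV)"
    using sep_holo_power_series[OF assms(1) s(2,3) F] by auto
  have "(\<lambda>\<alpha>. norm (c \<alpha>) * (\<Prod>b\<in>B. t ^ \<alpha> b)) summable_on (B \<rightarrow>\<^sub>E UNIV)"
  proof (rule summable_on_comparison_test)
    show "(\<lambda>\<alpha>. M * (\<Prod>b\<in>B. (t / s) ^ \<alpha> b)) summable_on (B \<rightarrow>\<^sub>E UNIV)"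
      by (intro summable_on_cmult_right summable_on_geometric_PiE) (use assms s in auto)
    fix \<alpha> assume \<alpha>: "\<alpha> \<in> B \<rightarrow>\<^sub>E (UNIV :: nat set)"
    have "norm (c \<alpha>) * (\<Prod>b\<in>B. t ^ \<alpha> b) \<le> M * (\<Prod>b\<in>B. (1 / s) ^ \<alpha> b) * (\<Prod>b\<in>B. t ^ \<alpha> b)"
      by (intro mult_right_mono cb \<alpha> prod_nonneg) (use t in auto)
    also have "\<dots> = M * (\<Prod>b\<in>B. (t / s) ^ \<alpha> b)"
      unfolding mult.assoc prod.distrib[symmetric] by (simp add: power_divide)
    finally show "norm (c \<alpha>) * (\<Prod>b\<in>B. t ^ \<alpha> b) \<le> M * (\<Prod>b\<in>B. (t / s) ^ \<alpha> b)" .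
    show "0 \<le> norm (c \<alpha>) * (\<Prod>b\<in>B. t ^ \<alpha> b)" using t by (intro mult_nonneg_nonneg prod_nonneg) auto
  qed
  from power_series_compose[where G = G, OF this t(1) \<open>open S\<close> hol bd]
  have "(\<lambda>\<zeta>. \<Sum>\<^sub>\<infinity>\<alpha>\<in>B \<rightarrow>\<^sub>E UNIV. c \<alpha> * (\<Prod>b\<in>B. G b \<zeta> ^ \<alpha> b)) holomorphic_on S" by blast
  moreover have "(\<Sum>\<^sub>\<infinity>\<alpha>\<in>B \<rightarrow>\<^sub>E UNIV. c \<alpha> * (\<Prod>b\<in>B. G b \<zeta> ^ \<alpha> b)) = F (\<lambda>b. if b \<in> B then G b \<zeta> else 0)"
    if "\<zeta> \<in> S" for \<zeta>
  proof -
    have "(\<lambda>b. if b \<in> B then G b \<zeta> else 0) \<in> polydisc B s"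
      using bd[OF _ that] s by (intro polydiscI) (auto intro: le_less_trans)
    from infsumI[OF cs[OF this]] show ?thesis by simp
  qed
  ultimately show ?thesis by (rule holomorphic_transform)
qed

text \<open>The embedding of the real space into its complexification, whose coordinates are indexed
  by the basis vectors themselves.\<close>

definition coords :: "'a::euclidean_space \<Rightarrow> 'a \<Rightarrow> complex" where
  "coords v = (\<lambda>b. if b \<in> Basis then of_real (v \<bullet> b) else 0)"

lemma coords_0 [simp]: "coords 0 = (\<lambda>_. 0)"
  by (auto simp: coords_def)

lemma coords_polydisc: "norm v < r \<Longrightarrow> coords v \<in> polydisc Basis r"
  by (rule polydiscI) (auto simp: coords_def intro: le_less_trans[OF Basis_le_norm])

lemma norm_le_polydisc:
  fixes v :: "'a::euclidean_space"
  assumes "coords v \<in> polydisc Basis r" shows "norm v < real (DIM('a)) * r"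
proof -
  have "norm v \<le> (\<Sum>b\<in>Basis. \<bar>v \<bullet> b\<bar>)" by (rule norm_le_l1)
  also have "\<dots> < (\<Sum>b\<in>(Basis::'a set). r)"
    by (rule sum_strict_mono) (use polydiscD[OF assms] in \<open>auto simp: coords_def\<close>)
  finally show ?thesis by simp
qed

text \<open>\<open>F\<close> extends \<open>f\<close> from the real points near \<open>p\<close> to
  a complex neighbourhood. Existence of such an extension is equivalent to analyticity at
  \<open>p\<close>, and the closure properties are proved on this side of the equivalence.\<close>

definition holo_ext :: "('a::euclidean_space \<Rightarrow> real) \<Rightarrow> 'a \<Rightarrow> real \<Rightarrow> real \<Rightarrow> (('a \<Rightarrow> complex) \<Rightarrow> complex) \<Rightarrow> bool" where
  "holo_ext f p r M F \<longleftrightarrow> 0 < r \<and> sep_holo Basis r M F \<and>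
     (\<forall>v. coords v \<in> polydisc Basis r \<longrightarrow> F (coords v) = of_real (f (p + v)))"

text \<open>Unconditional convergence at a single real point, the corner of a cube with all
  coordinates equal to \<open>s\<close>, is absolute and hence majorizes the series on the complex
  polydisc of radius \<open>s\<close>.\<close>

lemma real_analytic_imp_holo_ext:
  fixes f :: "'a::euclidean_space \<Rightarrow> real"
  assumes "real_analytic_at f p"
  obtains r M F where "holo_ext f p r M F"
proof -
  obtain r c where r: "r > 0" and
    c: "\<And>x. x \<in> ball p r \<Longrightarrow> ((\<lambda>\<alpha>. c \<alpha> * (\<Prod>b\<in>Basis. ((x - p) \<bullet> b) ^ \<alpha> b)) has_sum f x) (Basis \<rightarrow>\<^sub>E UNIV)"
    using assms unfolding real_analytic_at_def by blast
  \<comment> \<open>Points with all coordinates at most \<open>s\<close> in modulus have norm at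
    most DIM('a) * s = r/2, so the real cube stays inside the ball of convergence.\<close>
  define s where "s = r / (2 * real (DIM('a)))"
  have s: "0 < s" using r by (simp add: s_def)
  have ds: "real (DIM('a)) * s < r" using r by (simp add: s_def)
  define x where "x = p + (\<Sum>b\<in>Basis. s *\<^sub>R b)"
  have xb: "(x - p) \<bullet> b = s" if "b \<in> Basis" for b
    using that by (simp add: x_def)
  have "norm (x - p) \<le> (\<Sum>b\<in>(Basis :: 'a set). s)"
    unfolding x_def add_diff_cancel_left' by (rule sum_norm_le) (use s in simp)
  then have "x \<in> ball p r" using ds by (simp add: dist_norm norm_minus_commute)
  from c[OF this] have "((\<lambda>\<alpha>. c \<alpha> * (\<Prod>b\<in>Basis. s ^ \<alpha> b)) has_sum f x) (Basis \<rightarrow>\<^sub>E UNIV)"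
    by (simp add: xb cong: prod.cong)
  then have "(\<lambda>\<alpha>. c \<alpha> * (\<Prod>b\<in>Basis. s ^ \<alpha> b)) summable_on (Basis \<rightarrow>\<^sub>E UNIV)" by (auto simp: summable_on_def)
  then have "(\<lambda>\<alpha>. \<bar>c \<alpha> * (\<Prod>b\<in>Basis. s ^ \<alpha> b)\<bar>) summable_on (Basis \<rightarrow>\<^sub>E UNIV)"
    using summable_on_iff_abs_summable_on_real[of "\<lambda>\<alpha>. c \<alpha> * (\<Prod>b\<in>Basis. s ^ \<alpha> b)"] by simp
  moreover have "\<bar>c \<alpha> * (\<Prod>b\<in>Basis. s ^ \<alpha> b)\<bar> = norm (complex_of_real (c \<alpha>)) * (\<Prod>b\<in>Basis. s ^ \<alpha> b)" for \<alpha>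
    using s by (simp add: abs_mult abs_prod)
  ultimately have sm: "(\<lambda>\<alpha>. norm (complex_of_real (c \<alpha>)) * (\<Prod>b\<in>Basis. s ^ \<alpha> b)) summable_on (Basis \<rightarrow>\<^sub>E UNIV)"
    by simp
  define M where "M = (\<Sum>\<^sub>\<infinity>\<alpha>\<in>Basis \<rightarrow>\<^sub>E UNIV. norm (complex_of_real (c \<alpha>)) * (\<Prod>b\<in>Basis. s ^ \<alpha> b))"
  define F where "F w = (\<Sum>\<^sub>\<infinity>\<alpha>\<in>Basis \<rightarrow>\<^sub>E UNIV. complex_of_real (c \<alpha>) * (\<Prod>b\<in>Basis. w b ^ \<alpha> b))" for w
  have "sep_holo Basis s M F"
    unfolding sep_holo_def
  proof (intro ballI conjI)
    fix w :: "'a \<Rightarrow> complex" assume w: "w \<in> polydisc Basis s"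
    have le: "norm (complex_of_real (c \<alpha>) * (\<Prod>b\<in>Basis. w b ^ \<alpha> b)) \<le>
       norm (complex_of_real (c \<alpha>)) * (\<Prod>b\<in>Basis. s ^ \<alpha> b)" for \<alpha>
      unfolding norm_mult prod_norm[symmetric] norm_power
      using polydiscD[OF w] by (intro mult_left_mono prod_mono conjI power_mono zero_le_power norm_ge_zero less_imp_le)
    then have as: "(\<lambda>\<alpha>. norm (complex_of_real (c \<alpha>) * (\<Prod>b\<in>Basis. w b ^ \<alpha> b))) summable_on (Basis \<rightarrow>\<^sub>E UNIV)"
      by (intro summable_on_comparison_test[OF sm]) auto
    have "norm (F w) \<le> (\<Sum>\<^sub>\<infinity>\<alpha>\<in>Basis \<rightarrow>\<^sub>E UNIV. norm (complex_of_real (c \<alpha>) * (\<Prod>b\<in>Basis. w b ^ \<alpha> b)))"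
      unfolding F_def by (rule norm_infsum_bound[OF as])
    also have "\<dots> \<le> M" unfolding M_def by (rule infsum_mono[OF as sm le])
    finally show "norm (F w) \<le> M" .
    fix b :: 'a assume b: "b \<in> Basis"
    have "(\<lambda>\<zeta>. \<Sum>\<^sub>\<infinity>\<alpha>\<in>Basis \<rightarrow>\<^sub>E UNIV. complex_of_real (c \<alpha>) * (\<Prod>b'\<in>Basis. (if b' = b then \<zeta> else w b') ^ \<alpha> b'))
      holomorphic_on ball 0 s"
    proof (rule power_series_compose[OF sm])
      show "(\<lambda>\<zeta>. if b' = b then \<zeta> else w b') holomorphic_on ball 0 s" for b'
        by (cases "b' = b") (auto intro: holomorphic_intros)
      show "norm (if b' = b then \<zeta> else w b') \<le> s" if "b' \<in> Basis" "\<zeta> \<in> ball 0 s" for b' \<zeta>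
        using that polydiscD[OF w, of b'] by auto
    qed (use s in auto)
    then show "(\<lambda>\<zeta>. F (w(b := \<zeta>))) holomorphic_on ball 0 s" by (simp add: F_def fun_upd_def)
  qed
  moreover have "F (coords v) = of_real (f (p + v))" if "coords v \<in> polydisc Basis s" for v
  proof -
    have "p + v \<in> ball p r" using norm_le_polydisc[OF that] ds by (simp add: dist_norm)
    from has_sum_of_real[OF c[OF this], where 'a = complex]
    have "((\<lambda>\<alpha>. complex_of_real (c \<alpha>) * (\<Prod>b\<in>Basis. coords v b ^ \<alpha> b)) has_sum of_real (f (p + v))) (Basis \<rightarrow>\<^sub>E UNIV)"
      by (simp add: coords_def cong: prod.cong)
    then show ?thesis unfolding F_def by (rule infsumI)
  qed
  ultimately have "holo_ext f p s M F" using s by (auto simp: holo_ext_def)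
  then show ?thesis by (rule that)
qed

lemma holo_ext_imp_real_analytic:
  fixes f :: "'a::euclidean_space \<Rightarrow> real"
  assumes "holo_ext f p r M F" shows "real_analytic_at f p"
proof -
  have r: "0 < r" and F: "sep_holo Basis r M F"
    and v: "\<And>v. coords v \<in> polydisc Basis r \<Longrightarrow> F (coords v) = of_real (f (p + v))"
    using assms by (auto simp: holo_ext_def)
  define s where "s = r / 2"
  have s: "0 < s" "s < r" using r by (auto simp: s_def)
  obtain c where cs: "\<And>w. w \<in> polydisc Basis s \<Longrightarrow> ((\<lambda>\<alpha>. c \<alpha> * (\<Prod>b\<in>Basis. w b ^ \<alpha> b)) has_sum F w) (Basis \<rightarrow>\<^sub>E UNIV)"
    using sep_holo_power_series[OF finite_Basis s F] by auto
  show ?thesis unfolding real_analytic_at_def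
  \<comment> \<open>At real points both the monomials and the value are real, so the real parts of
    the complex coefficients represent \<open>f\<close>.\<close>
  proof (intro exI[of _ s] exI[of _ "\<lambda>\<alpha>. Re (c \<alpha>)"] conjI ballI s)
    fix x assume "x \<in> ball p s"
    then have n: "norm (x - p) < s" by (simp add: dist_norm norm_minus_commute)
    have "F (coords (x - p)) = of_real (f x)" using v[OF coords_polydisc, of "x - p"] n s by simp
    with cs[OF coords_polydisc[OF n]]
    have "((\<lambda>\<alpha>. c \<alpha> * (\<Prod>b\<in>Basis. coords (x - p) b ^ \<alpha> b)) has_sum of_real (f x)) (Basis \<rightarrow>\<^sub>E UNIV)" by simp
    from has_sum_Re[OF this]
    have "((\<lambda>\<alpha>. Re (c \<alpha> * (\<Prod>b\<in>Basis. coords (x - p) b ^ \<alpha> b))) has_sum f x) (Basis \<rightarrow>\<^sub>E UNIV)" by simp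
    moreover have "Re (c \<alpha> * (\<Prod>b\<in>Basis. coords (x - p) b ^ \<alpha> b)) = Re (c \<alpha>) * (\<Prod>b\<in>Basis. ((x - p) \<bullet> b) ^ \<alpha> b)" for \<alpha>
    proof -
      have "(\<Prod>b\<in>Basis. coords (x - p) b ^ \<alpha> b) = complex_of_real (\<Prod>b\<in>Basis. ((x - p) \<bullet> b) ^ \<alpha> b)"
        by (simp add: coords_def cong: prod.cong)
      then show ?thesis by (simp del: of_real_prod)
    qed
    ultimately show "((\<lambda>\<alpha>. Re (c \<alpha>) * (\<Prod>b\<in>Basis. ((x - p) \<bullet> b) ^ \<alpha> b)) has_sum f x) (Basis \<rightarrow>\<^sub>E UNIV)"
      by simp
  qed
qed

section \<open>Derivatives of real-analytic functions\<close>

lemma has_derivative_quadratic_remainder: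
  fixes f :: "'a::real_normed_vector \<Rightarrow> 'b::real_normed_vector"
  assumes "bounded_linear f'" "0 < d" and C: "\<And>v. norm v < d \<Longrightarrow> norm (f (p + v) - f p - f' v) \<le> C * (norm v)\<^sup>2"
  shows "(f has_derivative f') (at p)"
  unfolding has_derivative_at_alt
proof (intro conjI allI impI assms)
  fix e :: real assume e: "e > 0"
  have k: "0 < e / (\<bar>C\<bar> + 1)" using e by (intro divide_pos_pos) auto
  show "\<exists>d>0. \<forall>y. norm (y - p) < d \<longrightarrow> norm (f y - f p - f' (y - p)) \<le> e * norm (y - p)"
  proof (intro exI[of _ "min d (e / (\<bar>C\<bar> + 1))"] conjI allI impI)
    show "0 < min d (e / (\<bar>C\<bar> + 1))" using k assms by simp
    fix y assume y: "norm (y - p) < min d (e / (\<bar>C\<bar> + 1))"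
    have "norm (f y - f p - f' (y - p)) \<le> C * (norm (y - p))\<^sup>2" using C[of "y - p"] y by simp
    also have "\<dots> \<le> (\<bar>C\<bar> + 1) * (norm (y - p))\<^sup>2" by (intro mult_right_mono) auto
    also have "\<dots> = ((\<bar>C\<bar> + 1) * norm (y - p)) * norm (y - p)" by (simp add: power2_eq_square)
    also have "\<dots> \<le> e * norm (y - p)"
      using y by (intro mult_right_mono) (auto simp: field_simps)
    finally show "norm (f y - f p - f' (y - p)) \<le> e * norm (y - p)" .
  qed
qed

lemma real_analytic_imp_differentiable:
  fixes f :: "'a::euclidean_space \<Rightarrow> real"
  assumes "real_analytic_at f p" shows "f differentiable at p"
proof -
  obtain r M F where "holo_ext f p r M F" using real_analytic_imp_holo_ext[OF assms] by blast
  then have r: "0 < r" and F: "sep_holo Basis r M F"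
    and v: "\<And>v. coords v \<in> polydisc Basis r \<Longrightarrow> F (coords v) = of_real (f (p + v))"
    by (auto simp: holo_ext_def)
  obtain l C where C: "0 \<le> C" "\<And>w. w \<in> polydisc Basis (r/4) \<Longrightarrow>
    norm (F w - F (\<lambda>_. 0) - (\<Sum>b\<in>Basis. l b * w b)) \<le> C * (\<Sum>b\<in>Basis. norm (w b))\<^sup>2"
    using sep_holo_linear_approx[OF finite_Basis r F] by auto
  define f' where "f' v = (\<Sum>b\<in>Basis. Re (l b) * (v \<bullet> b))" for v
  have "(f has_derivative f') (at p)"
  proof (rule has_derivative_quadratic_remainder[where d = "r/4" and C = "C * (real DIM('a))\<^sup>2"])
    show "bounded_linear f'" unfolding f'_def
      by (intro bounded_linear_sum bounded_linear_const_mult bounded_linear_inner_left)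
    fix u :: 'a assume u: "norm u < r/4"
    have F0: "F (\<lambda>_. 0) = of_real (f p)" using v[of 0] r zero_in_polydisc by force
    have Fu: "F (coords u) = of_real (f (p + u))" using v[OF coords_polydisc] u r by auto
    have "(\<Sum>b\<in>Basis. l b * coords u b) = (\<Sum>b\<in>Basis. l b * of_real (u \<bullet> b))"
      by (intro sum.cong) (auto simp: coords_def)
    then have "\<bar>f (p + u) - f p - f' u\<bar> = \<bar>Re (F (coords u) - F (\<lambda>_. 0) - (\<Sum>b\<in>Basis. l b * coords u b))\<bar>"
      by (simp add: F0 Fu f'_def)
    also have "\<dots> \<le> C * (\<Sum>b\<in>Basis. norm (coords u b))\<^sup>2"
      using C(2)[OF coords_polydisc[OF u]] abs_Re_le_cmod order_trans by blast
    also have "(\<Sum>b\<in>Basis. norm (coords u b)) \<le> (\<Sum>b\<in>(Basis::'a set). norm u)"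
      by (intro sum_mono) (auto simp: coords_def Basis_le_norm)
    then have "C * (\<Sum>b\<in>Basis. norm (coords u b))\<^sup>2 \<le> C * (real DIM('a) * norm u)\<^sup>2"
      using C(1) by (intro mult_left_mono power_mono sum_nonneg) auto
    finally show "norm (f (p + u) - f p - f' u) \<le> C * (real DIM('a))\<^sup>2 * (norm u)\<^sup>2"
      by (simp add: power_mult_distrib mult.assoc)
  qed (use r in auto)
  then show ?thesis by (auto simp: differentiable_def)
qed

lemma coords_add_Basis:
  assumes "b \<in> Basis" shows "coords (v + t *\<^sub>R b) = (coords v)(b := of_real (v \<bullet> b + t))"
  using assms by (auto simp: coords_def inner_add_left inner_Basis fun_eq_iff)

text \<open>The complex derivative in a coordinate may be computed along the real line, where the
  extension coincides with \<open>f\<close>; uniqueness of the derivative identifies it with the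
  real partial derivative.\<close>

lemma dcoord_holo_ext:
  fixes f :: "'a::euclidean_space \<Rightarrow> real"
  assumes ext: "holo_ext f p r M F" and v: "coords v \<in> polydisc Basis r" and f: "f differentiable at (p + v)"
    and b: "b \<in> Basis"
  shows "dcoord b F (coords v) = of_real (frechet_derivative f (at (p + v)) b)"
proof -
  have F: "sep_holo Basis r M F"
    and e: "\<And>v. coords v \<in> polydisc Basis r \<Longrightarrow> F (coords v) = of_real (f (p + v))"
    using ext by (auto simp: holo_ext_def)
  let ?\<phi> = "\<lambda>\<zeta>. F ((coords v)(b := \<zeta>))"
  have vb: "\<bar>v \<bullet> b\<bar> < r" using polydiscD[OF v b] b by (simp add: coords_def)
  have "?\<phi> field_differentiable (at (of_real (v \<bullet> b)))"
    using sep_holo_coord[OF F v b] vb by (intro holomorphic_on_imp_differentiable_at[where s = "ball 0 r"]) auto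
  then have D: "(?\<phi> has_field_derivative dcoord b F (coords v)) (at (of_real (v \<bullet> b + 0)))"
    using b by (simp add: dcoord_def coords_def field_differentiable_derivI)
  have "((\<lambda>t. complex_of_real (v \<bullet> b + t)) has_vector_derivative 1) (at 0)"
    by (auto intro!: derivative_eq_intros simp: has_vector_derivative_def scaleR_conv_of_real)
  from field_vector_diff_chain_at[OF this D]
  have 1: "((\<lambda>t. ?\<phi> (complex_of_real (v \<bullet> b + t))) has_vector_derivative dcoord b F (coords v)) (at 0)"
    by (simp add: o_def)
  have "(f has_derivative frechet_derivative f (at (p + v))) (at (p + v + 0 *\<^sub>R b))"
    using f by (simp add: frechet_derivative_works)
  moreover have "((\<lambda>t. p + v + t *\<^sub>R b) has_derivative (\<lambda>t. t *\<^sub>R b)) (at 0)"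
    by (auto intro!: derivative_eq_intros)
  ultimately have "((\<lambda>t. f (p + v + t *\<^sub>R b)) has_derivative (\<lambda>t. frechet_derivative f (at (p + v)) (t *\<^sub>R b))) (at 0)"
    using diff_chain_at[of "\<lambda>t. p + v + t *\<^sub>R b" "\<lambda>t. t *\<^sub>R b" 0 f] by (simp add: o_def)
  then have "((\<lambda>t. complex_of_real (f (p + v + t *\<^sub>R b))) has_derivative
      (\<lambda>t. complex_of_real (frechet_derivative f (at (p + v)) (t *\<^sub>R b)))) (at 0)"
    by (rule has_derivative_of_real)
  moreover have "frechet_derivative f (at (p + v)) (t *\<^sub>R b) = t * frechet_derivative f (at (p + v)) b" for t
    using linear_frechet_derivative[OF f] by (simp add: linear_cmul)
  ultimately have 2: "((\<lambda>t. complex_of_real (f (p + v + t *\<^sub>R b))) has_vector_derivative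
      of_real (frechet_derivative f (at (p + v)) b)) (at 0)"
    by (simp add: has_vector_derivative_def scaleR_conv_of_real)
  have eq: "?\<phi> (complex_of_real (v \<bullet> b + t)) = complex_of_real (f (p + v + t *\<^sub>R b))" if "\<bar>v \<bullet> b + t\<bar> < r" for t
  proof -
    have "coords (v + t *\<^sub>R b) \<in> polydisc Basis r"
      unfolding coords_add_Basis[OF b] by (rule polydisc_upd[OF v b]) (use that in \<open>simp only: norm_of_real\<close>)
    from e[OF this] show ?thesis unfolding coords_add_Basis[OF b] by (simp only: add.assoc)
  qed
  have "((\<lambda>t. \<bar>v \<bullet> b + t\<bar>) \<longlongrightarrow> \<bar>v \<bullet> b + 0\<bar>) (at 0)" by (intro tendsto_intros)
  then have "\<forall>\<^sub>F t in at 0. \<bar>v \<bullet> b + t\<bar> < r" using vb by (intro order_tendstoD(2)) auto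
  then have ev: "\<forall>\<^sub>F t in at 0. ?\<phi> (complex_of_real (v \<bullet> b + t)) = complex_of_real (f (p + v + t *\<^sub>R b))"
    by eventually_elim (rule eq)
  have eq0: "?\<phi> (complex_of_real (v \<bullet> b + 0)) = complex_of_real (f (p + v + 0 *\<^sub>R b))"
    by (rule eq) (use vb in simp)
  have "((\<lambda>t. complex_of_real (f (p + v + t *\<^sub>R b))) has_vector_derivative dcoord b F (coords v)) (at 0)"
    using has_derivative_transform_eventually[OF 1[unfolded has_vector_derivative_def] ev eq0 UNIV_I]
    unfolding has_vector_derivative_def .
  from vector_derivative_unique_at[OF this 2] show ?thesis .
qed


text \<open>All partial derivatives are extended by coordinate derivatives of one and the same
  \<open>F\<close>. This makes them analytic, and having a common \<open>F\<close> reduces the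
  symmetry of second derivatives to that of \<open>F\<close>.\<close>

lemma holo_ext_frechet:
  fixes f :: "'a::euclidean_space \<Rightarrow> real"
  assumes W: "open W" "real_analytic_on f W" "p \<in> W"
  obtains r M F s K where "holo_ext f p r M F" "0 < s"
    "\<And>b. b \<in> Basis \<Longrightarrow> holo_ext (\<lambda>x. frechet_derivative f (at x) b) p s K (dcoord b F)"
proof -
  obtain d where d: "0 < d" "ball p d \<subseteq> W" using W open_contains_ball by blast
  have f: "f differentiable at x" if "x \<in> W" for x
    using W that by (auto simp: real_analytic_on_def intro: real_analytic_imp_differentiable)
  obtain r M F where ext: "holo_ext f p r M F"
    using real_analytic_imp_holo_ext W unfolding real_analytic_on_def by blast
  \<comment> \<open>The first bound leaves room for Cauchy's estimate, the second keeps the real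
    points of the polydisc inside the ball where \<open>f\<close> is differentiable.\<close>
  define s where "s = min (r/2) (d / real DIM('a))"
  have r: "0 < r" and F: "sep_holo Basis r M F" using ext by (auto simp: holo_ext_def)
  have s: "0 < s" "s < r" "real DIM('a) * s \<le> d" using r d(1) by (auto simp: s_def min_def field_simps)
  show ?thesis
  proof (rule that[OF ext s(1)])
    fix b :: 'a assume b: "b \<in> Basis"
    show "holo_ext (\<lambda>x. frechet_derivative f (at x) b) p s (2 * M / (r - s)) (dcoord b F)"
      unfolding holo_ext_def
    proof (intro conjI allI impI s sep_holo_dcoord[OF F b])
      fix v :: 'a assume v: "coords v \<in> polydisc Basis s"
      have "p + v \<in> ball p d" using norm_le_polydisc[OF v] s by (simp add: dist_norm)
      then have "f differentiable at (p + v)" using f d by blast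
      moreover have "coords v \<in> polydisc Basis r" using v polydisc_mono[of s r] s by auto
      ultimately show "dcoord b F (coords v) = of_real (frechet_derivative f (at (p + v)) b)"
        by (intro dcoord_holo_ext[OF ext _ _ b])
    qed
  qed
qed

lemma real_analytic_on_frechet:
  fixes f :: "'a::euclidean_space \<Rightarrow> real"
  assumes "open W" "real_analytic_on f W" "b \<in> Basis"
  shows "real_analytic_on (\<lambda>x. frechet_derivative f (at x) b) W"
  unfolding real_analytic_on_def
proof
  fix p assume "p \<in> W"
  from holo_ext_frechet[OF assms(1,2) this]
  show "real_analytic_at (\<lambda>x. frechet_derivative f (at x) b) p"
    using holo_ext_imp_real_analytic assms(3) by metis
qed

text \<open>Difference quotients in \<open>\<zeta>\<close> converge to the
  \<open>\<zeta>\<close>-derivative uniformly in \<open>\<eta>\<close>, and derivatives of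
  holomorphic functions pass to uniform limits. The \<open>\<eta>\<close>-derivative of such a
  quotient is itself a difference quotient, whose limit is the other mixed derivative.\<close>

lemma mixed_deriv_symmetric:
  fixes \<Phi> :: "complex \<Rightarrow> complex \<Rightarrow> complex"
  assumes r: "0 < r"
    and hol1: "\<And>\<eta>. \<eta> \<in> ball 0 r \<Longrightarrow> (\<lambda>\<zeta>. \<Phi> \<zeta> \<eta>) holomorphic_on ball 0 r"
    and hol2: "\<And>\<zeta>. \<zeta> \<in> ball 0 r \<Longrightarrow> \<Phi> \<zeta> holomorphic_on ball 0 r"
    and bd: "\<And>\<zeta> \<eta>. \<zeta> \<in> ball 0 r \<Longrightarrow> \<eta> \<in> ball 0 r \<Longrightarrow> norm (\<Phi> \<zeta> \<eta>) \<le> M"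
  shows "deriv (\<lambda>\<zeta>. deriv (\<Phi> \<zeta>) 0) 0 = deriv (\<lambda>\<eta>. deriv (\<lambda>\<zeta>. \<Phi> \<zeta> \<eta>) 0) 0"
proof -
  define s where "s = r / 2"
  have s: "0 < s" "s < r" using r by (auto simp: s_def)
  define h :: "nat \<Rightarrow> complex" where "h N = of_real (s / 2 * inverse (real (Suc N)))" for N
  have h0: "h N \<noteq> 0" for N using s by (simp add: h_def del: of_nat_Suc)
  have hn: "norm (h N) = s / 2 * inverse (real (Suc N))" for N
    unfolding h_def norm_of_real using s by simp
  have hs: "norm (h N) \<le> s / 2" for N
    unfolding hn using s by (simp add: divide_simps)
  have hlim: "h \<longlonglongrightarrow> 0"
  proof -
    have "(\<lambda>N. s / 2 * inverse (real (Suc N))) \<longlonglongrightarrow> s / 2 * 0"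
      by (intro tendsto_intros LIMSEQ_inverse_real_of_nat)
    from tendsto_of_real[OF this, where 'a = complex] show ?thesis unfolding h_def mult_zero_right of_real_0 .
  qed
  define a where "a \<eta> = deriv (\<lambda>\<zeta>. \<Phi> \<zeta> \<eta>) 0" for \<eta>
  define q where "q N \<eta> = (\<Phi> (h N) \<eta> - \<Phi> 0 \<eta>) / h N" for N \<eta>
  have hb: "h N \<in> ball 0 r" "0 \<in> ball (0::complex) r" for N using hs[of N] s by auto
  have qh: "q N holomorphic_on ball 0 r" for N
    unfolding q_def using h0 by (intro holomorphic_on_divide holomorphic_on_diff hol2 hb holomorphic_on_const) auto
  have est: "norm (q N \<eta> - a \<eta>) \<le> 2 * M / s\<^sup>2 * norm (h N)" if "\<eta> \<in> ball 0 r" for N \<eta>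
  proof -
    have "norm (\<Phi> (0 + h N) \<eta> - (\<Sum>j<2. (deriv ^^ j) (\<lambda>\<zeta>. \<Phi> \<zeta> \<eta>) 0 / fact j * h N ^ j)) \<le> 2 * M * (norm (h N) / s)\<^sup>2"
      by (rule taylor_remainder_bound[OF hol1[OF that] bd[OF _ that] s hs])
    then have *: "norm (\<Phi> (h N) \<eta> - (\<Phi> 0 \<eta> + a \<eta> * h N)) \<le> 2 * M * (norm (h N) / s)\<^sup>2"
      by (simp add: numeral_2_eq_2 a_def)
    have "q N \<eta> - a \<eta> = (\<Phi> (h N) \<eta> - (\<Phi> 0 \<eta> + a \<eta> * h N)) / h N"
      using h0[of N] by (simp add: q_def field_simps)
    then have "norm (q N \<eta> - a \<eta>) \<le> 2 * M * (norm (h N) / s)\<^sup>2 / norm (h N)"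
      using * by (simp add: norm_divide divide_right_mono)
    also have "\<dots> = 2 * M / s\<^sup>2 * norm (h N)"
      using h0[of N] by (simp add: power2_eq_square field_simps)
    finally show ?thesis .
  qed
  have lim0: "(\<lambda>N. 2 * M / s\<^sup>2 * norm (h N)) \<longlonglongrightarrow> 0"
    using tendsto_mult_right_zero[OF tendsto_norm_zero[OF hlim]] .
  have ul: "uniform_limit (ball 0 r) q a sequentially"
  proof (rule uniform_limitI)
    fix e :: real assume "e > 0"
    from order_tendstoD(2)[OF lim0 this]
    show "\<forall>\<^sub>F N in sequentially. \<forall>\<eta>\<in>ball 0 r. dist (q N \<eta>) (a \<eta>) < e"
      by eventually_elim (unfold dist_norm, intro ballI, rule le_less_trans[OF est])
  qed
  have "(\<lambda>N. (deriv ^^ 1) (q N) 0) \<longlonglongrightarrow> (deriv ^^ 1) a 0"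
    by (rule higher_deriv_complex_uniform_limit[OF ul]) (use qh r in auto)
  moreover have "(deriv ^^ 1) (q N) 0 = (deriv (\<Phi> (h N)) 0 - deriv (\<Phi> 0) 0) / h N" for N
  proof -
    have "\<Phi> \<zeta> field_differentiable (at 0)" if "\<zeta> \<in> ball 0 r" for \<zeta>
      using holomorphic_on_imp_differentiable_at[OF hol2[OF that]] r by auto
    then have "((\<lambda>\<eta>. (\<Phi> (h N) \<eta> - \<Phi> 0 \<eta>) / h N) has_field_derivative (deriv (\<Phi> (h N)) 0 - deriv (\<Phi> 0) 0) / h N) (at 0)"
      using hb by (intro DERIV_cdivide DERIV_diff field_differentiable_derivI) auto
    then have "(q N has_field_derivative (deriv (\<Phi> (h N)) 0 - deriv (\<Phi> 0) 0) / h N) (at 0)"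
      by (simp only: q_def[abs_def])
    from DERIV_imp_deriv[OF this] show ?thesis by simp
  qed
  ultimately have L1: "(\<lambda>N. (deriv (\<Phi> (h N)) 0 - deriv (\<Phi> 0) 0) / h N) \<longlonglongrightarrow> deriv a 0" by simp
  have "(\<lambda>\<zeta>. (deriv ^^ 1) (\<Phi> \<zeta>) 0) holomorphic_on ball 0 r"
    by (rule holomorphic_higher_deriv_parameter[where F = "\<lambda>\<eta> \<zeta>. \<Phi> \<zeta> \<eta>" and r = r and M = M, OF open_ball r hol2 hol1])
      (auto intro: bd)
  then have "(\<lambda>\<zeta>. deriv (\<Phi> \<zeta>) 0) field_differentiable (at 0)"
    using holomorphic_on_imp_differentiable_at[OF _ open_ball] r by fastforce
  then have "((\<lambda>\<zeta>. deriv (\<Phi> \<zeta>) 0) has_field_derivative deriv (\<lambda>\<zeta>. deriv (\<Phi> \<zeta>) 0) 0) (at 0)"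
    by (rule field_differentiable_derivI)
  then have "((\<lambda>k. (deriv (\<Phi> (0 + k)) 0 - deriv (\<Phi> 0) 0) / k) \<longlongrightarrow> deriv (\<lambda>\<zeta>. deriv (\<Phi> \<zeta>) 0) 0) (at 0)"
    by (rule DERIV_D)
  moreover have "filterlim h (at 0) sequentially" using hlim h0 by (simp add: filterlim_at)
  ultimately have "(\<lambda>N. (deriv (\<Phi> (0 + h N)) 0 - deriv (\<Phi> 0) 0) / h N) \<longlonglongrightarrow> deriv (\<lambda>\<zeta>. deriv (\<Phi> \<zeta>) 0) 0"
    by (rule filterlim_compose)
  with L1 show ?thesis using LIMSEQ_unique unfolding a_def by fastforce
qed

lemma dcoord_commute:
  assumes F: "sep_holo B r M F" and r: "0 < r" and b: "b \<in> B" "c \<in> B"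
  shows "dcoord b (dcoord c F) (\<lambda>_. 0) = dcoord c (dcoord b F) (\<lambda>_. 0)"
proof (cases "b = c")
  case False
  have z: "(\<lambda>_. 0) \<in> polydisc B r" using r by (rule zero_in_polydisc)
  let ?\<Phi> = "\<lambda>\<zeta> \<eta>. F ((\<lambda>_. 0)(b := \<zeta>, c := \<eta>))"
  have "deriv (\<lambda>\<zeta>. deriv (?\<Phi> \<zeta>) 0) 0 = deriv (\<lambda>\<eta>. deriv (\<lambda>\<zeta>. ?\<Phi> \<zeta> \<eta>) 0) 0"
  proof (rule mixed_deriv_symmetric[OF r])
    show "?\<Phi> \<zeta> holomorphic_on ball 0 r" if "\<zeta> \<in> ball 0 r" for \<zeta>
      using that by (intro sep_holo_coord[OF F _ b(2)] polydisc_upd z b) auto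
    show "(\<lambda>\<zeta>. ?\<Phi> \<zeta> \<eta>) holomorphic_on ball 0 r" if "\<eta> \<in> ball 0 r" for \<eta>
      unfolding fun_upd_twist[OF False]
      using that by (intro sep_holo_coord[OF F _ b(1)] polydisc_upd z b) auto
    show "norm (?\<Phi> \<zeta> \<eta>) \<le> M" if "\<zeta> \<in> ball 0 r" "\<eta> \<in> ball 0 r" for \<zeta> \<eta>
      using that by (intro sep_holo_bound[OF F] polydisc_upd z b) auto
  qed
  then show ?thesis using False by (simp add: dcoord_def fun_upd_twist[of b c])
qed simp

text \<open>Symmetry of the real Hessian, read off from the common extension; it is the source of
  the hermitian symmetry of the Levi matrix.\<close>

lemma real_analytic_frechet_commute:
  fixes f :: "'a::euclidean_space \<Rightarrow> real"
  assumes W: "open W" "real_analytic_on f W" and p: "p \<in> W" and b: "b \<in> Basis" "c \<in> Basis"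
  shows "frechet_derivative (\<lambda>x. frechet_derivative f (at x) c) (at p) b =
    frechet_derivative (\<lambda>x. frechet_derivative f (at x) b) (at p) c"
proof -
  obtain r M F s K where ext: "holo_ext f p r M F" and s: "0 < s"
    and ext': "\<And>b. b \<in> Basis \<Longrightarrow> holo_ext (\<lambda>x. frechet_derivative f (at x) b) p s K (dcoord b F)"
    by (rule holo_ext_frechet[OF W p]) (rule that)
  have r: "0 < r" and F: "sep_holo Basis r M F" using ext by (auto simp: holo_ext_def)
  have D: "dcoord c (dcoord b F) (\<lambda>_. 0) = of_real (frechet_derivative (\<lambda>x. frechet_derivative f (at x) b) (at p) c)"
    if "b \<in> Basis" "c \<in> Basis" for b c
  proof -
    have "(\<lambda>x. frechet_derivative f (at x) b) differentiable at (p + 0)"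
      using real_analytic_on_frechet[OF W that(1)] p
      by (simp add: real_analytic_on_def real_analytic_imp_differentiable)
    from dcoord_holo_ext[OF ext'[OF that(1)] _ this that(2)] show ?thesis
      using zero_in_polydisc[OF s, of Basis] by simp
  qed
  from dcoord_commute[OF F r b] D[OF b(2,1)] D[OF b(1,2)] show ?thesis by simp
qed

section \<open>Real-analytic and holomorphic maps\<close>

lemma finite_uniform_radius:
  assumes "finite A" "\<And>a. a \<in> A \<Longrightarrow> \<exists>s>(0::real). P a s"
    and mono: "\<And>a s t. P a s \<Longrightarrow> 0 < t \<Longrightarrow> t \<le> s \<Longrightarrow> P a t"
  shows "\<exists>s>0. \<forall>a\<in>A. P a s"
  using assms(1,2)
proof (induction A rule: finite_induct)
  case empty
  then show ?case by (intro exI[of _ 1]) auto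
next
  case (insert a A)
  from insert obtain s where s: "s > 0" "\<forall>a\<in>A. P a s" by auto
  from insert obtain t where t: "t > 0" "P a t" by blast
  show ?case
    by (rule exI[of _ "min s t"])
      (use s t mono[of _ s "min s t"] mono[OF t(2), of "min s t"] in auto)
qed

text \<open>Prepares composition: the increment of a component must have an extension with values
  small enough to stay in the polydisc of the outer function.\<close>

lemma holo_ext_small:
  fixes f :: "'a::euclidean_space \<Rightarrow> real"
  assumes "real_analytic_at f p" "0 < e"
  shows "\<exists>s>0. \<exists>G. (\<forall>w\<in>polydisc Basis s. norm (G w) \<le> e \<and> (\<forall>b\<in>Basis. (\<lambda>\<zeta>. G (w(b := \<zeta>))) holomorphic_on ball 0 s)) \<and>
    (\<forall>v. coords v \<in> polydisc Basis s \<longrightarrow> G (coords v) = of_real (f (p + v) - f p))"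
proof -
  obtain r M F where ext: "holo_ext f p r M F" using real_analytic_imp_holo_ext[OF assms(1)] by blast
  then have r: "0 < r" and F: "sep_holo Basis r M F"
    and v: "\<And>v. coords v \<in> polydisc Basis r \<Longrightarrow> F (coords v) = of_real (f (p + v))"
    by (auto simp: holo_ext_def)
  obtain C where C: "0 \<le> C" "\<And>w. w \<in> polydisc Basis (r/4) \<Longrightarrow> norm (F w - F (\<lambda>_. 0)) \<le> C * (\<Sum>b\<in>Basis. norm (w b))"
    using sep_holo_lipschitz[OF finite_Basis r F] by blast
  \<comment> \<open>The Lipschitz estimate bounds the increment by C * DIM('a) * s, which this
    choice makes at most \<open>e\<close>; adding 1 keeps the denominator positive.\<close>
  define s where "s = min (r/4) (e / (C * DIM('a) + 1))"
  have k: "0 < C * DIM('a) + 1" using C(1) by (simp add: add_nonneg_pos)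
  have s: "0 < s" "s \<le> r/4" using r assms(2) k unfolding s_def by (simp, intro min.cobounded1)
  then have s: "0 < s" "s \<le> r/4" "s \<le> r" by linarith+
  have "s * (C * DIM('a) + 1) \<le> e / (C * DIM('a) + 1) * (C * DIM('a) + 1)"
    using k by (intro mult_right_mono) (auto simp: s_def)
  also have "\<dots> = e" using k by simp
  finally have se: "C * (DIM('a) * s) \<le> e" using s by (simp add: algebra_simps)
  have F0: "F (\<lambda>_. 0) = of_real (f p)" using v[of 0] zero_in_polydisc[OF r, of Basis] by simp
  show ?thesis
  proof (intro exI[of _ s] exI[of _ "\<lambda>w. F w - F (\<lambda>_. 0)"] conjI ballI allI impI s)
    fix w :: "'a \<Rightarrow> complex" assume w: "w \<in> polydisc Basis s"
    then have w': "w \<in> polydisc Basis (r/4)" "w \<in> polydisc Basis r"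
      using polydisc_mono[of s "r/4" Basis] polydisc_mono[of s r Basis] s by auto
    have "(\<Sum>b\<in>Basis. norm (w b)) \<le> (\<Sum>b\<in>(Basis::'a set). s)"
      by (intro sum_mono less_imp_le polydiscD[OF w])
    then have "C * (\<Sum>b\<in>Basis. norm (w b)) \<le> C * (DIM('a) * s)"
      using C(1) by (intro mult_left_mono) auto
    with C(2)[OF w'(1)] se show "norm (F w - F (\<lambda>_. 0)) \<le> e" by linarith
    fix b :: 'a assume b: "b \<in> Basis"
    show "(\<lambda>\<zeta>. F (w(b := \<zeta>)) - F (\<lambda>_. 0)) holomorphic_on ball 0 s"
      by (intro holomorphic_on_diff holomorphic_on_const
          holomorphic_on_subset[OF sep_holo_coord[OF F w'(2) b] subset_ball[OF s(3)]])
  next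
    fix u :: 'a assume "coords u \<in> polydisc Basis s"
    then have "coords u \<in> polydisc Basis r" using polydisc_mono[OF s(3)] by auto
    then show "F (coords u) - F (\<lambda>_. 0) = of_real (f (p + u) - f p)" by (simp add: v F0)
  qed
qed

text \<open>Extend the increments of the components with values at most r/2 and insert them into the
  extension of \<open>f\<close>. Holomorphy in one source coordinate is then holomorphy of the outer
  extension along a curve.\<close>

lemma real_analytic_at_compose:
  fixes f :: "'b::euclidean_space \<Rightarrow> real" and h :: "'a::euclidean_space \<Rightarrow> 'b"
  assumes f: "real_analytic_at f (h p)" and h: "\<And>b. b \<in> Basis \<Longrightarrow> real_analytic_at (\<lambda>x. h x \<bullet> b) p"
  shows "real_analytic_at (\<lambda>x. f (h x)) p"
proof -
  obtain r M F where "holo_ext f (h p) r M F" using real_analytic_imp_holo_ext[OF f] by blast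
  then have r: "0 < r" and F: "sep_holo Basis r M F"
    and v: "\<And>v. coords v \<in> polydisc Basis r \<Longrightarrow> F (coords v) = of_real (f (h p + v))"
    by (auto simp: holo_ext_def)
  \<comment> \<open>Formulated as an existence statement that survives shrinking \<open>s\<close>,
    so that the finitely many components can share one radius.\<close>
  define Q where "Q b s \<longleftrightarrow> (\<exists>G. (\<forall>w\<in>polydisc (Basis::'a set) s. norm (G w) \<le> r/2 \<and> (\<forall>b\<in>Basis. (\<lambda>\<zeta>. G (w(b := \<zeta>))) holomorphic_on ball 0 s)) \<and>
    (\<forall>v. coords v \<in> polydisc Basis s \<longrightarrow> G (coords v) = of_real (h (p + v) \<bullet> b - h p \<bullet> b)))" for b s
  have "\<exists>s>0. \<forall>b\<in>Basis. Q b s"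
  proof (rule finite_uniform_radius[OF finite_Basis])
    show "\<exists>s>0. Q b s" if "b \<in> Basis" for b
      unfolding Q_def by (rule holo_ext_small[OF h[OF that]]) (use r in simp)
    show "Q b t" if Q: "Q b s" and t: "0 < t" "t \<le> s" for b s t
    proof -
      obtain G where G: "\<And>w. w \<in> polydisc (Basis::'a set) s \<Longrightarrow> norm (G w) \<le> r/2"
        "\<And>w c. w \<in> polydisc (Basis::'a set) s \<Longrightarrow> c \<in> Basis \<Longrightarrow> (\<lambda>\<zeta>. G (w(c := \<zeta>))) holomorphic_on ball 0 s"
        "\<And>v. coords v \<in> polydisc Basis s \<Longrightarrow> G (coords v) = of_real (h (p + v) \<bullet> b - h p \<bullet> b)"
        using Q unfolding Q_def by blast
      have sub: "w \<in> polydisc B s" if "w \<in> polydisc B t" for w and B :: "'a set"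
        using polydisc_mono[OF t(2)] that by blast
      show ?thesis unfolding Q_def
        by (intro exI[of _ G] conjI ballI allI impI G sub holomorphic_on_subset[OF G(2) subset_ball[OF t(2)]])
    qed
  qed
  then obtain s where s: "0 < s" and "\<forall>b\<in>Basis. Q b s" by blast
  then obtain G where G: "\<And>b w. b \<in> Basis \<Longrightarrow> w \<in> polydisc (Basis::'a set) s \<Longrightarrow> norm (G b w) \<le> r/2"
    "\<And>b w c. b \<in> Basis \<Longrightarrow> w \<in> polydisc (Basis::'a set) s \<Longrightarrow> c \<in> Basis \<Longrightarrow> (\<lambda>\<zeta>. G b (w(c := \<zeta>))) holomorphic_on ball 0 s"
    "\<And>b v. b \<in> Basis \<Longrightarrow> coords v \<in> polydisc Basis s \<Longrightarrow> G b (coords v) = of_real (h (p + v) \<bullet> b - h p \<bullet> b)"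
    unfolding Q_def by metis
  let ?K = "\<lambda>w b. if b \<in> Basis then G b w else 0"
  have "holo_ext (\<lambda>x. f (h x)) p s M (\<lambda>w. F (?K w))"
    unfolding holo_ext_def sep_holo_def
  proof (intro conjI ballI allI impI s)
    fix w :: "'a \<Rightarrow> complex" assume w: "w \<in> polydisc Basis s"
    have "?K w \<in> polydisc Basis r" using G(1)[OF _ w] r by (intro polydiscI) fastforce+
    then show "norm (F (?K w)) \<le> M" by (rule sep_holo_bound[OF F])
    fix c :: 'a assume c: "c \<in> Basis"
    show "(\<lambda>\<zeta>. F (?K (w(c := \<zeta>)))) holomorphic_on ball 0 s"
    proof (rule sep_holo_curve[where G = "\<lambda>b \<zeta>. G b (w(c := \<zeta>))" and t = "r/2", OF finite_Basis F])
      show "norm (G b (w(c := \<zeta>))) \<le> r/2" if "b \<in> Basis" "\<zeta> \<in> ball 0 s" for b \<zeta>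
        using that by (intro G polydisc_upd w c) auto
    qed (use r G(2)[OF _ w c] in auto)
  next
    fix u :: 'a assume u: "coords u \<in> polydisc Basis s"
    have eq: "?K (coords u) = coords (h (p + u) - h p)"
      using G(3)[OF _ u] by (auto simp: coords_def[of "h (p + u) - h p"] inner_diff_left)
    have "?K (coords u) \<in> polydisc Basis r" using G(1)[OF _ u] r by (intro polydiscI) fastforce+
    then have "coords (h (p + u) - h p) \<in> polydisc Basis r" unfolding eq .
    from v[OF this] show "F (?K (coords u)) = of_real (f (h (p + u)))" unfolding eq by simp
  qed
  then show ?thesis by (rule holo_ext_imp_real_analytic)
qed

text \<open>The scalar counterpart of \<open>holomorphic_map_on\<close> at a point; writing the
  derivative in coordinates makes its complex linearity visible.\<close>

definition cdiff_at :: "(complex ^ 'm \<Rightarrow> complex) \<Rightarrow> complex ^ 'm \<Rightarrow> bool" where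
  "cdiff_at f z \<longleftrightarrow> (\<exists>c. (f has_derivative (\<lambda>v. \<Sum>j\<in>UNIV. c j * v $ j)) (at z))"

lemma cdiff_at_imp_differentiable: "cdiff_at f z \<Longrightarrow> f differentiable (at z)"
  by (auto simp: cdiff_at_def differentiable_def)

lemma cdiff_at_line:
  fixes f :: "complex ^ 'm \<Rightarrow> complex"
  assumes "cdiff_at f (a + \<zeta> *s u)"
  shows "((\<lambda>\<zeta>. f (a + \<zeta> *s u)) has_field_derivative frechet_derivative f (at (a + \<zeta> *s u)) u) (at \<zeta>)"
proof -
  obtain c where c: "(f has_derivative (\<lambda>v. \<Sum>j\<in>UNIV. c j * v $ j)) (at (a + \<zeta> *s u))"
    using assms by (auto simp: cdiff_at_def)
  have "linear (\<lambda>\<zeta>. \<zeta> *s u)"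
    by (intro linearI) (auto simp: vec_eq_iff algebra_simps)
  then have "bounded_linear (\<lambda>\<zeta>. \<zeta> *s u)" by (simp add: linear_conv_bounded_linear)
  then have "((\<lambda>\<zeta>. a + \<zeta> *s u) has_derivative (\<lambda>h. h *s u)) (at \<zeta>)"
    using has_derivative_add[OF has_derivative_const bounded_linear_imp_has_derivative] by fastforce
  from diff_chain_at[OF this c]
  have "((\<lambda>\<zeta>. f (a + \<zeta> *s u)) has_derivative (\<lambda>h. \<Sum>j\<in>UNIV. c j * (h * u $ j))) (at \<zeta>)"
    by (simp add: o_def)
  moreover have "(\<lambda>h. \<Sum>j\<in>UNIV. c j * (h * u $ j)) = (*) (\<Sum>j\<in>UNIV. c j * u $ j)"
    by (auto simp: sum_distrib_right sum_distrib_left mult_ac)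
  moreover have "frechet_derivative f (at (a + \<zeta> *s u)) u = (\<Sum>j\<in>UNIV. c j * u $ j)"
    using frechet_derivative_at[OF c] by (metis (no_types, lifting))
  ultimately show ?thesis by (simp add: has_field_derivative_def)
qed

lemma norm_vector_smult: "norm (c *s (x :: complex ^ 'm)) = norm c * norm x"
  by (simp add: norm_vec_def norm_mult L2_set_right_distrib)

lemma of_real_smult: "complex_of_real c *s x = c *\<^sub>R (x :: complex ^ 'm)"
  by (simp add: vec_eq_iff scaleR_conv_of_real[where 'a = complex])



lemma field_differentiable_imp_holomorphic_on:
  assumes "open S" "\<And>z. z \<in> S \<Longrightarrow> f field_differentiable (at z)"
  shows "f holomorphic_on S"
  using assms by (auto simp: holomorphic_on_def intro: field_differentiable_at_within)

lemma field_differentiableI: "(f has_field_derivative D) F \<Longrightarrow> f field_differentiable F"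
  by (auto simp: field_differentiable_def)

lemma sum_smult_upd:
  assumes "finite B" "b \<in> B"
  shows "(\<Sum>b'\<in>B. (w(b := \<zeta>)) b' *s g b') = (\<Sum>b'\<in>B. (w(b := 0)) b' *s g b') + \<zeta> *s (g b :: complex ^ 'n)"
proof -
  have "(\<Sum>b'\<in>B. (w(b := \<eta>)) b' *s g b') = \<eta> *s g b + (\<Sum>b'\<in>B - {b}. w b' *s g b')" for \<eta>
    by (subst sum.remove[OF assms]) (auto intro!: sum.cong)
  from this[of \<zeta>] this[of 0] show ?thesis by simp
qed

text \<open>The directions \<open>g\<close> are left free because two choices occur: the real basis
  vectors, which complexify the underlying real space, and the unit vectors of the complex
  coordinates.\<close>

lemma sep_holo_affine:
  fixes f :: "complex ^ 'm \<Rightarrow> complex"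
  assumes "finite B" and g: "\<And>b. b \<in> B \<Longrightarrow> norm (g b) \<le> 1" and s: "0 < s" "real (card B) * s \<le> d"
    and f: "\<And>z. z \<in> cball p d \<Longrightarrow> cdiff_at f z \<and> norm (f z) \<le> M"
  shows "sep_holo B s M (\<lambda>w. f (p + (\<Sum>b\<in>B. w b *s g b)))"
proof -
  have in_ball: "p + (\<Sum>b\<in>B. w b *s g b) \<in> cball p d" if w: "w \<in> polydisc B s" for w
  proof -
    have "norm (\<Sum>b\<in>B. w b *s g b) \<le> (\<Sum>b\<in>B. s)"
    proof (rule sum_norm_le)
      fix b assume b: "b \<in> B"
      show "norm (w b *s g b) \<le> s"
        unfolding norm_vector_smult using mult_mono[OF less_imp_le[OF polydiscD[OF w b]] g[OF b]] s by simp
    qed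
    also have "\<dots> \<le> d" using s by simp
    finally show ?thesis by (simp add: dist_norm)
  qed
  show ?thesis unfolding sep_holo_def
  proof (intro ballI conjI)
    fix w assume w: "w \<in> polydisc B s"
    show "norm (f (p + (\<Sum>b\<in>B. w b *s g b))) \<le> M" using f in_ball[OF w] by blast
    fix b assume b: "b \<in> B"
    let ?a = "p + (\<Sum>b'\<in>B. (w(b := 0)) b' *s g b')"
    have eq: "p + (\<Sum>b'\<in>B. (w(b := \<zeta>)) b' *s g b') = ?a + \<zeta> *s g b" for \<zeta>
      unfolding sum_smult_upd[OF assms(1) b, of w \<zeta>] by (simp only: add.assoc)
    have "(\<lambda>\<zeta>. f (?a + \<zeta> *s g b)) holomorphic_on ball 0 s"
    proof (rule field_differentiable_imp_holomorphic_on[OF open_ball])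
      fix \<zeta> :: complex assume "\<zeta> \<in> ball 0 s"
      then have "cdiff_at f (?a + \<zeta> *s g b)"
        by (subst eq[symmetric]) (intro f[THEN conjunct1] in_ball polydisc_upd[OF w b], simp)
      from cdiff_at_line[OF this] show "(\<lambda>\<zeta>. f (?a + \<zeta> *s g b)) field_differentiable (at \<zeta>)"
        by (rule field_differentiableI)
    qed
    then show "(\<lambda>\<zeta>. f (p + (\<Sum>b'\<in>B. (w(b := \<zeta>)) b' *s g b'))) holomorphic_on ball 0 s"
      by (rule holomorphic_transform) (rule arg_cong[where f = f], rule eq[symmetric])
  qed
qed


lemma cdiff_ball_bounded:
  fixes f :: "complex ^ 'm \<Rightarrow> complex"
  assumes "open S" "p \<in> S" and f: "\<And>z. z \<in> S \<Longrightarrow> cdiff_at f z"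
  obtains d M where "0 < d" "\<And>z. z \<in> cball p d \<Longrightarrow> cdiff_at f z \<and> norm (f z) \<le> M" "cball p d \<subseteq> S"
proof -
  obtain d where d: "0 < d" "cball p d \<subseteq> S" using assms open_contains_cball by blast
  have "continuous_on (cball p d) f"
    using f d by (intro continuous_at_imp_continuous_on ballI differentiable_imp_continuous_within cdiff_at_imp_differentiable) auto
  then have "bounded (f ` cball p d)" by (intro compact_imp_bounded compact_continuous_image compact_cball)
  then obtain M where M: "\<forall>z\<in>cball p d. norm (f z) \<le> M" by (auto simp: bounded_iff)
  show ?thesis
  proof (rule that[OF d(1) _ d(2)])
    show "cdiff_at f z \<and> norm (f z) \<le> M" if "z \<in> cball p d" for z
      using that M f d(2) by blast
  qed
qed

lemma sum_coords_smult:
  fixes v :: "complex ^ 'm"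
  shows "(\<Sum>b\<in>Basis. coords v b *s b) = v" "(\<Sum>b\<in>Basis. cnj (coords v b) *s b) = v"
proof -
  have "(\<Sum>b\<in>Basis. coords v b *s b) = (\<Sum>b\<in>Basis. (v \<bullet> b) *\<^sub>R b)"
    by (intro sum.cong) (auto simp: coords_def of_real_smult)
  then show "(\<Sum>b\<in>Basis. coords v b *s b) = v" by (simp add: euclidean_representation)
  have "(\<Sum>b\<in>Basis. cnj (coords v b) *s b) = (\<Sum>b\<in>Basis. (v \<bullet> b) *\<^sub>R b)"
    by (intro sum.cong) (auto simp: coords_def of_real_smult)
  then show "(\<Sum>b\<in>Basis. cnj (coords v b) *s b) = v" by (simp add: euclidean_representation)
qed

text \<open>On the complexified space, \<open>Re f\<close> extends to half the sum of \<open>f\<close> and its conjugate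
  reflection.\<close>

lemma real_analytic_Re:
  fixes f :: "complex ^ 'm \<Rightarrow> complex"
  assumes S: "open S" "p \<in> S" and f: "\<And>z. z \<in> S \<Longrightarrow> cdiff_at f z"
  shows "real_analytic_at (\<lambda>z. Re (f z)) p"
proof -
  obtain d M where d: "0 < d" and fd: "\<And>z. z \<in> cball p d \<Longrightarrow> cdiff_at f z \<and> norm (f z) \<le> M"
    using cdiff_ball_bounded[OF S f] by metis
  let ?B = "Basis :: (complex ^ 'm) set"
  define s where "s = d / real (card ?B)"
  have s: "0 < s" "real (card ?B) * s \<le> d" using d DIM_positive[where 'a = "complex ^ 'm"] by (auto simp: s_def)
  define G where "G w = f (p + (\<Sum>b\<in>?B. w b *s b))" for w
  have G: "sep_holo ?B s M G" unfolding G_def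
    by (rule sep_holo_affine[OF finite_Basis _ s fd]) auto
  define F where "F w = (G w + cnj (G (\<lambda>b. cnj (w b)))) / 2" for w
  have "holo_ext (\<lambda>z. Re (f z)) p s M F"
    unfolding holo_ext_def sep_holo_def
  proof (intro conjI ballI allI impI s)
    fix w assume w: "w \<in> polydisc ?B s"
    have w': "(\<lambda>b. cnj (w b)) \<in> polydisc ?B s"
      using polydiscD[OF w] polydisc_outside[OF w] by (intro polydiscI) auto
    have "norm (F w) \<le> (norm (G w) + norm (cnj (G (\<lambda>b. cnj (w b))))) / 2"
      unfolding F_def norm_divide using norm_triangle_ineq[of "G w" "cnj (G (\<lambda>b. cnj (w b)))"] by simp
    also have "\<dots> \<le> M" using sep_holo_bound[OF G w] sep_holo_bound[OF G w'] by simp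
    finally show "norm (F w) \<le> M" .
    fix b assume b: "b \<in> ?B"
    let ?g = "\<lambda>\<zeta>. G ((\<lambda>b. cnj (w b))(b := \<zeta>))"
    have "cnj \<circ> ?g \<circ> cnj holomorphic_on ball 0 s"
    proof (rule holomorphic_on_compose_cnj_cnj)
      have "cnj ` ball 0 s \<subseteq> ball 0 s" by auto
      then show "?g holomorphic_on cnj ` ball 0 s"
        by (rule holomorphic_on_subset[OF sep_holo_coord[OF G w' b]])
    qed auto
    moreover have "cnj \<circ> ?g \<circ> cnj = (\<lambda>\<zeta>. cnj (G (\<lambda>b'. cnj ((w(b := \<zeta>)) b'))))"
    proof
      fix \<zeta>
      have "(\<lambda>b. cnj (w b))(b := cnj \<zeta>) = (\<lambda>b'. cnj ((w(b := \<zeta>)) b'))" by auto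
      then show "(cnj \<circ> ?g \<circ> cnj) \<zeta> = cnj (G (\<lambda>b'. cnj ((w(b := \<zeta>)) b')))" by (simp only: o_def)
    qed
    ultimately have "(\<lambda>\<zeta>. cnj (G (\<lambda>b'. cnj ((w(b := \<zeta>)) b')))) holomorphic_on ball 0 s" by (simp only:)
    with sep_holo_coord[OF G w b] show "(\<lambda>\<zeta>. F (w(b := \<zeta>))) holomorphic_on ball 0 s"
      unfolding F_def by (intro holomorphic_on_divide holomorphic_on_add holomorphic_on_const) auto
  next
    fix v :: "complex ^ 'm"
    have "F (coords v) = (f (p + v) + cnj (f (p + v))) / 2"
      by (simp add: F_def G_def sum_coords_smult)
    then show "F (coords v) = of_real (Re (f (p + v)))" by (simp add: complex_add_cnj)
  qed
  then show ?thesis by (rule holo_ext_imp_real_analytic)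
qed

section \<open>Closure properties of complex differentiability\<close>

lemma cdiff_at_const [simp, intro]: "cdiff_at (\<lambda>z. a) z"
  unfolding cdiff_at_def by (rule exI[of _ "\<lambda>_. 0"]) simp

lemma cdiff_at_add:
  assumes "cdiff_at f z" "cdiff_at g z" shows "cdiff_at (\<lambda>z. f z + g z) z"
proof -
  obtain c d where "(f has_derivative (\<lambda>v. \<Sum>j\<in>UNIV. c j * v $ j)) (at z)"
    "(g has_derivative (\<lambda>v. \<Sum>j\<in>UNIV. d j * v $ j)) (at z)"
    using assms by (auto simp: cdiff_at_def)
  from has_derivative_add[OF this] show ?thesis unfolding cdiff_at_def
    by (intro exI[of _ "\<lambda>j. c j + d j"]) (simp add: sum.distrib algebra_simps)
qed

lemma cdiff_at_mult:
  assumes "cdiff_at f z" "cdiff_at g z" shows "cdiff_at (\<lambda>z. f z * g z) z"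
proof -
  obtain c d where "(f has_derivative (\<lambda>v. \<Sum>j\<in>UNIV. c j * v $ j)) (at z)"
    "(g has_derivative (\<lambda>v. \<Sum>j\<in>UNIV. d j * v $ j)) (at z)"
    using assms by (auto simp: cdiff_at_def)
  from has_derivative_mult[OF this]
  have "((\<lambda>z. f z * g z) has_derivative (\<lambda>v. f z * (\<Sum>j\<in>UNIV. d j * v $ j) + (\<Sum>j\<in>UNIV. c j * v $ j) * g z)) (at z)" .
  moreover have "(\<lambda>v. f z * (\<Sum>j\<in>UNIV. d j * v $ j) + (\<Sum>j\<in>UNIV. c j * v $ j) * g z) =
    (\<lambda>v. \<Sum>j\<in>UNIV. (f z * d j + c j * g z) * v $ j)"
    by (simp add: sum_distrib_left sum_distrib_right sum.distrib[symmetric] algebra_simps)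
  ultimately show ?thesis unfolding cdiff_at_def by (intro exI[of _ "\<lambda>j. f z * d j + c j * g z"]) simp
qed

lemma cdiff_at_minus: "cdiff_at f z \<Longrightarrow> cdiff_at (\<lambda>z. - f z) z"
  using cdiff_at_mult[OF cdiff_at_const, of f z "-1"] by simp

lemma cdiff_at_sum:
  assumes "\<And>i. i \<in> I \<Longrightarrow> cdiff_at (f i) z" shows "cdiff_at (\<lambda>z. \<Sum>i\<in>I. f i z) z"
  using assms by (induction I rule: infinite_finite_induct) (auto intro!: cdiff_at_add)

lemma cdiff_at_prod:
  assumes "\<And>i. i \<in> I \<Longrightarrow> cdiff_at (f i) z" shows "cdiff_at (\<lambda>z. \<Prod>i\<in>I. f i z) z"
  using assms by (induction I rule: infinite_finite_induct) (auto intro!: cdiff_at_mult)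

lemma cdiff_at_det:
  fixes Q :: "complex ^ 'm \<Rightarrow> complex ^ 'n ^ 'n"
  assumes "\<And>i j. cdiff_at (\<lambda>z. Q z $ i $ j) z"
  shows "cdiff_at (\<lambda>z. det (Q z)) z"
  unfolding det_def by (intro cdiff_at_sum cdiff_at_mult cdiff_at_prod cdiff_at_const assms)

lemma real_analytic_Im:
  fixes f :: "complex ^ 'm \<Rightarrow> complex"
  assumes S: "open S" "p \<in> S" and f: "\<And>z. z \<in> S \<Longrightarrow> cdiff_at f z"
  shows "real_analytic_at (\<lambda>z. Im (f z)) p"
  using real_analytic_Re[OF S cdiff_at_mult[OF cdiff_at_const[of "-\<i>"] f]] by simp

text \<open>In the complex coordinates \<open>f\<close> is bounded and separately holomorphic, hence
  so is its coordinate derivative, and linear approximation with quadratic error gives that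
  derivative a complex-linear differential.\<close>

lemma cdiff_at_frechet:
  fixes f :: "complex ^ 'm \<Rightarrow> complex"
  assumes S: "open S" "p \<in> S" and f: "\<And>z. z \<in> S \<Longrightarrow> cdiff_at f z"
  shows "cdiff_at (\<lambda>z. frechet_derivative f (at z) (axis j 1)) p"
proof -
  obtain d M where d: "0 < d" and fd: "\<And>z. z \<in> cball p d \<Longrightarrow> cdiff_at f z \<and> norm (f z) \<le> M" and dS: "cball p d \<subseteq> S"
    using cdiff_ball_bounded[OF S f] by metis
  let ?\<psi> = "\<lambda>w :: 'm \<Rightarrow> complex. \<Sum>j\<in>UNIV. w j *s (axis j 1 :: complex ^ 'm)"
  define s where "s = d / real CARD('m)"
  have s: "0 < s" "real CARD('m) * s \<le> d" using d by (auto simp: s_def)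
  define F where "F w = f (p + ?\<psi> w)" for w
  have F: "sep_holo UNIV s M F" unfolding F_def
    by (rule sep_holo_affine[OF _ _ s fd]) auto
  have \<psi>: "?\<psi> (\<lambda>j. v $ j) = v" for v :: "complex ^ 'm"
    by (simp add: vec_eq_iff axis_def if_distrib cong: if_cong)
  let ?D = "dcoord j F"
  have D: "sep_holo UNIV (s/2) (2 * M / (s - s/2)) ?D"
    by (rule sep_holo_dcoord[OF F]) (use s in auto)
  have Dv: "?D (\<lambda>j. v $ j) = frechet_derivative f (at (p + v)) (axis j 1)" if "norm v \<le> d" for v
  proof -
    let ?a = "p + ?\<psi> ((\<lambda>j. v $ j)(j := 0))"
    have eq: "p + ?\<psi> ((\<lambda>j. v $ j)(j := \<zeta>)) = ?a + \<zeta> *s axis j 1" for \<zeta>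
      using sum_smult_upd[of UNIV j "\<lambda>j. v $ j" \<zeta> "\<lambda>j. axis j 1"] by (simp only: add.assoc finite UNIV_I)
    have av: "?a + v $ j *s axis j 1 = p + v"
      unfolding eq[symmetric] by (simp only: fun_upd_triv \<psi>)
    have "cdiff_at f (?a + v $ j *s axis j 1)" unfolding av using fd that by (simp add: dist_norm)
    from DERIV_imp_deriv[OF cdiff_at_line[OF this]]
    have "deriv (\<lambda>\<zeta>. f (?a + \<zeta> *s axis j 1)) (v $ j) = frechet_derivative f (at (p + v)) (axis j 1)"
      unfolding av .
    moreover have "(\<lambda>\<zeta>. F ((\<lambda>j. v $ j)(j := \<zeta>))) = (\<lambda>\<zeta>. f (?a + \<zeta> *s axis j 1))"
      unfolding F_def by (intro ext arg_cong[where f = f] eq)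
    ultimately show ?thesis by (simp only: dcoord_def)
  qed
  have s2: "0 < s/2" using s by simp
  obtain l C where C: "0 \<le> C" "\<And>w. w \<in> polydisc UNIV (s/2/4) \<Longrightarrow>
    norm (?D w - ?D (\<lambda>_. 0) - (\<Sum>b\<in>UNIV. l b * w b)) \<le> C * (\<Sum>b\<in>UNIV. norm (w b))\<^sup>2"
    using sep_holo_linear_approx[OF finite s2 D] by auto
  have "((\<lambda>z. frechet_derivative f (at z) (axis j 1)) has_derivative (\<lambda>v. \<Sum>j\<in>UNIV. l j * v $ j)) (at p)"
  proof (rule has_derivative_quadratic_remainder[where d = "min d (s/2/4)" and C = "C * (real CARD('m))\<^sup>2"])
    show "bounded_linear (\<lambda>v. \<Sum>j\<in>UNIV. l j * v $ j)"
      by (intro bounded_linear_sum bounded_linear_const_mult bounded_linear_vec_nth)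
    fix v :: "complex ^ 'm" assume v: "norm v < min d (s/2/4)"
    have "(\<lambda>j. v $ j) \<in> polydisc UNIV (s/2/4)"
      by (rule polydiscI, rule le_less_trans[OF Finite_Cartesian_Product.norm_nth_le]) (use v in auto)
    from C(2)[OF this] have "norm (frechet_derivative f (at (p + v)) (axis j 1) - frechet_derivative f (at p) (axis j 1) -
       (\<Sum>j\<in>UNIV. l j * v $ j)) \<le> C * (\<Sum>b\<in>UNIV. norm (v $ b))\<^sup>2"
      using Dv[of v] Dv[of 0] v d by simp
    also have "(\<Sum>b\<in>UNIV. norm (v $ b)) \<le> (\<Sum>b\<in>(UNIV::'m set). norm v)"
      by (intro sum_mono Finite_Cartesian_Product.norm_nth_le)
    then have "C * (\<Sum>b\<in>UNIV. norm (v $ b))\<^sup>2 \<le> C * (real CARD('m) * norm v)\<^sup>2"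
      using C(1) by (intro mult_left_mono power_mono sum_nonneg) auto
    finally show "norm (frechet_derivative f (at (p + v)) (axis j 1) - frechet_derivative f (at p) (axis j 1) -
       (\<Sum>j\<in>UNIV. l j * v $ j)) \<le> C * (real CARD('m))\<^sup>2 * (norm v)\<^sup>2"
      by (simp add: power_mult_distrib mult.assoc)
  qed (use d s in auto)
  then show ?thesis by (auto simp: cdiff_at_def)
qed

lemma holomorphic_map_component:
  assumes "holomorphic_map_on H U" "z \<in> U"
  shows "cdiff_at (\<lambda>z. H z $ a) z"
proof -
  obtain A where "(H has_derivative (\<lambda>v. A *v v)) (at z)"
    using assms by (auto simp: holomorphic_map_on_def)
  from bounded_linear.has_derivative[OF bounded_linear_vec_nth this]
  show ?thesis by (auto simp: cdiff_at_def matrix_vector_mult_def)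
qed

lemma real_analytic_at_compose_holomorphic:
  assumes "holomorphic_map_on H U" "open U" "z \<in> U" "real_analytic_at \<rho> (H z)"
  shows "real_analytic_at (\<lambda>z. \<rho> (H z)) z"
proof (rule real_analytic_at_compose[where f = \<rho> and h = H and p = z, OF assms(4)])
  fix b :: "complex ^ 'b" assume "b \<in> Basis"
  then obtain a u where b: "b = axis a u" "u = 1 \<or> u = \<i>"
    by (auto simp: Basis_vec_def Basis_complex_def)
  have "H x \<bullet> b = (if u = 1 then Re (H x $ a) else Im (H x $ a))" for x
    using b by (auto simp: inner_axis inner_complex_def)
  then show "real_analytic_at (\<lambda>x. H x \<bullet> b) z"
    using real_analytic_Re[OF assms(2,3) holomorphic_map_component[OF assms(1)]]
      real_analytic_Im[OF assms(2,3) holomorphic_map_component[OF assms(1)]]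
    by (cases "u = 1") simp_all
qed

text \<open>The extension restricted to the complexified line through \<open>x\<close> and
  \<open>y\<close> is a holomorphic function of one variable that vanishes for small real
  parameters, hence also at the parameter of \<open>y\<close>. The radius works for all pairs at
  once, which makes vanishing near a point a locally constant property.\<close>

lemma real_analytic_identity_local:
  fixes f :: "'a::euclidean_space \<Rightarrow> real"
  assumes "real_analytic_at f q"
  obtains d where "0 < d"
    "\<And>x y. x \<in> ball q d \<Longrightarrow> \<forall>\<^sub>F z in nhds x. f z = 0 \<Longrightarrow> y \<in> ball q d \<Longrightarrow> f y = 0"
proof -
  obtain r M F where "holo_ext f q r M F" using real_analytic_imp_holo_ext[OF assms] by blast
  then have r: "0 < r" and F: "sep_holo Basis r M F"
    and v: "\<And>v. coords v \<in> polydisc Basis r \<Longrightarrow> F (coords v) = of_real (f (q + v))"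
    by (auto simp: holo_ext_def)
  show ?thesis
  \<comment> \<open>With |x - q| < r/8 and |y - x| < r/4, every coordinate on the complex line stays
    below r/8 + 2 * (r/4) = 5r/8 for |\<zeta>| < 2, so the line stays in the polydisc and \<zeta> =
    1 is an interior parameter.\<close>
  proof (rule that[of "r/8"])
    fix x y assume x: "x \<in> ball q (r/8)" and ev: "\<forall>\<^sub>F z in nhds x. f z = 0" and y: "y \<in> ball q (r/8)"
    define a u where "a = x - q" and "u = y - x"
    have a: "norm a < r/8" and au: "norm (a + u) < r/8" using x y by (auto simp: a_def u_def dist_norm norm_minus_commute)
    have u: "norm u < r/4" using norm_triangle_ineq4[of "a + u" a] a au by simp
    define g where "g \<zeta> = F (\<lambda>b. if b \<in> Basis then of_real (a \<bullet> b) + \<zeta> * of_real (u \<bullet> b) else 0)" for \<zeta>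
    have gh: "g holomorphic_on ball 0 2" unfolding g_def
    proof (rule sep_holo_curve[OF finite_Basis F, where t = "5/8 * r"])
      show "(\<lambda>\<zeta>. complex_of_real (a \<bullet> b) + \<zeta> * complex_of_real (u \<bullet> b)) holomorphic_on ball 0 2" for b
        by (intro holomorphic_intros)
      show "norm (complex_of_real (a \<bullet> b) + \<zeta> * complex_of_real (u \<bullet> b)) \<le> 5/8 * r"
        if "b \<in> Basis" "\<zeta> \<in> ball 0 2" for b \<zeta>
      proof -
        have "norm (complex_of_real (a \<bullet> b) + \<zeta> * complex_of_real (u \<bullet> b)) \<le> \<bar>a \<bullet> b\<bar> + norm \<zeta> * \<bar>u \<bullet> b\<bar>"
          by (rule order_trans[OF norm_triangle_ineq]) (simp add: norm_mult)
        also have "\<dots> \<le> r/8 + 2 * (r/4)"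
          using that Basis_le_norm[OF that(1), of a] Basis_le_norm[OF that(1), of u] a u
          by (intro add_mono mult_mono) auto
        finally show ?thesis by simp
      qed
    qed (use r in auto)
    have gt: "g (of_real t) = of_real (f (x + t *\<^sub>R u))" if "norm (a + t *\<^sub>R u) < r" for t
    proof -
      have "(\<lambda>b. if b \<in> Basis then of_real (a \<bullet> b) + of_real t * of_real (u \<bullet> b) else 0) = coords (a + t *\<^sub>R u)"
        by (auto simp: coords_def inner_add_left)
      then have "g (of_real t) = F (coords (a + t *\<^sub>R u))" by (simp only: g_def)
      also have "\<dots> = of_real (f (q + (a + t *\<^sub>R u)))" by (rule v[OF coords_polydisc[OF that]])
      finally show ?thesis by (simp add: a_def)
    qed
    have "((\<lambda>t. x + t *\<^sub>R u) \<longlongrightarrow> x + 0 *\<^sub>R u) (at 0)" by (intro tendsto_intros)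
    then have "((\<lambda>t. x + t *\<^sub>R u) \<longlongrightarrow> x) (at 0)" by simp
    from eventually_compose_filterlim[OF ev this] have "\<forall>\<^sub>F t in at 0. f (x + t *\<^sub>R u) = 0" .
    then obtain e where e: "0 < e" "\<And>t. t \<noteq> 0 \<Longrightarrow> \<bar>t\<bar> < e \<Longrightarrow> f (x + t *\<^sub>R u) = 0"
      by (auto simp: eventually_at dist_real_def)
    define U where "U = complex_of_real ` ({0<..<min e 1})"
    have "g 1 = 0"
    proof (rule analytic_continuation[of g "ball 0 2" U 0])
      show "0 islimpt U"
        unfolding islimpt_approachable
      proof (intro allI impI)
        fix \<epsilon> :: real assume "0 < \<epsilon>"
        then have "min (\<epsilon>/2) (min e 1 / 2) \<in> {0<..<min e 1}" using e by auto
        then show "\<exists>x'\<in>U. x' \<noteq> 0 \<and> dist x' 0 < \<epsilon>"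
          unfolding U_def using \<open>0 < \<epsilon>\<close> e
          by (intro bexI[of _ "of_real (min (\<epsilon>/2) (min e 1 / 2))"]) auto
      qed
      show "g z = 0" if "z \<in> U" for z
      proof -
        obtain t where t: "z = of_real t" "0 < t" "t < e" "t < 1" using \<open>z \<in> U\<close> by (auto simp: U_def)
        have "norm (a + t *\<^sub>R u) \<le> norm a + t * norm u" using t norm_triangle_ineq[of a "t *\<^sub>R u"] by simp
        also have "\<dots> \<le> r/8 + 1 * (r/4)" using t a u by (intro add_mono mult_mono) auto
        also have "\<dots> < r" using r by simp
        finally show ?thesis using gt[of t] e t by simp
      qed
    qed (use gh e in \<open>auto simp: U_def\<close>)
    moreover have "g 1 = of_real (f y)" using gt[of 1] au r by (simp add: u_def)
    ultimately show "f y = 0" by simp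
  qed (use r in simp)
qed

theorem real_analytic_identity:
  fixes f :: "'a::euclidean_space \<Rightarrow> real"
  assumes S: "open S" "connected S" and f: "real_analytic_on f S"
    and a: "a \<in> S" "\<forall>\<^sub>F z in nhds a. f z = 0" and b: "b \<in> S"
  shows "f b = 0"
proof -
  have "\<forall>\<^sub>F z in nhds b. f z = 0"
  proof (rule connected_induction_simple[where P = "\<lambda>x. \<forall>\<^sub>F z in nhds x. f z = 0", OF S(2) a(1) b a(2)])
    fix q assume q: "q \<in> S"
    obtain d where d: "0 < d"
      "\<And>x y. x \<in> ball q d \<Longrightarrow> \<forall>\<^sub>F z in nhds x. f z = 0 \<Longrightarrow> y \<in> ball q d \<Longrightarrow> f y = 0"
      using real_analytic_identity_local f q unfolding real_analytic_on_def by metis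
    show "\<exists>T. openin (top_of_set S) T \<and> q \<in> T \<and>
        (\<forall>x\<in>T. \<forall>y\<in>T. (\<forall>\<^sub>F z in nhds x. f z = 0) \<longrightarrow> (\<forall>\<^sub>F z in nhds y. f z = 0))"
    proof (intro exI[of _ "S \<inter> ball q d"] conjI ballI impI)
      fix x y assume *: "x \<in> S \<inter> ball q d" "y \<in> S \<inter> ball q d" "\<forall>\<^sub>F z in nhds x. f z = 0"
      then have "\<forall>z\<in>ball q d. f z = 0" using d by blast
      then show "\<forall>\<^sub>F z in nhds y. f z = 0" using * eventually_nhds open_ball by blast
    qed (use d q in auto)
  qed
  then show ?thesis by (rule eventually_nhds_x_imp_x)
qed

section \<open>Propagation of zeros off a hypersurface\<close>

lemma add_in_ball_iff: "p + x \<in> ball p d \<longleftrightarrow> norm (x :: 'a::real_normed_vector) < d"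
  by (simp add: dist_norm)

lemma isCont_tendsto_nhds: "isCont f x \<Longrightarrow> (f \<longlongrightarrow> f x) (nhds x)"
  by (simp add: isCont_def tendsto_at_iff_tendsto_nhds)

text \<open>The intermediate value theorem along the normal direction \<open>N\<close> plays the
  part of the implicit function theorem: it finds zeros of \<rho> within an arbitrarily small
  multiple of t from the tangential line.\<close>

lemma zero_set_tangential:
  fixes \<rho> :: "'a::real_normed_vector \<Rightarrow> real"
  assumes \<rho>: "(\<rho> has_derivative D) (at p)" "\<rho> p = 0" and cont: "0 < d" "continuous_on (ball p d) \<rho>"
    and v: "D v = 0" and N: "D N = 1" and e: "0 < e"
  shows "\<exists>\<delta>>0. \<forall>t. 0 < t \<longrightarrow> t < \<delta> \<longrightarrow> (\<exists>s. \<bar>s\<bar> \<le> e * t \<and> \<rho> (p + (t *\<^sub>R v + s *\<^sub>R N)) = 0)"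
proof -
  define K where "K = norm v + e * norm N + 1"
  have K: "0 < K" using e by (auto simp: K_def intro!: add_nonneg_pos)
  have lin: "linear D" using \<rho>(1) has_derivative_linear by blast
  obtain \<delta>1 where \<delta>1: "0 < \<delta>1" "\<And>y. norm (y - p) < \<delta>1 \<Longrightarrow> norm (\<rho> y - \<rho> p - D (y - p)) \<le> e / (2 * K) * norm (y - p)"
    using \<rho>(1) e K unfolding has_derivative_at_alt by (metis divide_pos_pos mult_pos_pos zero_less_numeral)
  define \<delta> where "\<delta> = min \<delta>1 d / K"
  have \<delta>: "0 < \<delta>" using \<delta>1 cont K by (simp add: \<delta>_def)
  show ?thesis
  proof (rule exI[of _ \<delta>], intro conjI allI impI \<delta>)
    fix t :: real assume t: "0 < t" "t < \<delta>"
    have tK: "t * K < \<delta>1" "t * K < d"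
      using t K by (auto simp: \<delta>_def field_simps)
    have nx: "norm (t *\<^sub>R v + s *\<^sub>R N) \<le> t * K" if "\<bar>s\<bar> \<le> e * t" for s
    proof -
      have "norm (t *\<^sub>R v + s *\<^sub>R N) \<le> t * norm v + \<bar>s\<bar> * norm N"
        using norm_triangle_ineq[of "t *\<^sub>R v" "s *\<^sub>R N"] t by simp
      also have "\<dots> \<le> t * norm v + e * t * norm N" using that by (intro add_left_mono mult_right_mono) auto
      also have "\<dots> \<le> t * K" using t by (simp add: K_def algebra_simps)
      finally show ?thesis .
    qed
    \<comment> \<open>The error e t / 2 is smaller than |s| at the endpoints s = \<plusminus> e t,
      which decides the sign of \<rho> there.\<close>
    have est: "\<bar>\<rho> (p + (t *\<^sub>R v + s *\<^sub>R N)) - s\<bar> \<le> e * t / 2" if s: "\<bar>s\<bar> \<le> e * t" for s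
    proof -
      let ?x = "t *\<^sub>R v + s *\<^sub>R N"
      have "D ?x = s" using lin v N by (simp add: linear_add linear_cmul)
      then have "\<bar>\<rho> (p + ?x) - s\<bar> \<le> e / (2 * K) * norm ?x"
        using \<delta>1(2)[of "p + ?x"] nx[OF s] tK \<rho>(2) by simp
      also have "\<dots> \<le> e / (2 * K) * (t * K)" using nx[OF s] e K by (intro mult_left_mono) auto
      also have "\<dots> = e * t / 2" using K by simp
      finally show ?thesis .
    qed
    have et: "0 < e * t" using e t by simp
    have "\<exists>s\<ge>- (e * t). s \<le> e * t \<and> \<rho> (p + (t *\<^sub>R v + s *\<^sub>R N)) = 0"
    proof (rule IVT')
      show "\<rho> (p + (t *\<^sub>R v + (- (e * t)) *\<^sub>R N)) \<le> 0" using est[of "- (e * t)"] et by linarith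
      show "0 \<le> \<rho> (p + (t *\<^sub>R v + (e * t) *\<^sub>R N))" using est[of "e * t"] et by linarith
      show "continuous_on {- (e * t)..e * t} (\<lambda>s. \<rho> (p + (t *\<^sub>R v + s *\<^sub>R N)))"
      proof (rule continuous_on_compose2[OF cont(2)])
        show "continuous_on {- (e * t)..e * t} (\<lambda>s. p + (t *\<^sub>R v + s *\<^sub>R N))" by (intro continuous_intros)
        show "(\<lambda>s. p + (t *\<^sub>R v + s *\<^sub>R N)) ` {- (e * t)..e * t} \<subseteq> ball p d"
        proof (rule image_subsetI)
          fix s assume "s \<in> {- (e * t)..e * t}"
          then have "\<bar>s\<bar> \<le> e * t" by auto
          from nx[OF this] tK show "p + (t *\<^sub>R v + s *\<^sub>R N) \<in> ball p d" unfolding add_in_ball_iff by linarith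
        qed
      qed
    qed (use et in auto)
    then show "\<exists>s. \<bar>s\<bar> \<le> e * t \<and> \<rho> (p + (t *\<^sub>R v + s *\<^sub>R N)) = 0" by (auto simp: abs_le_iff)
  qed
qed

lemma linear_functional_normalize:
  fixes D :: "'a::real_vector \<Rightarrow> real"
  assumes "linear D" "D \<noteq> (\<lambda>v. 0)" obtains N where "D N = 1"
proof -
  obtain u where "D u \<noteq> 0" using assms(2) by auto
  then have "D ((1 / D u) *\<^sub>R u) = 1" using assms(1) by (simp add: linear_cmul)
  then show ?thesis by (rule that)
qed

text \<open>At zeros of \<rho> of the form p + t v + o(t) the function \<open>f\<close> vanishes, so
  t f'(v) is bounded by t times a multiple of \<open>e\<close>, with \<open>e\<close> arbitrary.
  This serves twice: to compare defining functions of one hypersurface, and to differentiate the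
  first-order vanishing condition along \<open>M\<close>.\<close>

lemma derivative_vanishes_tangential:
  fixes \<rho> :: "'a::real_normed_vector \<Rightarrow> real" and f :: "'a \<Rightarrow> 'b::real_normed_vector"
  assumes \<rho>: "(\<rho> has_derivative D) (at p)" "\<rho> p = 0" and cont: "0 < d" "continuous_on (ball p d) \<rho>"
    and D: "D \<noteq> (\<lambda>v. 0)" and f: "(f has_derivative f') (at p)"
    and fz: "\<And>z. z \<in> ball p d \<Longrightarrow> \<rho> z = 0 \<Longrightarrow> f z = 0" and v: "D v = 0"
  shows "f' v = 0"
proof -
  obtain N where N: "D N = 1"
    using linear_functional_normalize[OF has_derivative_linear[OF \<rho>(1)] D] by blast
  have lin: "linear f'" using f has_derivative_linear by blast
  define K where "K = norm (f' N) + norm v + norm N"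
  have key: "norm (f' v) \<le> e * K" if e: "0 < e" "e \<le> 1" for e
  proof -
    obtain \<delta> where \<delta>: "0 < \<delta>" "\<And>t. 0 < t \<Longrightarrow> t < \<delta> \<Longrightarrow> \<exists>s. \<bar>s\<bar> \<le> e * t \<and> \<rho> (p + (t *\<^sub>R v + s *\<^sub>R N)) = 0"
      using zero_set_tangential[OF \<rho> cont v N e(1)] by blast
    obtain \<delta>1 where \<delta>1: "0 < \<delta>1" "\<And>y. norm (y - p) < \<delta>1 \<Longrightarrow> norm (f y - f p - f' (y - p)) \<le> e * norm (y - p)"
      using f e unfolding has_derivative_at_alt by metis
    define L where "L = norm v + norm N + 1"
    have L: "0 < L" by (auto simp: L_def intro: add_nonneg_pos)
    define t where "t = min (\<delta> / 2) (min d \<delta>1 / (2 * L))"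
    have t: "0 < t" "t < \<delta>" using \<delta> \<delta>1 cont L by (auto simp: t_def)
    have "t * L \<le> min d \<delta>1 / (2 * L) * L" using L by (intro mult_right_mono) (auto simp: t_def)
    also have "\<dots> = min d \<delta>1 / 2" using L by simp
    also have "\<dots> < min d \<delta>1" using cont(1) \<delta>1(1) by linarith
    finally have tL: "t * L < d" "t * L < \<delta>1" by auto
    obtain s where s: "\<bar>s\<bar> \<le> e * t" "\<rho> (p + (t *\<^sub>R v + s *\<^sub>R N)) = 0" using \<delta>(2)[OF t] by blast
    let ?x = "t *\<^sub>R v + s *\<^sub>R N"
    have st: "\<bar>s\<bar> \<le> t" using s(1) e t mult_right_mono[of e 1 t] by linarith
    have nx: "norm ?x \<le> t * (norm v + norm N)"
    proof -
      have "norm ?x \<le> t * norm v + \<bar>s\<bar> * norm N"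
        using norm_triangle_ineq[of "t *\<^sub>R v" "s *\<^sub>R N"] t by simp
      also have "\<dots> \<le> t * norm v + t * norm N" using st by (intro add_left_mono mult_right_mono) auto
      finally show ?thesis by (simp add: algebra_simps)
    qed
    then have nx': "norm ?x < d" "norm ?x < \<delta>1" using tL t by (auto simp: L_def algebra_simps)
    have "p + ?x \<in> ball p d" unfolding add_in_ball_iff by (rule nx')
    then have "f (p + ?x) = 0" "f p = 0" using fz[of "p + ?x"] fz[of p] s(2) \<rho>(2) cont by simp_all
    then have "norm (f' ?x) \<le> e * norm ?x" using \<delta>1(2)[of "p + ?x"] nx' by simp
    moreover have "f' ?x = t *\<^sub>R f' v + s *\<^sub>R f' N" using lin by (simp add: linear_add linear_cmul)
    moreover have "norm (t *\<^sub>R f' v) \<le> norm (t *\<^sub>R f' v + s *\<^sub>R f' N) + norm (s *\<^sub>R f' N)"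
      using norm_triangle_ineq4[of "t *\<^sub>R f' v + s *\<^sub>R f' N" "s *\<^sub>R f' N"] by simp
    ultimately have "t * norm (f' v) \<le> e * norm ?x + \<bar>s\<bar> * norm (f' N)" using t by simp
    also have "\<dots> \<le> e * (t * (norm v + norm N)) + e * t * norm (f' N)"
      using nx s(1) e by (intro add_mono mult_left_mono mult_right_mono) auto
    also have "\<dots> = t * (e * K)" by (simp add: K_def algebra_simps)
    finally show ?thesis using t by simp
  qed
  have K: "0 \<le> K" by (simp add: K_def)
  have "norm (f' v) \<le> 0"
  proof (rule field_le_epsilon)
    fix e :: real assume e: "0 < e"
    define e' where "e' = min 1 (e / (K + 1))"
    have e': "0 < e'" "e' \<le> 1" using e K by (auto simp: e'_def)
    have "norm (f' v) \<le> e' * K" by (rule key[OF e'])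
    also have "\<dots> \<le> e / (K + 1) * (K + 1)" using K e by (intro mult_mono) (auto simp: e'_def)
    also have "\<dots> = e" using K by simp
    finally show "norm (f' v) \<le> 0 + e" by simp
  qed
  then show ?thesis by simp
qed

section \<open>Transport of zeros along a vector field\<close>

lemma derivative_along:
  fixes f :: "'a::real_normed_vector \<Rightarrow> real"
  assumes "(f has_derivative f') (at z)"
  shows "((\<lambda>t. f (z + t *\<^sub>R v)) has_real_derivative f' v) (at 0)"
proof -
  have "((\<lambda>t. z + t *\<^sub>R v) has_derivative (\<lambda>t. t *\<^sub>R v)) (at 0)" by (auto intro!: derivative_eq_intros)
  then have "((\<lambda>t. f (z + t *\<^sub>R v)) has_derivative (\<lambda>t. f' (t *\<^sub>R v))) (at 0)"
    using diff_chain_at[of "\<lambda>t. z + t *\<^sub>R v" "\<lambda>t. t *\<^sub>R v" 0 f f'] assms by (simp add: o_def)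
  moreover have "f' (t *\<^sub>R v) = f' v * t" for t
    using has_derivative_linear[OF assms] by (simp add: linear_cmul)
  ultimately show ?thesis by (simp add: has_field_derivative_def)
qed

lemma derivative_pos_increasing_along:
  fixes f :: "'a::real_normed_vector \<Rightarrow> real"
  assumes "(f has_derivative f') (at z)" "0 < f' v"
  shows "\<forall>\<^sub>F t in at_right 0. f z < f (z + t *\<^sub>R v)"
proof -
  obtain d where "0 < d" "\<And>h. 0 < h \<Longrightarrow> h < d \<Longrightarrow> f (z + 0 *\<^sub>R v) < f (z + (0 + h) *\<^sub>R v)"
    using DERIV_pos_inc_right[OF derivative_along[OF assms(1)] assms(2)] by blast
  then show ?thesis by (auto simp: eventually_at_right_field intro!: exI[of _ d])
qed

text \<open>Since \<open>X\<close> annihilates \<open>f\<close>, the perturbed function f - \<tau>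
  \<rho> grows along -X at the positive rate \<tau> d\<rho>(X). A maximum over \<open>K\<close>
  therefore cannot sit where a backward step remains in \<open>K\<close>, and is attained on \<rho>
  = 0, where the value is 0. Finally \<tau> tends to 0.\<close>

lemma nonpos_of_backward_invariant:
  fixes f \<rho> :: "'a::real_normed_vector \<Rightarrow> real" and X :: "'a \<Rightarrow> 'a"
  assumes K: "compact K"
    and f: "\<And>z. z \<in> K \<Longrightarrow> (f has_derivative Df z) (at z)"
    and \<rho>: "\<And>z. z \<in> K \<Longrightarrow> (\<rho> has_derivative D\<rho> z) (at z)" "\<And>z. z \<in> K \<Longrightarrow> 0 \<le> \<rho> z"
    and fz: "\<And>z. z \<in> K \<Longrightarrow> \<rho> z = 0 \<Longrightarrow> f z = 0"
    and X: "\<And>z. z \<in> K \<Longrightarrow> Df z (X z) = 0" "\<And>z. z \<in> K \<Longrightarrow> 0 < D\<rho> z (X z)"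
    and inv: "\<And>z. z \<in> K \<Longrightarrow> 0 < \<rho> z \<Longrightarrow> \<forall>\<^sub>F t in at_right 0. z + t *\<^sub>R (- X z) \<in> K"
    and z: "z \<in> K"
  shows "f z \<le> 0"
proof -
  have le: "f z \<le> \<tau> * \<rho> z" if \<tau>: "0 < \<tau>" for \<tau>
  proof -
    let ?g = "\<lambda>z. f z - \<tau> * \<rho> z"
    have dg: "(?g has_derivative (\<lambda>v. Df z v - \<tau> * D\<rho> z v)) (at z)" if "z \<in> K" for z
      using f[OF that] \<rho>(1)[OF that] by (auto intro!: derivative_eq_intros)
    have "continuous_on K ?g"
      using dg by (intro continuous_at_imp_continuous_on ballI) (blast intro: has_derivative_continuous)
    then obtain m where m: "m \<in> K" "\<And>y. y \<in> K \<Longrightarrow> ?g y \<le> ?g m"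
      using continuous_attains_sup[OF K] z by blast
    have "\<rho> m = 0"
    proof (rule ccontr)
      assume "\<rho> m \<noteq> 0"
      then have pos: "0 < \<rho> m" using \<rho>(2)[OF m(1)] by simp
      have lf: "linear (Df m)" "linear (D\<rho> m)" using f \<rho>(1) m(1) has_derivative_linear by blast+
      have "0 < Df m (- X m) - \<tau> * D\<rho> m (- X m)"
        using X[OF m(1)] \<tau> lf by (simp add: linear_neg)
      from derivative_pos_increasing_along[OF dg[OF m(1)] this]
      have "\<forall>\<^sub>F t in at_right 0. ?g m < ?g (m + t *\<^sub>R (- X m))" .
      then have "\<forall>\<^sub>F t in at_right (0::real). False"
        using inv[OF m(1) pos] by eventually_elim (use m(2) in \<open>meson not_less\<close>)
      then show False by simp
    qed
    then have "?g m = 0" using fz[OF m(1)] by simp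
    with m(2)[OF z] show ?thesis by simp
  qed
  have "f z \<le> 0 + e" if e: "0 < e" for e
  proof -
    have r: "0 \<le> \<rho> z" using \<rho>(2) z by blast
    have "f z \<le> e / (\<rho> z + 1) * \<rho> z" by (rule le) (use e r in auto)
    also have "\<dots> \<le> e / (\<rho> z + 1) * (\<rho> z + 1)" using e r by (intro mult_left_mono) auto
    also have "\<dots> = e" using r by simp
    finally show ?thesis by simp
  qed
  then show ?thesis by (rule field_le_epsilon)
qed

text \<open>Maximum principle for \<open>\<plusminus>f - \<tau>\<rho>\<close> on a lens-shaped region above \<open>q\<close>: following \<open>-X\<close> stays in
  the region, so the maximum sits on \<open>\<rho> = 0\<close>. No flow of \<open>X\<close> is needed.\<close>

lemma transport_vanishing:
  fixes f \<rho> :: "'a::euclidean_space \<Rightarrow> real" and X :: "'a \<Rightarrow> 'a"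
  assumes W: "open W" "q \<in> W"
    and f: "\<And>z. z \<in> W \<Longrightarrow> (f has_derivative Df z) (at z)"
    and \<rho>: "\<And>z. z \<in> W \<Longrightarrow> (\<rho> has_derivative D\<rho> z) (at z)"
    and fz: "\<And>z. z \<in> W \<Longrightarrow> \<rho> z = 0 \<Longrightarrow> f z = 0" and q: "\<rho> q = 0"
    and X: "\<And>z. z \<in> W \<Longrightarrow> Df z (X z) = 0" "0 < D\<rho> q (X q)"
    and cont: "isCont (\<lambda>z. D\<rho> z (X z)) q" "isCont X q"
  shows "\<exists>x\<in>W. \<forall>\<^sub>F z in nhds x. f z = 0"
proof -
  define c where "c = D\<rho> q (X q)"
  have c: "0 < c" using X(2) by (simp add: c_def)
  define B where "B = norm (X q) + 1"
  have B: "0 < B" by (auto simp: B_def intro: add_nonneg_pos)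
  have t1: "((\<lambda>z. D\<rho> z (X z)) \<longlongrightarrow> c) (nhds q)" using cont(1) by (simp add: c_def isCont_def tendsto_nhds_iff)
  have t2: "((\<lambda>z. norm (X z)) \<longlongrightarrow> norm (X q)) (nhds q)" using cont(2) by (intro tendsto_norm) (simp add: isCont_def tendsto_nhds_iff)
  have "\<forall>\<^sub>F z in nhds q. c / 2 < D\<rho> z (X z)" using t1 c by (intro order_tendstoD(1)) auto
  moreover have "\<forall>\<^sub>F z in nhds q. norm (X z) < B" using t2 by (intro order_tendstoD(2)) (auto simp: B_def)
  moreover have "\<forall>\<^sub>F z in nhds q. z \<in> W" using W by (rule eventually_nhds_in_open)
  ultimately have "\<forall>\<^sub>F z in nhds q. z \<in> W \<and> c / 2 < D\<rho> z (X z) \<and> norm (X z) < B" by eventually_elim auto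
  then obtain r0 where r0: "0 < r0" "\<And>z. dist z q < r0 \<Longrightarrow> z \<in> W \<and> c / 2 < D\<rho> z (X z) \<and> norm (X z) < B"
    unfolding eventually_nhds_metric by blast
  define r where "r = r0 / 2"
  have r: "0 < r" using r0 by (simp add: r_def)
  have rz: "z \<in> W" "c / 2 < D\<rho> z (X z)" "norm (X z) < B" if "z \<in> cball q r" for z
    using r0(2)[of z] that r by (auto simp: r_def dist_commute)
  \<comment> \<open>On the ball of radius \<open>r\<close> this bounds the term 2 \<eta> (z - q)
    \<bullet> X by c/4, below the lower bound c/2 of d\<rho>(X), so that \<open>\<kappa>\<close> too
    decreases along -X.\<close>
  define \<eta> where "\<eta> = c / (8 * r * B)"
  have \<eta>: "0 < \<eta>" using c r B by (simp add: \<eta>_def)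
  define \<kappa> where "\<kappa> z = \<rho> z + \<eta> * ((z - q) \<bullet> (z - q))" for z
  \<comment> \<open>In the lens, \<eta> |z - q|^2 \<le> \<delta> forces |z - q|^2 \<le> r^2/2, so
    the sphere of radius \<open>r\<close> is never reached and only \<rho> = 0 can stop a backward
    step.\<close>
  define \<delta> where "\<delta> = \<eta> * r\<^sup>2 / 2"
  have \<delta>: "0 < \<delta>" using \<eta> r by (simp add: \<delta>_def)
  have d\<kappa>: "(\<kappa> has_derivative (\<lambda>v. D\<rho> z v + \<eta> * (2 * ((z - q) \<bullet> v)))) (at z)" if "z \<in> W" for z
    unfolding \<kappa>_def using \<rho>[OF that] by (auto intro!: derivative_eq_intros simp: inner_commute algebra_simps)
  define K where "K = {z \<in> cball q r. 0 \<le> \<rho> z \<and> \<kappa> z \<le> \<delta>}"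
  have cW: "cball q r \<subseteq> W" using rz by blast
  have c\<rho>: "isCont \<rho> z" "isCont \<kappa> z" if "z \<in> W" for z
    using \<rho>[OF that] d\<kappa>[OF that] has_derivative_continuous by blast+
  have con: "continuous_on (cball q r) \<rho>" "continuous_on (cball q r) \<kappa>"
    using c\<rho> cW by (auto intro!: continuous_at_imp_continuous_on)
  have "compact K"
  proof -
    have "closed (cball q r \<inter> \<rho> -` {0..})" "closed (cball q r \<inter> \<kappa> -` {..\<delta>})"
      by (intro continuous_closed_preimage con; simp)+
    from closed_Int[OF this]
    have "compact (cball q r \<inter> ((cball q r \<inter> \<rho> -` {0..}) \<inter> (cball q r \<inter> \<kappa> -` {..\<delta>})))"
      by (rule compact_Int_closed[OF compact_cball])
    moreover have "K = cball q r \<inter> ((cball q r \<inter> \<rho> -` {0..}) \<inter> (cball q r \<inter> \<kappa> -` {..\<delta>}))" by (auto simp: K_def)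
    ultimately show ?thesis by simp
  qed
  have KW: "z \<in> W" "z \<in> cball q r" if "z \<in> K" for z using that cW by (auto simp: K_def)
  have inv: "\<forall>\<^sub>F t in at_right 0. z + t *\<^sub>R (- X z) \<in> K" if z: "z \<in> K" and pos: "0 < \<rho> z" for z
  proof -
    have "\<eta> * (norm (z - q))\<^sup>2 \<le> \<delta>" using z pos by (simp add: K_def \<kappa>_def power2_norm_eq_inner)
    then have "(norm (z - q))\<^sup>2 \<le> r\<^sup>2 / 2" using \<eta> by (simp add: \<delta>_def)
    also have "\<dots> < r\<^sup>2" using r by simp
    finally have nz: "norm (z - q) < r" using r by (simp add: power2_less_imp_less)
    have lin: "linear (D\<rho> z)" using \<rho>[OF KW(1)[OF z]] has_derivative_linear by blast
    have "\<bar>(z - q) \<bullet> X z\<bar> \<le> r * B"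
      using Cauchy_Schwarz_ineq2[of "z - q" "X z"] mult_mono[of "norm (z - q)" r "norm (X z)" B] nz rz(3)[OF KW(2)[OF z]] r by auto
    then have "2 * \<eta> * \<bar>(z - q) \<bullet> X z\<bar> \<le> 2 * \<eta> * (r * B)" using \<eta> by (intro mult_left_mono) auto
    also have "\<dots> = c / 4" using r B by (simp add: \<eta>_def)
    finally have "0 < D\<rho> z (X z) + \<eta> * (2 * ((z - q) \<bullet> X z))"
      using rz(2)[OF KW(2)[OF z]] c \<eta> abs_ge_minus_self[of "(z - q) \<bullet> X z"]
        mult_left_mono[of "- ((z - q) \<bullet> X z)" "\<bar>(z - q) \<bullet> X z\<bar>" "2 * \<eta>"] by simp
    then have neg: "0 < - (D\<rho> z (- X z) + \<eta> * (2 * ((z - q) \<bullet> (- X z))))"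
      using lin by (simp add: linear_neg)
    have "((\<lambda>z. - \<kappa> z) has_derivative (\<lambda>v. - (D\<rho> z v + \<eta> * (2 * ((z - q) \<bullet> v))))) (at z)"
      by (intro has_derivative_minus d\<kappa> KW(1)[OF z])
    from derivative_pos_increasing_along[OF this neg]
    have e1: "\<forall>\<^sub>F t in at_right 0. - \<kappa> z < - \<kappa> (z + t *\<^sub>R (- X z))" .
    have lim: "((\<lambda>t. z + t *\<^sub>R (- X z)) \<longlongrightarrow> z) (at_right 0)"
    proof -
      have "((\<lambda>t. z + t *\<^sub>R (- X z)) \<longlongrightarrow> z + 0 *\<^sub>R (- X z)) (at_right 0)" by (intro tendsto_intros)
      then show ?thesis by simp
    qed
    have "((\<lambda>t. \<rho> (z + t *\<^sub>R (- X z))) \<longlongrightarrow> \<rho> z) (at_right 0)"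
      by (rule isCont_tendsto_compose[OF c\<rho>(1)[OF KW(1)[OF z]] lim])
    then have e2: "\<forall>\<^sub>F t in at_right 0. 0 < \<rho> (z + t *\<^sub>R (- X z))" using pos by (rule order_tendstoD(1))
    have "((\<lambda>t. norm (z + t *\<^sub>R (- X z) - q)) \<longlongrightarrow> norm (z - q)) (at_right 0)" by (intro tendsto_intros lim)
    then have e3: "\<forall>\<^sub>F t in at_right 0. norm (z + t *\<^sub>R (- X z) - q) < r" using nz by (rule order_tendstoD(2))
    show ?thesis using e1 e2 e3
    proof eventually_elim
      case (elim t)
      have "\<kappa> z \<le> \<delta>" using z by (simp add: K_def)
      with elim show ?case by (simp add: K_def dist_norm norm_minus_commute)
    qed
  qed
  have fK: "f z = 0" if z: "z \<in> K" for z
  proof -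
    have K0: "0 \<le> \<rho> z" if "z \<in> K" for z using that by (simp add: K_def)
    have Xp: "0 < D\<rho> z (X z)" if "z \<in> K" for z using rz(2)[OF KW(2)[OF that]] c by simp
    have "f z \<le> 0"
      by (rule nonpos_of_backward_invariant[OF \<open>compact K\<close> f[OF KW(1)] \<rho>[OF KW(1)] K0 fz[OF KW(1)] X(1)[OF KW(1)] Xp inv z])
    moreover have "- f z \<le> 0"
    proof (rule nonpos_of_backward_invariant[OF \<open>compact K\<close> _ \<rho>[OF KW(1)] K0 _ _ Xp inv z])
      show "((\<lambda>z. - f z) has_derivative (\<lambda>v. - Df z v)) (at z)" if "z \<in> K" for z
        by (intro has_derivative_minus f KW(1)[OF that])
      show "- f z = 0" if "z \<in> K" "\<rho> z = 0" for z using fz KW(1) that by simp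
      show "- Df z (X z) = 0" if "z \<in> K" for z using X(1) KW(1) that by simp
    qed
    ultimately show ?thesis by simp
  qed
  have qW: "q \<in> W" by (rule W)
  have lim: "((\<lambda>t. q + t *\<^sub>R X q) \<longlongrightarrow> q) (at_right 0)"
  proof -
    have "((\<lambda>t. q + t *\<^sub>R X q) \<longlongrightarrow> q + 0 *\<^sub>R X q) (at_right 0)" by (intro tendsto_intros)
    then show ?thesis by simp
  qed
  have e1: "\<forall>\<^sub>F t in at_right 0. \<rho> q < \<rho> (q + t *\<^sub>R X q)"
    by (rule derivative_pos_increasing_along[OF \<rho>[OF qW] X(2)])
  have "((\<lambda>t. \<kappa> (q + t *\<^sub>R X q)) \<longlongrightarrow> \<kappa> q) (at_right 0)" by (rule isCont_tendsto_compose[OF c\<rho>(2)[OF qW] lim])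
  then have e2: "\<forall>\<^sub>F t in at_right 0. \<kappa> (q + t *\<^sub>R X q) < \<delta>"
    using \<delta> q by (intro order_tendstoD(2)) (auto simp: \<kappa>_def)
  have "((\<lambda>t. norm (q + t *\<^sub>R X q - q)) \<longlongrightarrow> norm (q - q)) (at_right 0)" by (intro tendsto_intros lim)
  then have e3: "\<forall>\<^sub>F t in at_right 0. norm (q + t *\<^sub>R X q - q) < r" using r by (intro order_tendstoD(2)) auto
  have "\<forall>\<^sub>F t in at_right (0::real). 0 < \<rho> (q + t *\<^sub>R X q) \<and> \<kappa> (q + t *\<^sub>R X q) < \<delta> \<and> norm (q + t *\<^sub>R X q - q) < r"
    using e1 e2 e3 by eventually_elim (use q in auto)
  then obtain t where t: "0 < \<rho> (q + t *\<^sub>R X q)" "\<kappa> (q + t *\<^sub>R X q) < \<delta>" "norm (q + t *\<^sub>R X q - q) < r"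
    using eventually_happens'[of "at_right (0::real)"] by force
  \<comment> \<open>A short step from \<open>q\<close> along \<open>X\<close> satisfies all three
    constraints strictly, hence lies in the interior of the lens, where \<open>f\<close> is already
    known to vanish.\<close>
  define x where "x = q + t *\<^sub>R X q"
  have xb: "x \<in> ball q r" using t by (simp add: x_def dist_norm)
  then have xW: "x \<in> W" using cW by auto
  have "\<forall>\<^sub>F z in nhds x. 0 < \<rho> z" 
    by (rule order_tendstoD(1)[OF isCont_tendsto_nhds[OF c\<rho>(1)[OF xW]] t(1)[folded x_def]])
  moreover have "\<forall>\<^sub>F z in nhds x. \<kappa> z < \<delta>" 
    by (rule order_tendstoD(2)[OF isCont_tendsto_nhds[OF c\<rho>(2)[OF xW]] t(2)[folded x_def]])
  moreover have "\<forall>\<^sub>F z in nhds x. z \<in> ball q r" using xb by (intro eventually_nhds_in_open open_ball)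
  ultimately have "\<forall>\<^sub>F z in nhds x. f z = 0"
    by eventually_elim (rule fK, simp add: K_def)
  then show ?thesis using xW by blast
qed


section \<open>Uniqueness of holomorphic functions along complex lines\<close>

lemma holomorphic_along_line:
  fixes f :: "complex ^ 'm \<Rightarrow> complex"
  assumes "open S" "\<And>\<zeta>. \<zeta> \<in> S \<Longrightarrow> cdiff_at f (a + \<zeta> *s u)"
  shows "(\<lambda>\<zeta>. f (a + \<zeta> *s u)) holomorphic_on S"
  using assms by (intro field_differentiable_imp_holomorphic_on field_differentiableI[OF cdiff_at_line])

lemma cdiff_identity_ball:
  fixes f :: "complex ^ 'm \<Rightarrow> complex"
  assumes f: "\<And>z. z \<in> ball p d \<Longrightarrow> cdiff_at f z" and ev: "\<forall>\<^sub>F z in nhds p. f z = 0" and y: "y \<in> ball p d"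
  shows "f y = 0"
proof -
  define u where "u = y - p"
  have u: "norm u < d" using y by (simp add: u_def dist_norm norm_minus_commute)
  obtain e where e: "0 < e" "\<And>z. dist z p < e \<Longrightarrow> f z = 0" using ev by (auto simp: eventually_nhds_metric)
  \<comment> \<open>Any radius above 1 for which \<zeta> u stays within distance \<open>d\<close>;
    for u = 0 there is no constraint and 2 is an arbitrary choice.\<close>
  define R where "R = (if norm u = 0 then 2 else d / norm u)"
  have R: "1 < R" using u by (auto simp: R_def field_simps)
  have Ru: "norm (\<zeta> *s u) < d" if "norm \<zeta> < R" for \<zeta>
    using that u by (auto simp: R_def norm_vector_smult field_simps split: if_splits)
  let ?g = "\<lambda>\<zeta>. f (p + \<zeta> *s u)"
  have hol: "?g holomorphic_on ball 0 R"
  proof (rule holomorphic_along_line[OF open_ball])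
    fix \<zeta> :: complex assume "\<zeta> \<in> ball 0 R"
    then show "cdiff_at f (p + \<zeta> *s u)" by (intro f) (simp only: add_in_ball_iff, rule Ru, simp)
  qed
  define \<epsilon> where "\<epsilon> = min R (e / (norm u + 1))"
  have \<epsilon>: "0 < \<epsilon>" "\<epsilon> \<le> R" using e R by (auto simp: \<epsilon>_def add_nonneg_pos)
  have "?g 1 = 0"
  proof (rule analytic_continuation_open[where s = "ball 0 \<epsilon>" and g = "\<lambda>_. 0" and f = ?g, OF open_ball open_ball _ _ _ hol])
    show "?g \<zeta> = 0" if "\<zeta> \<in> ball 0 \<epsilon>" for \<zeta>
    proof (rule e)
      have "norm \<zeta> < e / (norm u + 1)" using that by (simp add: \<epsilon>_def)
      then have "norm \<zeta> * (norm u + 1) < e" by (subst (asm) pos_less_divide_eq) (auto simp: add_nonneg_pos)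
      moreover have "norm \<zeta> * norm u \<le> norm \<zeta> * (norm u + 1)" by (intro mult_left_mono) auto
      ultimately show "dist (p + \<zeta> *s u) p < e" by (simp add: dist_norm norm_vector_smult)
    qed
  qed (use \<epsilon> R in auto)
  then show ?thesis by (simp add: u_def)
qed

text \<open>Hypersurfaces are sets of uniqueness. A complex line near \<open>p\<close> in a
  transversal direction \<open>u\<close> meets the zero set at every height Im \<zeta> = \<tau> in
  an interval, by the intermediate value theorem in Re \<zeta>. These infinitely many zeros
  accumulate inside the disc, so \<open>f\<close> vanishes on the line.\<close>

lemma cdiff_vanishing_on_hypersurface:
  fixes f :: "complex ^ 'm \<Rightarrow> complex" and \<rho> :: "complex ^ 'm \<Rightarrow> real"
  assumes d: "0 < d" and \<rho>: "(\<rho> has_derivative D) (at p)" "\<rho> p = 0" "D \<noteq> (\<lambda>v. 0)" "continuous_on (ball p d) \<rho>"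
    and f: "\<And>z. z \<in> ball p d \<Longrightarrow> cdiff_at f z"
    and fz: "\<And>z. z \<in> ball p d \<Longrightarrow> \<rho> z = 0 \<Longrightarrow> f z = 0"
  shows "\<forall>\<^sub>F z in nhds p. f z = 0"
proof -
  obtain u where u: "D u = 1"
    using linear_functional_normalize[OF has_derivative_linear[OF \<rho>(1)] \<rho>(3)] by blast
  have lin: "linear D" using \<rho>(1) by (rule has_derivative_linear)
  have u0: "0 < norm u" using u lin by (auto simp: linear_0)
  define R where "R = d / (2 * norm u)"
  have R: "0 < R" using d u0 by (simp add: R_def)
  have e1: "\<forall>\<^sub>F t in at_right 0. \<rho> p < \<rho> (p + t *\<^sub>R u)"
    by (rule derivative_pos_increasing_along[OF \<rho>(1)]) (simp add: u)
  have "((\<lambda>z. - \<rho> z) has_derivative (\<lambda>v. - D v)) (at p)" by (intro has_derivative_minus \<rho>)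
  then have e2: "\<forall>\<^sub>F t in at_right 0. - \<rho> p < - \<rho> (p + t *\<^sub>R (- u))"
    by (rule derivative_pos_increasing_along) (use u lin in \<open>simp add: linear_neg\<close>)
  have e3: "\<forall>\<^sub>F t in at_right 0. 0 < t \<and> t < R / 4"
    using R by (auto simp: eventually_at_right_field intro!: exI[of _ "R/4"])
  have "\<forall>\<^sub>F t in at_right 0. 0 < t \<and> t < R / 4 \<and> 0 < \<rho> (p + t *\<^sub>R u) \<and> \<rho> (p + t *\<^sub>R (- u)) < 0"
    using e1 e2 e3 by eventually_elim (use \<rho>(2) in auto)
  then obtain t0 where t0: "0 < t0" "t0 < R / 4" "0 < \<rho> (p + t0 *\<^sub>R u)" "\<rho> (p + t0 *\<^sub>R (- u)) < 0"
    using eventually_happens'[of "at_right (0::real)"] by force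
  have t0u: "norm (t0 *\<^sub>R u) < d" "norm (t0 *\<^sub>R (- u)) < d"
    using t0 d u0 by (auto simp: R_def field_simps)
  have c: "isCont \<rho> z" if "z \<in> ball p d" for z
    using \<rho>(4) that by (simp add: continuous_on_eq_continuous_at)
  have "\<forall>\<^sub>F z in nhds (p + t0 *\<^sub>R u). 0 < \<rho> z"
    by (rule order_tendstoD(1)[OF isCont_tendsto_nhds[OF c] t0(3)]) (simp only: add_in_ball_iff t0u)
  then obtain k1 where k1: "0 < k1" "\<And>z. dist z (p + t0 *\<^sub>R u) < k1 \<Longrightarrow> 0 < \<rho> z" by (auto simp: eventually_nhds_metric)
  have "\<forall>\<^sub>F z in nhds (p + t0 *\<^sub>R (- u)). \<rho> z < 0"
    by (rule order_tendstoD(2)[OF isCont_tendsto_nhds[OF c] t0(4)]) (simp only: add_in_ball_iff t0u)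
  then obtain k2 where k2: "0 < k2" "\<And>z. dist z (p + t0 *\<^sub>R (- u)) < k2 \<Longrightarrow> \<rho> z < 0" by (auto simp: eventually_nhds_metric)
  \<comment> \<open>The signs of \<rho> at p \<plusminus> t0 u survive perturbations of size
    \<open>k\<close>. One half of \<open>k\<close> is spent on moving \<open>p\<close> to
    \<open>z\<close>, the other on the imaginary shift, which \<sigma> |u| \<le> k/2
    controls.\<close>
  define k where "k = min (min k1 k2) (d / 2)"
  have k: "0 < k" using k1 k2 d by (simp add: k_def)
  define \<sigma> where "\<sigma> = min (R / 4) (k / (2 * norm u))"
  have \<sigma>: "0 < \<sigma>" "\<sigma> \<le> R/4" "\<sigma> * norm u \<le> k / 2" using R k u0 by (auto simp: \<sigma>_def min_def field_simps)
  show ?thesis unfolding eventually_nhds_metric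
  proof (intro exI[of _ "k / 2"] conjI allI impI)
    show "0 < k / 2" using k by simp
    fix z assume z: "dist z p < k / 2"
    have zb: "z + \<zeta> *s u \<in> ball p d" if "norm \<zeta> < R" for \<zeta>
    proof -
      have "norm (\<zeta> *s u) < R * norm u" unfolding norm_vector_smult using that u0 by simp
      also have "R * norm u = d / 2" using u0 by (simp add: R_def)
      finally have "norm (\<zeta> *s u) < d / 2" .
      moreover have "norm (z - p) < d / 2" using z k by (simp add: dist_norm k_def)
      moreover have "z + \<zeta> *s u = p + ((z - p) + \<zeta> *s u)" by simp
      ultimately show ?thesis using norm_triangle_ineq[of "z - p" "\<zeta> *s u"] by (simp only: add_in_ball_iff)
    qed
    let ?g = "\<lambda>\<zeta>. f (z + \<zeta> *s u)"
    have hol: "?g holomorphic_on ball 0 R"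
      by (rule holomorphic_along_line[OF open_ball]) (intro f zb, simp)
    have "\<exists>t. \<bar>t\<bar> \<le> t0 \<and> ?g (Complex t \<tau>) = 0" if \<tau>: "0 \<le> \<tau>" "\<tau> \<le> \<sigma>" for \<tau>
    proof -
      have CR: "norm (Complex t \<tau>) < R" if "\<bar>t\<bar> \<le> t0" for t
        using cmod_le[of "Complex t \<tau>"] that \<tau> t0 \<sigma> R by simp
      have near: "dist (z + Complex s \<tau> *s u) (p + s *\<^sub>R u) < k" for s
      proof -
        have E: "z + Complex s \<tau> *s u - (p + s *\<^sub>R u) = (z - p) + Complex 0 \<tau> *s u"
          by (simp add: vec_eq_iff complex_eq_iff algebra_simps)
        have "norm (Complex 0 \<tau> *s u) \<le> k / 2"
          unfolding norm_vector_smult using \<tau> \<sigma> mult_right_mono[of \<tau> \<sigma> "norm u"] by (simp add: complex_norm)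
        then show ?thesis
          using z norm_triangle_ineq[of "z - p" "Complex 0 \<tau> *s u"] unfolding dist_norm E by linarith
      qed
      have "\<exists>t\<ge>- t0. t \<le> t0 \<and> \<rho> (z + Complex t \<tau> *s u) = 0"
      proof (rule IVT')
        show "\<rho> (z + Complex (- t0) \<tau> *s u) \<le> 0"
          using k2(2)[of "z + Complex (- t0) \<tau> *s u"] near[of "- t0"] by (simp add: k_def)
        show "0 \<le> \<rho> (z + Complex t0 \<tau> *s u)"
          using k1(2)[of "z + Complex t0 \<tau> *s u"] near[of t0] by (simp add: k_def)
        show "continuous_on {- t0..t0} (\<lambda>t. \<rho> (z + Complex t \<tau> *s u))"
        proof (rule continuous_on_compose2[OF \<rho>(4)])
          have "(\<lambda>t. z + Complex t \<tau> *s u) = (\<lambda>t. (z + Complex 0 \<tau> *s u) + t *\<^sub>R u)"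
            by (simp add: vec_eq_iff complex_eq_iff fun_eq_iff algebra_simps)
          then show "continuous_on {- t0..t0} (\<lambda>t. z + Complex t \<tau> *s u)"
            by (simp only:) (intro continuous_intros)
          show "(\<lambda>t. z + Complex t \<tau> *s u) ` {- t0..t0} \<subseteq> ball p d"
            by (rule image_subsetI, intro zb CR) auto
        qed
      qed (use t0 in auto)
      then obtain t where t: "- t0 \<le> t" "t \<le> t0" "\<rho> (z + Complex t \<tau> *s u) = 0" by blast
      then have "?g (Complex t \<tau>) = 0" by (intro fz zb CR) auto
      with t show ?thesis by (intro exI[of _ t]) auto
    qed
    then obtain T where T: "\<And>\<tau>. 0 \<le> \<tau> \<Longrightarrow> \<tau> \<le> \<sigma> \<Longrightarrow> \<bar>T \<tau>\<bar> \<le> t0 \<and> ?g (Complex (T \<tau>) \<tau>) = 0" by metis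
    define Z where "Z = (\<lambda>\<tau>. Complex (T \<tau>) \<tau>) ` {0..\<sigma>}"
    have "inj_on (\<lambda>\<tau>. Complex (T \<tau>) \<tau>) {0..\<sigma>}" by (auto simp: inj_on_def)
    then have inf: "infinite Z" using \<sigma>(1) by (simp add: Z_def finite_image_iff)
    have ZR: "Z \<subseteq> cball 0 (R/2)"
    proof
      fix \<zeta> assume "\<zeta> \<in> Z"
      then obtain \<tau> where \<tau>: "0 \<le> \<tau>" "\<tau> \<le> \<sigma>" "\<zeta> = Complex (T \<tau>) \<tau>" by (auto simp: Z_def)
      then show "\<zeta> \<in> cball 0 (R/2)" using cmod_le[of \<zeta>] T[OF \<tau>(1,2)] t0 \<sigma> by simp
    qed
    obtain \<xi> where \<xi>: "\<xi> \<in> cball 0 (R/2)" "\<xi> islimpt Z"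
      using Heine_Borel_imp_Bolzano_Weierstrass[OF compact_cball inf ZR] by blast
    have "?g 0 = 0"
    proof (rule analytic_continuation[of ?g "ball 0 R" Z \<xi>, OF hol open_ball _ _ _ \<xi>(2)])
      show "Z \<subseteq> ball 0 R" using ZR R by fastforce
      show "?g w = 0" if "w \<in> Z" for w using that T by (auto simp: Z_def)
    qed (use R \<xi> in auto)
    then show "f z = 0" by simp
  qed
qed

section \<open>Hermitian forms\<close>

definition hip :: "complex ^ 'n \<Rightarrow> complex ^ 'n \<Rightarrow> complex" where
  "hip u v = (\<Sum>j\<in>UNIV. u $ j * cnj (v $ j))"

definition hform :: "('n \<Rightarrow> 'n \<Rightarrow> complex) \<Rightarrow> complex ^ 'n \<Rightarrow> complex ^ 'n \<Rightarrow> complex" where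
  "hform C u v = (\<Sum>j\<in>UNIV. \<Sum>k\<in>UNIV. C j k * u $ j * cnj (v $ k))"

lemma hip_simps [simp]:
  "hip (u + v) w = hip u w + hip v w" "hip w (u + v) = hip w u + hip w v"
  "hip (u - v) w = hip u w - hip v w" "hip w (u - v) = hip w u - hip w v"
  "hip (c *s u) w = c * hip u w" "hip w (c *s u) = cnj c * hip w u"
  "hip 0 w = 0" "hip w 0 = 0"
  by (simp_all add: hip_def algebra_simps sum.distrib sum_distrib_left sum_subtractf)

lemma cnj_hip: "cnj (hip u v) = hip v u"
  by (simp add: hip_def mult.commute)

lemma hip_sum_left: "hip (sum f A) w = (\<Sum>i\<in>A. hip (f i) w)"
  by (induction A rule: infinite_finite_induct) auto

lemma hip_self: "hip u u = complex_of_real ((norm u)\<^sup>2)"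
proof -
  have "hip u u = complex_of_real (\<Sum>j\<in>UNIV. (norm (u $ j))\<^sup>2)"
    unfolding hip_def by (simp only: of_real_sum complex_norm_square)
  also have "(\<Sum>j\<in>UNIV. (norm (u $ j))\<^sup>2) = (norm u)\<^sup>2"
    by (simp add: norm_vec_def L2_set_def sum_nonneg)
  finally show ?thesis .
qed

lemma hip_self_eq_0: "hip u u = 0 \<longleftrightarrow> u = 0"
  by (simp add: hip_self)

lemma hform_simps [simp]:
  "hform C (u + v) w = hform C u w + hform C v w" "hform C w (u + v) = hform C w u + hform C w v"
  "hform C (c *s u) w = c * hform C u w" "hform C w (c *s u) = cnj c * hform C w u"
  "hform C 0 w = 0" "hform C w 0 = 0"
  by (simp_all add: hform_def algebra_simps sum.distrib sum_distrib_left)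

lemma hform_sum_left: "hform C (sum f A) w = (\<Sum>i\<in>A. hform C (f i) w)"
  by (induction A rule: infinite_finite_induct) auto

lemma cnj_hform:
  assumes "\<And>j k. C k j = cnj (C j k)" shows "cnj (hform C u v) = hform C v u"
proof -
  have "cnj (hform C u v) = (\<Sum>j\<in>UNIV. \<Sum>k\<in>UNIV. C k j * v $ k * cnj (u $ j))"
    unfolding hform_def cnj_sum complex_cnj_mult complex_cnj_cnj assms[symmetric] by (simp add: mult_ac)
  also have "\<dots> = hform C v u" unfolding hform_def by (rule sum.swap)
  finally show ?thesis .
qed

text \<open>First-order condition at a maximum: for small t of the sign of \<open>a\<close> the
  linear term would win.\<close>

lemma linear_bounded_quadratic_eq_0:
  fixes a b :: real
  assumes "\<And>t. 2 * t * a + t\<^sup>2 * b \<le> 0" shows "a = 0"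
proof (rule ccontr)
  assume a: "a \<noteq> 0"
  define t where "t = a / (\<bar>b\<bar> + 1)"
  have k: "0 < \<bar>b\<bar> + 1" by simp
  have "a = t * (\<bar>b\<bar> + 1)" using k by (simp add: t_def)
  then have "2 * t * a + t\<^sup>2 * b = 2 * t * (t * (\<bar>b\<bar> + 1)) + t\<^sup>2 * b" by simp
  then have "2 * t * a + t\<^sup>2 * b = t\<^sup>2 * (2 * (\<bar>b\<bar> + 1) + b)"
    by (simp add: power2_eq_square algebra_simps)
  moreover have "0 < t\<^sup>2" using a k by (simp add: t_def)
  moreover have "0 < 2 * (\<bar>b\<bar> + 1) + b"
    using abs_ge_minus_self[of b] abs_ge_zero[of b] by (simp add: algebra_simps)
  ultimately show False using assms[of t] by (simp add: zero_less_mult_iff mult_le_0_iff)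
qed

text \<open>First variation of the Rayleigh quotient at its maximum. Real perturbations along
  \<open>v\<close> give the real part of the eigenvalue equation, perturbations along \<i> v the
  imaginary part.\<close>

lemma hermitian_maximizer_eigenvector:
  assumes C: "\<And>j k. C k j = cnj (C j k)" and V: "vec.subspace V"
    and u: "u \<in> V" "norm u = 1" and max: "\<And>v. v \<in> V \<Longrightarrow> norm v = 1 \<Longrightarrow> Re (hform C v v) \<le> Re (hform C u u)"
    and v: "v \<in> V"
  shows "hform C u v = of_real (Re (hform C u u)) * hip u v"
proof -
  define m where "m = Re (hform C u u)"
  have le: "Re (hform C w w) \<le> m * (norm w)\<^sup>2" if w: "w \<in> V" for w
  proof (cases "w = 0")
    case False
    define c where "c = norm w"
    have c: "0 < c" using False by (simp add: c_def)
    define x where "x = complex_of_real (1 / c) *s w"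
    have "x \<in> V" unfolding x_def using V w by (rule vec.subspace_scale)
    moreover have "norm x = 1" unfolding x_def norm_vector_smult using c by (simp add: c_def norm_divide)
    ultimately have "Re (hform C x x) \<le> m" unfolding m_def by (rule max)
    moreover have "hform C x x = complex_of_real (1 / c) * (complex_of_real (1 / c) * hform C w w)"
      unfolding x_def by (simp only: hform_simps complex_cnj_complex_of_real)
    then have "Re (hform C x x) = Re (hform C w w) / c\<^sup>2"
      by (simp add: power2_eq_square)
    ultimately show ?thesis using c by (simp add: c_def divide_simps split: if_splits)
  qed simp
  have re: "Re (hform C u w) = m * Re (hip u w)" if w: "w \<in> V" for w
  proof -
    have "2 * t * (Re (hform C u w) - m * Re (hip u w)) + t\<^sup>2 * (Re (hform C w w) - m * (norm w)\<^sup>2) \<le> 0" for t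
    proof -
      let ?x = "u + of_real t *s w"
      have x: "?x \<in> V" using V u w by (intro vec.subspace_add vec.subspace_scale)
      have "Re (hform C w u) = Re (hform C u w)" using cnj_hform[of C u w, OF C] by (metis cnj.simps(1))
      then have 1: "Re (hform C ?x ?x) = m + 2 * t * Re (hform C u w) + t\<^sup>2 * Re (hform C w w)"
        by (simp add: m_def power2_eq_square algebra_simps)
      have "Re (hip w u) = Re (hip u w)" using cnj_hip[of u w] by (metis cnj.simps(1))
      then have "Re (hip ?x ?x) = Re (hip u u) + 2 * t * Re (hip u w) + t\<^sup>2 * Re (hip w w)"
        by (simp add: power2_eq_square algebra_simps)
      then have 2: "(norm ?x)\<^sup>2 = 1 + 2 * t * Re (hip u w) + t\<^sup>2 * (norm w)\<^sup>2"
        by (simp add: hip_self u)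
      from le[OF x] show ?thesis unfolding 1 2 by (simp add: algebra_simps)
    qed
    from linear_bounded_quadratic_eq_0[OF this] show ?thesis by simp
  qed
  have iv: "\<i> *s v \<in> V" using V v by (rule vec.subspace_scale)
  have "hform C u v = of_real m * hip u v"
    using re[OF v] re[OF iv] by (simp add: complex_eq_iff)
  then show ?thesis by (simp add: m_def)
qed

lemma vec_subspace_imp_subspace: "vec.subspace V \<Longrightarrow> subspace (V :: (complex ^ 'n) set)"
  unfolding subspace_def using vec.subspace_scale[of V _ "of_real _"]
  by (auto simp: of_real_smult vec.subspace_0 vec.subspace_add)

text \<open>Spectral theorem for the form restricted to \<open>V\<close>: split off a maximizer
  \<open>u\<close> of the Rayleigh quotient and continue in its orthogonal complement. Eigenvectors
  found there remain eigenvectors on \<open>V\<close>, because the eigenvalue equation for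
  \<open>u\<close> makes the form vanish between \<open>u\<close> and its complement.\<close>

theorem hermitian_eigenbasis:
  fixes V :: "(complex ^ 'n) set"
  assumes C: "\<And>j k. C k j = cnj (C j k)" and V: "vec.subspace V"
  shows "\<exists>B \<mu>. finite B \<and> B \<subseteq> V \<and> V \<subseteq> vec.span B \<and> (\<forall>b\<in>B. \<forall>c\<in>B. hip b c = (if b = c then 1 else 0)) \<and>
    (\<forall>b\<in>B. \<forall>v\<in>V. hform C b v = complex_of_real (\<mu> b) * hip b v)"
  using V
proof (induction "vec.dim V" arbitrary: V rule: less_induct)
  case less
  note V = less.prems
  show ?case
  proof (cases "V = {0}")
    case True
    then show ?thesis by (intro exI[of _ "{}"]) auto
  next
    case False
    then obtain w where w: "w \<in> V" "w \<noteq> 0" using vec.subspace_0[OF V] by auto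
    define K where "K = V \<inter> sphere 0 1"
    have "compact K" unfolding K_def
      by (intro closed_Int_compact compact_sphere closed_subspace vec_subspace_imp_subspace V)
    moreover have "complex_of_real (1 / norm w) *s w \<in> K"
      using w vec.subspace_scale[OF V w(1)] by (simp add: K_def norm_vector_smult norm_divide)
    moreover have "continuous_on K (\<lambda>u. Re (hform C u u))"
      unfolding hform_def by (intro continuous_intros)
    ultimately obtain u where u: "u \<in> K" "\<And>v. v \<in> K \<Longrightarrow> Re (hform C v v) \<le> Re (hform C u u)"
      using continuous_attains_sup[of K "\<lambda>u. Re (hform C u u)"] by blast
    have uV: "u \<in> V" "norm u = 1" using u by (auto simp: K_def)
    have eu: "hform C u v = of_real (Re (hform C u u)) * hip u v" if "v \<in> V" for v
      by (rule hermitian_maximizer_eigenvector[of C V, OF C V uV _ that]) (use u in \<open>auto simp: K_def\<close>)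
    have uu: "hip u u = 1" by (simp add: hip_self uV)
    define V' where "V' = {v \<in> V. hip v u = 0}"
    have V': "vec.subspace V'" using V unfolding V'_def vec.subspace_def by auto
    have "u \<notin> V'" using uu by (simp add: V'_def)
    moreover have "V' \<subseteq> V" by (auto simp: V'_def)
    ultimately have "V' \<subset> V" using uV by blast
    then have "vec.span V' \<subset> vec.span V" using V V' by (simp add: vec.span_eq_iff[THEN iffD2])
    then have "vec.dim V' < vec.dim V" by (rule vec.dim_psubset)
    from less.hyps[OF this V'] obtain B \<mu> where "finite B \<and> B \<subseteq> V' \<and> V' \<subseteq> vec.span B \<and>
      (\<forall>b\<in>B. \<forall>c\<in>B. hip b c = (if b = c then 1 else 0)) \<and>
      (\<forall>b\<in>B. \<forall>v\<in>V'. hform C b v = complex_of_real (\<mu> b) * hip b v)"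
      by (elim exE)
    then have B: "finite B" "B \<subseteq> V'" "V' \<subseteq> vec.span B"
      "\<And>b c. b \<in> B \<Longrightarrow> c \<in> B \<Longrightarrow> hip b c = (if b = c then 1 else 0)"
      "\<And>b v. b \<in> B \<Longrightarrow> v \<in> V' \<Longrightarrow> hform C b v = complex_of_real (\<mu> b) * hip b v" by simp_all
    have bu: "hip b u = 0" "hip u b = 0" if "b \<in> B" for b
    proof -
      show "hip b u = 0" using that B(2) by (auto simp: V'_def)
      then show "hip u b = 0" using cnj_hip[of b u] by simp
    qed
    have ub: "u \<notin> B" using bu uu by auto
    have dec: "v - hip v u *s u \<in> V'" if "v \<in> V" for v
      using that uV V uu by (auto simp: V'_def intro!: vec.subspace_diff vec.subspace_scale)
    show ?thesis
    proof (intro exI[of _ "insert u B"] exI[of _ "\<mu>(u := Re (hform C u u))"] conjI ballI subsetI)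
      show "finite (insert u B)" using B by simp
      show "x \<in> V" if "x \<in> insert u B" for x using that B(2) uV by (auto simp: V'_def)
      show "v \<in> vec.span (insert u B)" if v: "v \<in> V" for v
        unfolding vec.span_insert using dec[OF v] B(3) by blast
      show "hip b c = (if b = c then 1 else 0)" if "b \<in> insert u B" "c \<in> insert u B" for b c
        using that B(4) bu uu ub by (auto split: if_splits)
      show "hform C b v = complex_of_real ((\<mu>(u := Re (hform C u u))) b) * hip b v"
        if b: "b \<in> insert u B" and v: "v \<in> V" for b v
      proof (cases "b = u")
        case False
        then have b: "b \<in> B" using b by simp
        have bV: "b \<in> V" using b B(2) by (auto simp: V'_def)
        have "hform C b u = 0" using eu[OF bV] bu[OF b] cnj_hform[of C u b, OF C] by simp
        moreover have "v = (v - hip v u *s u) + hip v u *s u" by simp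
        ultimately have "hform C b v = hform C b (v - hip v u *s u)" by (metis hform_simps(2,4) mult_zero_right add_0_right)
        also have "\<dots> = complex_of_real (\<mu> b) * hip b (v - hip v u *s u)" by (rule B(5)[OF b dec[OF v]])
        also have "\<dots> = complex_of_real (\<mu> b) * hip b v" by (simp add: bu[OF b])
        finally show ?thesis using False by simp
      qed (use eu v in simp)
    qed
  qed
qed

section \<open>Counting eigenvalues of a restricted hermitian form\<close>

definition heigenspace :: "('n \<Rightarrow> 'n \<Rightarrow> complex) \<Rightarrow> (complex ^ 'n) set \<Rightarrow> real \<Rightarrow> (complex ^ 'n) set" where
  "heigenspace C V \<mu> = {u \<in> V. \<forall>v\<in>V. hform C u v = complex_of_real \<mu> * hip u v}"

definition hcount :: "('n \<Rightarrow> 'n \<Rightarrow> complex) \<Rightarrow> (complex ^ 'n) set \<Rightarrow> real set \<Rightarrow> nat" where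
  "hcount C V S = (\<Sum>\<mu> | \<mu> \<in> S \<and> heigenspace C V \<mu> \<noteq> {0}. vec.dim (heigenspace C V \<mu>))"

context
  fixes C :: "'n::finite \<Rightarrow> 'n \<Rightarrow> complex" and V B \<mu>
  assumes V: "vec.subspace V" and B: "finite B" "B \<subseteq> V" "V \<subseteq> vec.span B"
    and on: "\<And>b c. b \<in> B \<Longrightarrow> c \<in> B \<Longrightarrow> hip b c = (if b = c then 1 else 0)"
    and eig: "\<And>b v. b \<in> B \<Longrightarrow> v \<in> V \<Longrightarrow> hform C b v = complex_of_real (\<mu> b) * hip b v"
begin

lemma eigenbasis_hip_sum: "b \<in> B \<Longrightarrow> D \<subseteq> B \<Longrightarrow> hip (\<Sum>c\<in>D. x c *s c) b = (if b \<in> D then x b else 0)"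
proof -
  assume b: "b \<in> B" "D \<subseteq> B"
  have "hip (\<Sum>c\<in>D. x c *s c) b = (\<Sum>c\<in>D. if c = b then x c else 0)"
    unfolding hip_sum_left using b by (intro sum.cong) (auto simp: on subset_iff)
  also have "\<dots> = (if b \<in> D then x b else 0)" using b finite_subset[OF b(2) B(1)] by (simp add: sum.delta)
  finally show ?thesis .
qed

lemma eigenbasis_independent: "D \<subseteq> B \<Longrightarrow> vec.independent D"
proof
  assume D: "D \<subseteq> B" "vec.dependent D"
  then obtain x d where x: "d \<in> D" "x d \<noteq> 0" "(\<Sum>c\<in>D. x c *s c) = 0"
    using vec.dependent_finite[OF finite_subset[OF D(1) B(1)]] by auto
  then have "x d = hip (\<Sum>c\<in>D. x c *s c) d" using eigenbasis_hip_sum[of d D x] D by auto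
  with x show False by simp
qed

lemma eigenbasis_span: "D \<subseteq> B \<Longrightarrow> v \<in> vec.span D \<longleftrightarrow> (\<exists>x. v = (\<Sum>c\<in>D. x c *s c))"
  using vec.span_finite[OF finite_subset[OF _ B(1)]] by auto

lemma eigenbasis_dim: "D \<subseteq> B \<Longrightarrow> vec.dim (vec.span D) = card D"
  by (simp add: vec.dim_eq_card_independent eigenbasis_independent)

lemma eigenbasis_span_eq: "vec.span B = V"
  using B V by (metis vec.span_minimal subset_antisym)

lemma eigenbasis_dim_V: "vec.dim V = card B"
  using eigenbasis_dim[of B] unfolding eigenbasis_span_eq by blast

lemma heigenspace_eq: "heigenspace C V m = vec.span {b \<in> B. \<mu> b = m}"
proof (intro equalityI subsetI)
  let ?D = "{b \<in> B. \<mu> b = m}"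
  fix u assume u: "u \<in> vec.span ?D"
  then obtain x where x: "u = (\<Sum>c\<in>?D. x c *s c)" using eigenbasis_span[of ?D] by auto
  have "u \<in> V" using u eigenbasis_span_eq vec.span_mono[of ?D B] by auto
  moreover have "hform C u v = of_real m * hip u v" if "v \<in> V" for v
    unfolding x hform_sum_left hip_sum_left sum_distrib_left
    by (intro sum.cong) (use eig that in auto)
  ultimately show "u \<in> heigenspace C V m" by (auto simp: heigenspace_def)
next
  let ?D = "{b \<in> B. \<mu> b = m}"
  fix u assume u: "u \<in> heigenspace C V m"
  then have "u \<in> vec.span B" using eigenbasis_span_eq by (auto simp: heigenspace_def)
  then obtain x where x: "u = (\<Sum>c\<in>B. x c *s c)" using eigenbasis_span[of B] by auto
  have "x b = 0" if b: "b \<in> B - ?D" for b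
  proof -
    have bV: "b \<in> V" using b B by auto
    have "hform C u b = (\<Sum>c\<in>B. x c * (of_real (\<mu> c) * hip c b))"
      unfolding x hform_sum_left by (intro sum.cong) (auto simp: eig bV)
    also have "\<dots> = hip (\<Sum>c\<in>B. (x c * of_real (\<mu> c)) *s c) b"
      unfolding hip_sum_left by (simp add: mult.assoc)
    also have "\<dots> = x b * of_real (\<mu> b)" using eigenbasis_hip_sum[of b B] b by simp
    finally have "hform C u b = x b * of_real (\<mu> b)" .
    moreover have "hip u b = x b" unfolding x using eigenbasis_hip_sum[of b B x] b by simp
    ultimately have "x b * of_real (\<mu> b) = of_real m * x b" using u bV by (auto simp: heigenspace_def)
    then have "x b = 0 \<or> \<mu> b = m" by (metis mult.commute mult_cancel_left of_real_eq_iff)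
    then show ?thesis using b by auto
  qed
  then have "u = (\<Sum>c\<in>?D. x c *s c)" unfolding x by (intro sum.mono_neutral_right) (use B in auto)
  then show "u \<in> vec.span ?D" using eigenbasis_span[of ?D] by blast
qed

text \<open>Each eigenspace is spanned by the basis vectors carrying its eigenvalue, so a sum of
  dimensions over eigenvalues becomes a plain cardinality.\<close>

lemma hcount_eq: "hcount C V S = card {b \<in> B. \<mu> b \<in> S}"
proof -
  have b0: "b \<noteq> 0" if "b \<in> B" for b using on[OF that that] by (cases "b = 0") simp_all
  have ne: "heigenspace C V m \<noteq> {0} \<longleftrightarrow> m \<in> \<mu> ` B" for m
  proof
    assume "m \<in> \<mu> ` B"
    then obtain b where "b \<in> B" "\<mu> b = m" by auto
    then have "b \<in> heigenspace C V m" unfolding heigenspace_eq by (intro vec.span_base) simp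
    then show "heigenspace C V m \<noteq> {0}" using b0[OF \<open>b \<in> B\<close>] by auto
  next
    assume "heigenspace C V m \<noteq> {0}"
    then have "{b \<in> B. \<mu> b = m} \<noteq> {}" unfolding heigenspace_eq using vec.span_empty by force
    then show "m \<in> \<mu> ` B" by auto
  qed
  have "hcount C V S = (\<Sum>m\<in>S \<inter> \<mu> ` B. card {b \<in> B. \<mu> b = m})"
  proof -
    have "hcount C V S = (\<Sum>m\<in>S \<inter> \<mu> ` B. vec.dim (heigenspace C V m))"
      unfolding hcount_def ne by (rule sum.cong) auto
    also have "\<dots> = (\<Sum>m\<in>S \<inter> \<mu> ` B. card {b \<in> B. \<mu> b = m})"
      unfolding heigenspace_eq by (rule sum.cong, rule refl, rule eigenbasis_dim, blast)
    finally show ?thesis .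
  qed
  also have "\<dots> = card (\<Union>m\<in>S \<inter> \<mu> ` B. {b \<in> B. \<mu> b = m})"
    by (rule card_UN_disjoint[symmetric]) (use B(1) in \<open>simp, simp, blast\<close>)
  also have "(\<Union>m\<in>S \<inter> \<mu> ` B. {b \<in> B. \<mu> b = m}) = {b \<in> B. \<mu> b \<in> S}" by auto
  finally show ?thesis .
qed

text \<open>On the span of the eigenvectors with s \<mu> < 0 the form times \<open>s\<close> is
  negative definite, so this span meets \<open>E\<close> in 0 only and the dimensions add up inside
  \<open>V\<close>. The factor \<open>s\<close>, later 1 or -1, treats both signs at once.\<close>

lemma semidefinite_dim_bound:
  assumes E: "vec.subspace E" "E \<subseteq> V" and pos: "\<And>u. u \<in> E \<Longrightarrow> 0 \<le> s * Re (hform C u u)"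
  shows "vec.dim E \<le> card {b \<in> B. 0 \<le> s * \<mu> b}"
proof -
  let ?D = "{b \<in> B. s * \<mu> b < 0}"
  let ?N = "vec.span ?D"
  have "E \<inter> ?N \<subseteq> {0}"
  proof
    fix u assume u: "u \<in> E \<inter> ?N"
    then obtain x where x: "u = (\<Sum>c\<in>?D. x c *s c)" using eigenbasis_span[of ?D] by auto
    have uV: "u \<in> V" using u E(2) by blast
    have hb: "hip c u = cnj (x c)" if "c \<in> ?D" for c
    proof -
      have "hip u c = (if c \<in> ?D then x c else 0)"
        unfolding x by (rule eigenbasis_hip_sum) (use that in blast)+
      then have "hip u c = x c" by (simp only: that if_True)
      then show ?thesis using cnj_hip[of u c] by simp
    qed
    have "hform C u u = (\<Sum>c\<in>?D. x c * hform C c u)"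
      by (subst x) (simp add: hform_sum_left)
    also have "\<dots> = (\<Sum>c\<in>?D. x c * (of_real (\<mu> c) * cnj (x c)))"
      by (intro sum.cong) (auto simp: eig uV hb)
    also have "\<dots> = of_real (\<Sum>c\<in>?D. \<mu> c * (norm (x c))\<^sup>2)"
      unfolding of_real_sum of_real_mult complex_norm_square by (simp add: mult_ac)
    finally have "s * Re (hform C u u) = (\<Sum>c\<in>?D. s * \<mu> c * (norm (x c))\<^sup>2)"
      by (simp add: sum_distrib_left mult.assoc)
    then have "0 \<le> (\<Sum>c\<in>?D. s * \<mu> c * (norm (x c))\<^sup>2)" using pos[of u] u by simp
    moreover have "s * \<mu> c * (norm (x c))\<^sup>2 \<le> 0" if "c \<in> ?D" for c
      using that by (simp add: mult_nonpos_nonneg)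
    ultimately have "(\<Sum>c\<in>?D. - (s * \<mu> c * (norm (x c))\<^sup>2)) = 0"
      unfolding sum_negf using sum_nonpos[of ?D "\<lambda>c. s * \<mu> c * (norm (x c))\<^sup>2"] by simp
    then have all: "\<forall>c\<in>?D. - (s * \<mu> c * (norm (x c))\<^sup>2) = 0"
      using B(1) by (subst (asm) sum_nonneg_eq_0_iff) (auto simp: mult_nonpos_nonneg)
    have x0: "x c = 0" if c: "c \<in> ?D" for c
    proof -
      have "s * \<mu> c < 0" using c by blast
      then have "s * \<mu> c \<noteq> 0" by (rule less_imp_neq)
      moreover have "- (s * \<mu> c * (norm (x c))\<^sup>2) = 0" by (rule bspec[OF all c])
      ultimately show ?thesis by simp
    qed
    have "u = (\<Sum>c\<in>?D. 0 *s c)" unfolding x by (intro sum.cong) (auto simp: x0)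
    then show "u \<in> {0}" by simp
  qed
  moreover have "0 \<in> E \<inter> ?N" by (intro IntI vec.subspace_0[OF E(1)] vec.span_zero)
  ultimately have EN: "E \<inter> ?N = {0}" by blast
  have "vec.dim {x + y |x y. x \<in> E \<and> y \<in> ?N} + vec.dim (E \<inter> ?N) = vec.dim E + vec.dim ?N"
    by (rule vec.dim_sums_Int[OF E(1) vec.subspace_span])
  then have "vec.dim {x + y |x y. x \<in> E \<and> y \<in> ?N} = vec.dim E + vec.dim ?N"
    unfolding EN by (simp only: vec.dim_singleton if_True add_0_right simp_thms)
  moreover have "{x + y |x y. x \<in> E \<and> y \<in> ?N} \<subseteq> V"
  proof (rule subsetI)
    have NV: "?N \<subseteq> V" unfolding eigenbasis_span_eq[symmetric] by (rule vec.span_mono) blast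
    fix z assume "z \<in> {x + y |x y. x \<in> E \<and> y \<in> ?N}"
    then obtain x y where "z = x + y" "x \<in> E" "y \<in> ?N" by blast
    then show "z \<in> V" using E(2) NV vec.subspace_add[OF V, of x y] by blast
  qed
  then have "vec.dim {x + y |x y. x \<in> E \<and> y \<in> ?N} \<le> vec.dim V" by (rule vec.dim_subset)
  moreover have "vec.dim V = card B" using eigenbasis_dim[of B] unfolding eigenbasis_span_eq by blast
  moreover have "vec.dim ?N = card ?D" by (rule eigenbasis_dim) blast
  moreover have "card B = card ?D + card {b \<in> B. 0 \<le> s * \<mu> b}"
  proof -
    have "card B = card (?D \<union> {b \<in> B. 0 \<le> s * \<mu> b})" by (rule arg_cong[where f = card]) auto
    also have "\<dots> = card ?D + card {b \<in> B. 0 \<le> s * \<mu> b}" using B(1) by (intro card_Un_disjoint) auto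
    finally show ?thesis .
  qed
  ultimately show ?thesis by linarith
qed

end

theorem hermitian_signature_bounds:
  fixes C :: "'n::finite \<Rightarrow> 'n \<Rightarrow> complex"
  assumes C: "\<And>j k. C k j = cnj (C j k)" and V: "vec.subspace V"
  shows "hcount C V {0<..} + hcount C V {..<0} + hcount C V {0} = vec.dim V"
    and "\<And>E. vec.subspace E \<Longrightarrow> E \<subseteq> V \<Longrightarrow> (\<And>u. u \<in> E \<Longrightarrow> 0 \<le> Re (hform C u u)) \<Longrightarrow>
      vec.dim E \<le> hcount C V {0<..} + hcount C V {0}"
    and "\<And>E. vec.subspace E \<Longrightarrow> E \<subseteq> V \<Longrightarrow> (\<And>u. u \<in> E \<Longrightarrow> Re (hform C u u) \<le> 0) \<Longrightarrow>
      vec.dim E \<le> hcount C V {..<0} + hcount C V {0}"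
proof -
  obtain B \<mu> where "finite B \<and> B \<subseteq> V \<and> V \<subseteq> vec.span B \<and> (\<forall>b\<in>B. \<forall>c\<in>B. hip b c = (if b = c then 1 else 0)) \<and>
    (\<forall>b\<in>B. \<forall>v\<in>V. hform C b v = complex_of_real (\<mu> b) * hip b v)"
    using hermitian_eigenbasis[of C V, OF C V] by (elim exE)
  then have B: "finite B" "B \<subseteq> V" "V \<subseteq> vec.span B"
    "\<And>b c. b \<in> B \<Longrightarrow> c \<in> B \<Longrightarrow> hip b c = (if b = c then 1 else 0)"
    "\<And>b v. b \<in> B \<Longrightarrow> v \<in> V \<Longrightarrow> hform C b v = complex_of_real (\<mu> b) * hip b v" by simp_all
  note ctx = V B
  have cnt: "hcount C V S = card {b \<in> B. \<mu> b \<in> S}" for S by (rule hcount_eq[OF ctx])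
  have un: "card {b \<in> B. \<mu> b \<in> S} + card {b \<in> B. \<mu> b \<in> T} = card {b \<in> B. \<mu> b \<in> S \<union> T}" if "S \<inter> T = {}" for S T
  proof -
    have "{b \<in> B. \<mu> b \<in> S \<union> T} = {b \<in> B. \<mu> b \<in> S} \<union> {b \<in> B. \<mu> b \<in> T}" by blast
    moreover have "{b \<in> B. \<mu> b \<in> S} \<inter> {b \<in> B. \<mu> b \<in> T} = {}" using that by blast
    ultimately show ?thesis using B(1) by (simp add: card_Un_disjoint)
  qed
  have dimV: "vec.dim V = card B" by (rule eigenbasis_dim_V[OF ctx])
  have "{0<..} \<inter> {..<0::real} = {}" "({0<..} \<union> {..<0}) \<inter> {0::real} = {}" by auto
  note un2 = un[OF this(1)] un[OF this(2)]
  have "hcount C V {0<..} + hcount C V {..<0} + hcount C V {0} = card {b \<in> B. \<mu> b \<in> {0<..} \<union> {..<0} \<union> {0}}"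
    unfolding cnt un2 ..
  also have "{b \<in> B. \<mu> b \<in> {0<..} \<union> {..<0} \<union> {0}} = B" by auto
  finally show "hcount C V {0<..} + hcount C V {..<0} + hcount C V {0} = vec.dim V" using dimV by simp
  fix E assume E: "vec.subspace E" "E \<subseteq> V"
  show "vec.dim E \<le> hcount C V {0<..} + hcount C V {0}" if "\<And>u. u \<in> E \<Longrightarrow> 0 \<le> Re (hform C u u)"
  proof -
    have "vec.dim E \<le> card {b \<in> B. 0 \<le> 1 * \<mu> b}"
      by (rule semidefinite_dim_bound[OF ctx E]) (simp_all add: that)
    also have "{b \<in> B. 0 \<le> 1 * \<mu> b} = {b \<in> B. \<mu> b \<in> {0<..} \<union> {0}}" by auto
    also have "card \<dots> = hcount C V {0<..} + hcount C V {0}" unfolding cnt by (rule un[symmetric]) auto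
    finally show ?thesis .
  qed
  show "vec.dim E \<le> hcount C V {..<0} + hcount C V {0}" if "\<And>u. u \<in> E \<Longrightarrow> Re (hform C u u) \<le> 0"
  proof -
    have "vec.dim E \<le> card {b \<in> B. 0 \<le> - 1 * \<mu> b}"
      by (rule semidefinite_dim_bound[OF ctx E]) (simp_all add: that)
    also have "{b \<in> B. 0 \<le> - 1 * \<mu> b} = {b \<in> B. \<mu> b \<in> {..<0} \<union> {0}}" by auto
    also have "card \<dots> = hcount C V {..<0} + hcount C V {0}" unfolding cnt by (rule un[symmetric]) auto
    finally show ?thesis .
  qed
qed

section \<open>Defining functions and transversality\<close>

lemma local_defining_functionD:
  assumes "local_defining_function M p W \<rho>"
  shows "open W" "p \<in> W" "real_analytic_on \<rho> W"
    and "\<And>z. z \<in> W \<Longrightarrow> (\<rho> has_derivative frechet_derivative \<rho> (at z)) (at z)"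
    and "\<And>z. z \<in> W \<Longrightarrow> frechet_derivative \<rho> (at z) \<noteq> (\<lambda>v. 0)"
    and "\<And>z. z \<in> W \<Longrightarrow> z \<in> M \<longleftrightarrow> \<rho> z = 0"
    and "continuous_on W \<rho>"
proof -
  show W: "open W" "p \<in> W" "real_analytic_on \<rho> W" using assms by (auto simp: local_defining_function_def)
  show d: "(\<rho> has_derivative frechet_derivative \<rho> (at z)) (at z)" if "z \<in> W" for z
    using W(3) that unfolding real_analytic_on_def
    by (auto intro!: frechet_derivative_works[THEN iffD1] real_analytic_imp_differentiable)
  show "frechet_derivative \<rho> (at z) \<noteq> (\<lambda>v. 0)" if "z \<in> W" for z
    using assms that by (auto simp: local_defining_function_def)
  show "z \<in> M \<longleftrightarrow> \<rho> z = 0" if "z \<in> W" for z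
    using assms that by (auto simp: local_defining_function_def)
  show "continuous_on W \<rho>"
    by (intro continuous_at_imp_continuous_on ballI has_derivative_continuous) (erule d)
qed

lemma local_defining_function_subset:
  assumes "local_defining_function M p W \<rho>" "open O1" "O1 \<subseteq> W" "q \<in> O1"
  shows "local_defining_function M q O1 \<rho>"
  using assms unfolding local_defining_function_def real_analytic_on_def by blast

text \<open>Two defining functions have the same zeros near \<open>z\<close>, and the second
  vanishes to first order in directions tangential to the zeros of the first. By symmetry the
  tangent space does not depend on the choice made in \<open>defining_function_at\<close>.\<close>

lemma defining_derivative_kernel:
  assumes l: "local_defining_function M p1 W1 \<rho>1" "local_defining_function M p2 W2 \<rho>2"
    and z: "z \<in> M" "z \<in> W1" "z \<in> W2" and v: "frechet_derivative \<rho>1 (at z) v = 0"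
  shows "frechet_derivative \<rho>2 (at z) v = 0"
proof -
  note l1 = local_defining_functionD[OF l(1)] and l2 = local_defining_functionD[OF l(2)]
  have "open (W1 \<inter> W2)" "z \<in> W1 \<inter> W2" using l1 l2 z by auto
  then obtain d where d: "0 < d" "ball z d \<subseteq> W1 \<inter> W2" using open_contains_ball by blast
  show ?thesis
  proof (rule derivative_vanishes_tangential[OF l1(4)[OF z(2)] _ d(1) _ l1(5)[OF z(2)] l2(4)[OF z(3)] _ v])
    show "\<rho>1 z = 0" using l1(6) z by blast
    show "continuous_on (ball z d) \<rho>1" using l1(7) d(2) continuous_on_subset by blast
    show "\<rho>2 y = 0" if "y \<in> ball z d" "\<rho>1 y = 0" for y using that d(2) l1(6) l2(6) by blast
  qed
qed

lemma defining_function_at_works: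
  assumes "real_analytic_hypersurface M" "p \<in> M"
  obtains W where "local_defining_function M p W (defining_function_at M p)"
  using assms someI_ex[of "\<lambda>\<rho>. \<exists>W. local_defining_function M p W \<rho>"]
  unfolding real_analytic_hypersurface_def defining_function_at_def by blast

lemma real_tangent_space_eq:
  assumes "real_analytic_hypersurface M" "local_defining_function M p W \<rho>" "z \<in> M" "z \<in> W"
  shows "real_tangent_space M z = {v. frechet_derivative \<rho> (at z) v = 0}"
proof -
  obtain W' where W': "local_defining_function M z W' (defining_function_at M z)"
    using defining_function_at_works[OF assms(1,3)] .
  have "z \<in> W'" using local_defining_functionD(2)[OF W'] .
  then show ?thesis unfolding real_tangent_space_def
    using defining_derivative_kernel[OF W' assms(2) assms(3) _ assms(4)]
      defining_derivative_kernel[OF assms(2) W' assms(3,4)] by blast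
qed

text \<open>The tangent space is the kernel of a nonzero real functional and has real codimension
  one, so a single vector of the image of \<open>J\<close> outside it already spans the
  rest.\<close>

lemma transversal_at_iff:
  assumes "real_analytic_hypersurface M'" and l: "local_defining_function M' p W \<rho>" and z: "H z \<in> M'" "H z \<in> W"
    and J: "(H has_derivative J) (at z)"
  shows "transversal_at H M' z \<longleftrightarrow> (\<exists>v. frechet_derivative \<rho> (at (H z)) (J v) \<noteq> 0)"
proof -
  let ?D = "frechet_derivative \<rho> (at (H z))"
  note l' = local_defining_functionD[OF l]
  have lin: "linear ?D" using l'(4)[OF z(2)] by (rule has_derivative_linear)
  have linJ: "linear J" using J by (rule has_derivative_linear)
  have JH: "frechet_derivative H (at z) = J" using frechet_derivative_at[OF J] by simp
  have T: "t \<in> real_tangent_space M' (H z) \<longleftrightarrow> ?D t = 0" for t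
    using real_tangent_space_eq[OF assms(1) l z] by simp
  obtain x where x: "?D x = 1" using linear_functional_normalize[OF lin l'(5)[OF z(2)]] .
  show ?thesis
  proof
    assume "transversal_at H M' z"
    then have "x \<in> {t + J v | t v. t \<in> real_tangent_space M' (H z)}" unfolding transversal_at_def JH by simp
    then obtain t v where "x = t + J v" "?D t = 0" using T by auto
    then have "?D (J v) = 1" using x lin by (simp add: linear_add)
    then show "\<exists>v. ?D (J v) \<noteq> 0" by (intro exI[of _ v]) simp
  next
    assume "\<exists>v. ?D (J v) \<noteq> 0"
    then obtain v where v: "?D (J v) \<noteq> 0" by blast
    have "y \<in> {t + J v | t v. t \<in> real_tangent_space M' (H z)}" for y
    proof -
      let ?w = "(?D y / ?D (J v)) *\<^sub>R v"
      have "?D (y - J ?w) = 0" using lin linJ v by (simp add: linear_diff linear_cmul)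
      then have "y - J ?w \<in> real_tangent_space M' (H z)" using T by blast
      moreover have "y = (y - J ?w) + J ?w" by simp
      ultimately show ?thesis by blast
    qed
    then show "transversal_at H M' z" unfolding transversal_at_def JH by blast
  qed
qed

section \<open>Jacobian matrices and nontransversal points\<close>

definition jac :: "(complex ^ 'm \<Rightarrow> complex ^ 'k) \<Rightarrow> complex ^ 'm \<Rightarrow> complex ^ 'm ^ 'k" where
  "jac H z = (\<chi> a j. frechet_derivative (\<lambda>z. H z $ a) (at z) (axis j 1))"

lemma has_derivative_jac:
  assumes "holomorphic_map_on H U" "z \<in> U"
  shows "(H has_derivative (\<lambda>v. jac H z *v v)) (at z)"
proof -
  obtain A where A: "(H has_derivative (\<lambda>v. A *v v)) (at z)"
    using assms by (auto simp: holomorphic_map_on_def)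
  have "frechet_derivative (\<lambda>z. H z $ a) (at z) = (\<lambda>v. (A *v v) $ a)" for a
    using frechet_derivative_at[OF bounded_linear.has_derivative[OF bounded_linear_vec_nth A]] by simp
  then have "jac H z = A"
    by (simp add: jac_def vec_eq_iff matrix_vector_mult_def axis_def if_distrib cong: if_cong)
  with A show ?thesis by simp
qed

lemma cdiff_at_jac:
  assumes "holomorphic_map_on H U" "open U" "z \<in> U"
  shows "cdiff_at (\<lambda>z. jac H z $ a $ j) z"
  unfolding jac_def using cdiff_at_frechet[OF assms(2,3) holomorphic_map_component[OF assms(1)]] by simp

lemma linear_eq_0_Basis:
  fixes D :: "'a::euclidean_space \<Rightarrow> real"
  assumes "linear D" shows "(\<forall>b\<in>Basis. D b = 0) \<longleftrightarrow> (\<forall>v. D v = 0)"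
proof
  assume b: "\<forall>b\<in>Basis. D b = 0"
  show "\<forall>v. D v = 0"
  proof
    fix v
    have "D v = D (\<Sum>b\<in>Basis. (v \<bullet> b) *\<^sub>R b)" by (simp add: euclidean_representation)
    also have "\<dots> = 0" using assms b by (simp add: linear_sum linear_cmul)
    finally show "D v = 0" .
  qed
qed simp

lemma frechet_compose_holomorphic:
  assumes l: "local_defining_function M' p W \<rho>" and H: "holomorphic_map_on H U" "z \<in> U" "H z \<in> W"
  shows "((\<lambda>z. \<rho> (H z)) has_derivative (\<lambda>v. frechet_derivative \<rho> (at (H z)) (jac H z *v v))) (at z)"
  using diff_chain_at[OF has_derivative_jac[OF H(1,2)] local_defining_functionD(4)[OF l H(3)]]
  by (simp add: o_def)

lemma holomorphic_map_continuous: "holomorphic_map_on H U \<Longrightarrow> continuous_on U H"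
  unfolding holomorphic_map_on_def
  by (intro continuous_at_imp_continuous_on ballI) (blast intro: has_derivative_continuous)

text \<open>The local equations are the partial derivatives of \<rho> composed with \<open>H\<close>
  along the real basis: finitely many, and analytic because derivatives and holomorphic pullbacks of
  analytic functions are.\<close>

lemma nontransversal_real_analytic_subset:
  fixes M U :: "(complex ^ 'm) set" and M' :: "(complex ^ 'k) set"
  assumes M': "real_analytic_hypersurface M'" and U: "open U" "M \<subseteq> U"
    and H: "holomorphic_map_on H U" "H ` M \<subseteq> M'"
  shows "real_analytic_subset M {z \<in> M. \<not> transversal_at H M' z}"
  unfolding real_analytic_subset_def
proof (intro conjI ballI)
  fix p assume p: "p \<in> M"
  then have Hp: "H p \<in> M'" using H by auto
  then obtain W' \<rho> where l: "local_defining_function M' (H p) W' \<rho>"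
    using M' unfolding real_analytic_hypersurface_def by blast
  note l' = local_defining_functionD[OF l]
  define W where "W = U \<inter> H -` W'"
  have W: "open W" unfolding W_def
    by (rule continuous_open_preimage[OF holomorphic_map_continuous[OF H(1)] U(1) l'(1)])
  have pW: "p \<in> W" using p U l'(2) by (auto simp: W_def)
  let ?g = "\<lambda>z. \<rho> (H z)"
  let ?F = "(\<lambda>b x. frechet_derivative ?g (at x) b) ` Basis"
  have g: "real_analytic_on ?g W"
    unfolding real_analytic_on_def
  proof
    fix z assume "z \<in> W"
    then have z: "z \<in> U" "H z \<in> W'" by (auto simp: W_def)
    have "real_analytic_at \<rho> (H z)" using l'(3) z(2) unfolding real_analytic_on_def by blast
    then show "real_analytic_at ?g z" by (rule real_analytic_at_compose_holomorphic[OF H(1) U(1) z(1)])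
  qed
  have dg: "frechet_derivative ?g (at z) = (\<lambda>v. frechet_derivative \<rho> (at (H z)) (jac H z *v v))" if "z \<in> W" for z
    using frechet_derivative_at[OF frechet_compose_holomorphic[OF l H(1), of z]] that by (simp add: W_def)
  have lin: "linear (frechet_derivative ?g (at z))" if "z \<in> W" for z
    by (rule linear_frechet_derivative, rule real_analytic_imp_differentiable)
      (use g that in \<open>unfold real_analytic_on_def, blast\<close>)
  have tr: "transversal_at H M' z \<longleftrightarrow> (\<exists>v. frechet_derivative ?g (at z) v \<noteq> 0)" if "z \<in> M" "z \<in> W" for z
  proof -
    have "H z \<in> M'" "H z \<in> W'" "z \<in> U" using that H(2) by (auto simp: W_def)
    then show ?thesis unfolding dg[OF that(2)] by (intro transversal_at_iff[OF M' l] has_derivative_jac[OF H(1)])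
  qed
  show "\<exists>W F. open W \<and> p \<in> W \<and> finite F \<and> (\<forall>f\<in>F. real_analytic_on f W) \<and>
      {z \<in> M. \<not> transversal_at H M' z} \<inter> W = {z \<in> M \<inter> W. \<forall>f\<in>F. f z = 0}"
  proof (intro exI[of _ W] exI[of _ ?F] conjI W pW)
    show "\<forall>f\<in>?F. real_analytic_on f W" using real_analytic_on_frechet[OF W g] by blast
    have "(\<forall>f\<in>?F. f z = 0) \<longleftrightarrow> \<not> transversal_at H M' z" if "z \<in> M" "z \<in> W" for z
      unfolding tr[OF that] ball_simps(9) linear_eq_0_Basis[OF lin[OF that(2)]] by blast
    then show "{z \<in> M. \<not> transversal_at H M' z} \<inter> W = {z \<in> M \<inter> W. \<forall>f\<in>?F. f z = 0}"
      by (intro set_eqI) (simp only: mem_Collect_eq Int_iff, metis)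
  qed simp
qed blast

text \<open>This is the mutual exclusion of the two alternatives: \<rho> composed with
  \<open>H\<close> is identically zero near \<open>p\<close>, hence so is its derivative at
  \<open>p\<close>.\<close>

lemma not_transversal_of_mapped_neighborhood:
  assumes M': "real_analytic_hypersurface M'" and H: "holomorphic_map_on H U" "p \<in> U"
    and V: "open V" "p \<in> V" "H ` V \<subseteq> M'"
  shows "\<not> transversal_at H M' p"
proof -
  have Hp: "H p \<in> M'" using V by auto
  then obtain W' \<rho> where l: "local_defining_function M' (H p) W' \<rho>"
    using M' unfolding real_analytic_hypersurface_def by blast
  note l' = local_defining_functionD[OF l]
  let ?D = "\<lambda>v. frechet_derivative \<rho> (at (H p)) (jac H p *v v)"
  have d: "((\<lambda>z. \<rho> (H z)) has_derivative ?D) (at p)"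
    by (rule frechet_compose_holomorphic[OF l H l'(2)])
  have "\<forall>\<^sub>F z in nhds p. H z \<in> W'"
    using eventually_compose_filterlim[OF eventually_nhds_in_open[OF l'(1,2)]
        isCont_tendsto_nhds[OF has_derivative_continuous[OF has_derivative_jac[OF H]]]] .
  moreover have "\<forall>\<^sub>F z in nhds p. z \<in> V" using V by (intro eventually_nhds_in_open)
  ultimately have "\<forall>\<^sub>F z in nhds p. \<rho> (H z) = 0"
    by eventually_elim (use l'(6) V(3) in auto)
  then have "\<forall>\<^sub>F z in at p. \<rho> (H z) = 0" "\<rho> (H p) = 0"
    by (auto simp: eventually_nhds_conv_at)
  then have "((\<lambda>z. 0) has_derivative ?D) (at p)"
    using has_derivative_transform_eventually[OF d, of "\<lambda>_. 0"] by simp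
  then have "?D = (\<lambda>v. 0)" using has_derivative_unique has_derivative_const by blast
  then show ?thesis
    using transversal_at_iff[OF M' l Hp l'(2) has_derivative_jac[OF H]] by metis
qed

section \<open>The Levi form of the target\<close>

text \<open>\<open>clin\<close> and \<open>canti\<close> are the complex-linear and antilinear parts
  of a real-linear functional, so that dS = \<partial>S + \<partial>-bar S. In this coordinate-free
  form a complex Jacobian passes through both, since it commutes with multiplication by
  \<i>.\<close>

definition clin :: "(complex ^ 'n \<Rightarrow> complex) \<Rightarrow> complex ^ 'n \<Rightarrow> complex" where
  "clin S v = (S v - \<i> * S (\<i> *s v)) / 2"

definition canti :: "(complex ^ 'n \<Rightarrow> complex) \<Rightarrow> complex ^ 'n \<Rightarrow> complex" where
  "canti S v = (S v + \<i> * S (\<i> *s v)) / 2"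

lemma canti_sum: "canti (\<lambda>v. \<Sum>a\<in>A. S a v) v = (\<Sum>a\<in>A. canti (S a) v)"
  by (simp add: canti_def sum_distrib_left sum.distrib sum_divide_distrib[symmetric])

lemma canti_add: "canti (\<lambda>v. S v + R v) v = canti S v + canti R v"
  by (simp add: canti_def algebra_simps add_divide_distrib)

lemma canti_cmult: "canti (\<lambda>v. c * S v) v = c * canti S v"
  by (simp add: canti_def algebra_simps add_divide_distrib)

lemma real_linear_expansion:
  fixes S :: "complex ^ 'n \<Rightarrow> complex"
  assumes "linear S"
  shows "S v = (\<Sum>j\<in>UNIV. of_real (Re (v $ j)) * S (axis j 1) + of_real (Im (v $ j)) * S (axis j \<i>))"
proof -
  have "v = (\<Sum>j\<in>UNIV. Re (v $ j) *\<^sub>R axis j 1 + Im (v $ j) *\<^sub>R axis j \<i>)"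
  proof (rule vec_eq_iff[THEN iffD2], intro allI)
    fix i
    have "(\<Sum>j\<in>UNIV. Re (v $ j) *\<^sub>R axis j 1 + Im (v $ j) *\<^sub>R axis j \<i>) $ i =
      (\<Sum>j\<in>UNIV. if j = i then of_real (Re (v $ j)) + of_real (Im (v $ j)) * \<i> else 0)"
      unfolding sum_component by (intro sum.cong) (auto simp: axis_def scaleR_conv_of_real[where 'a = complex])
    also have "\<dots> = v $ i" by (simp add: complex_eq_iff)
    finally show "v $ i = (\<Sum>j\<in>UNIV. Re (v $ j) *\<^sub>R axis j 1 + Im (v $ j) *\<^sub>R axis j \<i>) $ i" by simp
  qed
  then have "S v = S (\<Sum>j\<in>UNIV. Re (v $ j) *\<^sub>R axis j 1 + Im (v $ j) *\<^sub>R axis j \<i>)" by (rule arg_cong)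
  also have "\<dots> = (\<Sum>j\<in>UNIV. Re (v $ j) *\<^sub>R S (axis j 1) + Im (v $ j) *\<^sub>R S (axis j \<i>))"
    using assms by (simp add: linear_sum linear_add linear_cmul)
  finally show ?thesis by (simp add: scaleR_conv_of_real[where 'a = complex])
qed

lemma clin_expansion:
  fixes S :: "complex ^ 'n \<Rightarrow> complex"
  assumes "linear S"
  shows "clin S v = (\<Sum>j\<in>UNIV. (S (axis j 1) - \<i> * S (axis j \<i>)) / 2 * v $ j)"
  unfolding clin_def real_linear_expansion[OF assms, of v] real_linear_expansion[OF assms, of "\<i> *s v"]
  by (simp add: sum_distrib_left sum_subtractf[symmetric] sum_divide_distrib)
    (intro sum.cong refl, simp add: complex_eq_iff field_simps)

lemma canti_expansion:
  fixes S :: "complex ^ 'n \<Rightarrow> complex"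
  assumes "linear S"
  shows "canti S v = (\<Sum>j\<in>UNIV. (S (axis j 1) + \<i> * S (axis j \<i>)) / 2 * cnj (v $ j))"
  unfolding canti_def real_linear_expansion[OF assms, of v] real_linear_expansion[OF assms, of "\<i> *s v"]
  by (simp add: sum_distrib_left sum.distrib[symmetric] sum_divide_distrib)
    (intro sum.cong refl, simp add: complex_eq_iff field_simps)

section \<open>Wirtinger derivatives and the Levi matrix\<close>

lemma axis_in_Basis [simp]: "axis j (1::complex) \<in> Basis" "axis j \<i> \<in> Basis"
  by (auto simp: axis_in_Basis_iff Basis_complex_def)

lemma frechet_of_real:
  assumes "f differentiable (at z)"
  shows "frechet_derivative (\<lambda>z. complex_of_real (f z)) (at z) = (\<lambda>v. of_real (frechet_derivative f (at z) v))"
  by (rule frechet_derivative_at[OF has_derivative_of_real[OF frechet_derivative_works[THEN iffD1, OF assms]], symmetric])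

lemma wirtinger_of_real:
  assumes "f differentiable (at z)"
  shows "wirtinger j (\<lambda>z. complex_of_real (f z)) z =
    (of_real (frechet_derivative f (at z) (axis j 1)) - \<i> * of_real (frechet_derivative f (at z) (axis j \<i>))) / 2"
  unfolding wirtinger_def frechet_of_real[OF assms] ..

lemma wirtinger_sum_eq:
  assumes "f differentiable (at z)"
  shows "(\<Sum>j\<in>UNIV. wirtinger j (\<lambda>z. complex_of_real (f z)) z * v $ j) = clin (\<lambda>v. of_real (frechet_derivative f (at z) v)) v"
proof -
  have "linear (\<lambda>v. complex_of_real (frechet_derivative f (at z) v))"
    using linear_frechet_derivative[OF assms]
    by (intro linearI) (auto simp: linear_add linear_cmul scaleR_conv_of_real[where 'a = complex])
  then show ?thesis unfolding wirtinger_of_real[OF assms] by (simp add: clin_expansion)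
qed

lemma levi_space_eq:
  assumes "\<rho> differentiable (at p)"
  shows "levi_space \<rho> p = {u. clin (\<lambda>v. of_real (frechet_derivative \<rho> (at p) v)) u = 0}"
  unfolding levi_space_def wirtinger_sum_eq[OF assms] ..

lemma levi_space_subspace: "vec.subspace (levi_space \<rho> p)"
  unfolding levi_space_def vec.subspace_def
  by (auto simp: algebra_simps sum.distrib sum_distrib_left[symmetric])

definition levi_matrix :: "(complex ^ 'm \<Rightarrow> real) \<Rightarrow> complex ^ 'm \<Rightarrow> 'm \<Rightarrow> 'm \<Rightarrow> complex" where
  "levi_matrix \<rho> p j k = wirtinger_bar k (wirtinger j (\<lambda>z. complex_of_real (\<rho> z))) p"

lemma levi_form_eq_hform: "levi_form \<rho> p = hform (levi_matrix \<rho> p)"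
  by (simp add: levi_form_def hform_def levi_matrix_def fun_eq_iff)

lemma num_levi_eigenvalues_eq: "num_levi_eigenvalues \<rho> p S = hcount (levi_matrix \<rho> p) (levi_space \<rho> p) S"
proof -
  have "levi_eigenspace \<rho> p = heigenspace (levi_matrix \<rho> p) (levi_space \<rho> p)"
    by (simp add: levi_eigenspace_def heigenspace_def levi_form_eq_hform hip_def fun_eq_iff)
  then show ?thesis by (simp add: num_levi_eigenvalues_def hcount_def)
qed

lemma wirtinger_has_derivative:
  assumes W: "open W" "real_analytic_on \<rho> W" "p \<in> W"
  shows "(wirtinger j (\<lambda>z. complex_of_real (\<rho> z)) has_derivative
    (\<lambda>v. (of_real (frechet_derivative (\<lambda>z. frechet_derivative \<rho> (at z) (axis j 1)) (at p) v) -
          \<i> * of_real (frechet_derivative (\<lambda>z. frechet_derivative \<rho> (at z) (axis j \<i>)) (at p) v)) / 2)) (at p)"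
proof -
  have d: "((\<lambda>z. frechet_derivative \<rho> (at z) b) has_derivative
      frechet_derivative (\<lambda>z. frechet_derivative \<rho> (at z) b) (at p)) (at p)" if "b \<in> Basis" for b
    using real_analytic_on_frechet[OF W(1,2) that] W(3) unfolding real_analytic_on_def
    by (auto intro!: frechet_derivative_works[THEN iffD1] real_analytic_imp_differentiable)
  have "((\<lambda>z. (of_real (frechet_derivative \<rho> (at z) (axis j 1)) - \<i> * of_real (frechet_derivative \<rho> (at z) (axis j \<i>))) / 2)
      has_derivative (\<lambda>v. (of_real (frechet_derivative (\<lambda>z. frechet_derivative \<rho> (at z) (axis j 1)) (at p) v) -
          \<i> * of_real (frechet_derivative (\<lambda>z. frechet_derivative \<rho> (at z) (axis j \<i>)) (at p) v)) / 2)) (at p)"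
    unfolding divide_inverse
    by (intro has_derivative_mult_left has_derivative_diff has_derivative_mult_right has_derivative_of_real d axis_in_Basis)
  moreover have "(of_real (frechet_derivative \<rho> (at z) (axis j 1)) - \<i> * of_real (frechet_derivative \<rho> (at z) (axis j \<i>))) / 2
      = wirtinger j (\<lambda>z. complex_of_real (\<rho> z)) z" if "z \<in> W" for z
    using W(2) that unfolding real_analytic_on_def
    by (intro wirtinger_of_real[symmetric] real_analytic_imp_differentiable) blast
  ultimately show ?thesis by (rule has_derivative_transform_within_open[OF _ W(1,3)])
qed

lemma levi_matrix_eq:
  assumes W: "open W" "real_analytic_on \<rho> W" "p \<in> W"
    and T: "\<And>j. (wirtinger j (\<lambda>z. complex_of_real (\<rho> z)) has_derivative T j) (at p)"
  shows "levi_matrix \<rho> p j k = (T j (axis k 1) + \<i> * T j (axis k \<i>)) / 2"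
  unfolding levi_matrix_def wirtinger_bar_def frechet_derivative_at[OF T, symmetric] ..

text \<open>Written in real second derivatives, conjugation exchanges the two orders of
  differentiation, so this is the symmetry of the real Hessian.\<close>

lemma levi_matrix_hermitian:
  assumes W: "open W" "real_analytic_on \<rho> W" "p \<in> W"
  shows "levi_matrix \<rho> p k j = cnj (levi_matrix \<rho> p j k)"
proof -
  have s: "frechet_derivative (\<lambda>z. frechet_derivative \<rho> (at z) b) (at p) c =
    frechet_derivative (\<lambda>z. frechet_derivative \<rho> (at z) c) (at p) b" if "b \<in> Basis" "c \<in> Basis" for b c
    using real_analytic_frechet_commute[OF W that(2,1)] .
  show ?thesis
    unfolding levi_matrix_eq[OF W wirtinger_has_derivative[OF W]]
    by (simp add: s[of "axis k 1"] s[of "axis k \<i>"] complex_eq_iff)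
qed

lemma matrix_mult_smult: "A *v (c *s v) = c *s (A *v (v :: complex ^ 'n))"
  by (simp add: vec_eq_iff matrix_vector_mult_def sum_distrib_left algebra_simps)

text \<open>In a product rule this removes the derivative of the holomorphic factor
  \<open>jac H\<close> as soon as only the antilinear part is kept.\<close>

lemma canti_zero_of_complex_linear:
  fixes c :: "'n::finite \<Rightarrow> complex"
  shows "canti (\<lambda>v. \<Sum>j\<in>UNIV. c j * v $ j) v = 0"
proof -
  have "(\<Sum>j\<in>UNIV. c j * (\<i> *s v) $ j) = \<i> * (\<Sum>j\<in>UNIV. c j * v $ j)"
    by (simp add: sum_distrib_left algebra_simps)
  then show ?thesis by (simp add: canti_def mult.assoc[symmetric])
qed

lemma dim_kernel_functional:
  fixes \<theta> :: "complex ^ 'n \<Rightarrow> complex"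
  assumes lin: "\<And>u v. \<theta> (u + v) = \<theta> u + \<theta> v" "\<And>c u. \<theta> (c *s u) = c * \<theta> u" and ne: "\<theta> x \<noteq> 0"
  shows "vec.dim {u. \<theta> u = 0} + 1 = CARD('n)"
proof -
  let ?K = "{u. \<theta> u = 0}"
  have \<theta>0: "\<theta> 0 = 0" using lin(2)[of 0 0] by simp
  have K: "vec.subspace ?K" unfolding vec.subspace_def using lin \<theta>0 by auto
  have xK: "x \<notin> vec.span ?K" unfolding vec.span_eq_iff[THEN iffD2, OF K] using ne by simp
  have "u \<in> vec.span (insert x ?K)" for u
  proof -
    let ?c = "\<theta> u / \<theta> x"
    have "u - ?c *s x = u + (- ?c) *s x" by simp
    then have "\<theta> (u - ?c *s x) = \<theta> u + (- ?c) * \<theta> x" by (simp only: lin)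
    then have "u - ?c *s x \<in> ?K" using ne by simp
    then show ?thesis unfolding vec.span_insert by (intro CollectI[of _ u] exI[of _ ?c]) (rule vec.span_base)
  qed
  then have "vec.span (insert x ?K) = UNIV" by blast
  then have "vec.dim (insert x ?K) = vec.dim (UNIV :: (complex ^ 'n) set)" using vec.dim_span by metis
  then have "vec.dim (insert x ?K) = CARD('n)" unfolding vec_dim_card .
  then show ?thesis using xK by (simp add: vec.dim_insert)
qed


lemma nontransversal_derivative:
  assumes M': "real_analytic_hypersurface M'" and l: "local_defining_function M' p' W' \<rho>'"
    and H: "holomorphic_map_on H U" "z \<in> U" "H z \<in> M'" "H z \<in> W'" and nt: "\<not> transversal_at H M' z"
  shows "frechet_derivative \<rho>' (at (H z)) (jac H z *v v) = 0"
  using nt unfolding transversal_at_iff[OF M' l H(3,4) has_derivative_jac[OF H(1,2)]] by simp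

text \<open>The composite \<open>\<rho>' \<circ> H\<close> vanishes to second order along \<open>M\<close>, so its complex Hessian
  \<open>\<L>'(Ju, Jv)\<close> vanishes whenever \<open>v\<close> is in the complex tangent space \<open>{\<theta> = 0}\<close> of \<open>M\<close>.\<close>

lemma levi_form_pullback:
  fixes M U :: "(complex ^ 'm) set" and M' :: "(complex ^ 'k) set"
  assumes M': "real_analytic_hypersurface M'" and U: "open U" "M \<subseteq> U"
    and H: "holomorphic_map_on H U" "H ` M \<subseteq> M'"
    and l: "local_defining_function M p W \<rho>" and p: "p \<in> M"
    and l': "local_defining_function M' (H p) W' \<rho>'"
    and nt: "\<And>z. z \<in> M \<Longrightarrow> \<not> transversal_at H M' z"
  shows "\<exists>c. \<forall>u v. hform (levi_matrix \<rho>' (H p)) (jac H p *v u) (jac H p *v v) =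
    (\<Sum>j\<in>UNIV. u $ j * c j) * cnj (clin (\<lambda>v. of_real (frechet_derivative \<rho> (at p) v)) v)"
proof -
  note L = local_defining_functionD[OF l] and L' = local_defining_functionD[OF l']
  let ?D = "frechet_derivative \<rho> (at p)"
  let ?J = "jac H p"
  have pU: "p \<in> U" using p U by blast
  have linD: "linear ?D" using L(4)[OF L(2)] by (rule has_derivative_linear)
  obtain N where N: "?D N = 1" using linear_functional_normalize[OF linD L(5)[OF L(2)]] .
  define f where "f a = wirtinger a (\<lambda>z. complex_of_real (\<rho>' z))" for a
  define T where "T a v = (of_real (frechet_derivative (\<lambda>z. frechet_derivative \<rho>' (at z) (axis a 1)) (at (H p)) v) -
      \<i> * of_real (frechet_derivative (\<lambda>z. frechet_derivative \<rho>' (at z) (axis a \<i>)) (at (H p)) v)) / 2" for a v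
  have T: "(f a has_derivative T a) (at (H p))" for a
    unfolding f_def T_def[abs_def] by (rule wirtinger_has_derivative[OF L'(1,3,2)])
  have linT: "linear (T a)" for a using T by (rule has_derivative_linear)
  define K where "K a j = (SOME c. ((\<lambda>z. jac H z $ a $ j) has_derivative (\<lambda>v. \<Sum>i\<in>UNIV. c i * v $ i)) (at p))" for a j
  have K: "((\<lambda>z. jac H z $ a $ j) has_derivative (\<lambda>v. \<Sum>i\<in>UNIV. K a j i * v $ i)) (at p)" for a j
    unfolding K_def by (rule someI_ex[OF cdiff_at_jac[OF H(1) U(1) pU, unfolded cdiff_at_def]])
  define W1 where "W1 = W \<inter> (U \<inter> H -` W')"
  have W1: "open W1" unfolding W1_def
    by (intro open_Int L(1) continuous_open_preimage[OF holomorphic_map_continuous[OF H(1)] U(1) L'(1)])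
  have "p \<in> W1" using L(2) L'(2) pU by (simp add: W1_def)
  then obtain d where d: "0 < d" "ball p d \<subseteq> W1" using W1 open_contains_ball by blast
  \<comment> \<open>\<open>G j\<close> is the j-th holomorphic partial derivative of \<rho>'
    composed with \<open>H\<close>, written by the chain rule; nontransversality along
    \<open>M\<close> says that it vanishes on \<open>M\<close>.\<close>
  define G where "G j z = (\<Sum>a\<in>UNIV. f a (H z) * jac H z $ a $ j)" for j z
  define G' where "G' j v = (\<Sum>a\<in>UNIV. f a (H p) * (\<Sum>i\<in>UNIV. K a j i * v $ i) + T a (?J *v v) * ?J $ a $ j)" for j v
  have dG: "(G j has_derivative G' j) (at p)" for j
  proof -
    have fH: "((\<lambda>z. f a (H z)) has_derivative (\<lambda>v. T a (?J *v v))) (at p)" for a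
      using diff_chain_at[OF has_derivative_jac[OF H(1) pU] T] by (simp add: o_def)
    show ?thesis unfolding G_def[abs_def] G'_def[abs_def]
      by (intro has_derivative_sum has_derivative_mult fH K)
  qed
  have df': "\<rho>' differentiable (at w)" if "w \<in> W'" for w
    using L'(4)[OF that] by (auto simp: differentiable_def)
  have Gz: "G j z = 0" if z: "z \<in> ball p d" "\<rho> z = 0" for j z
  proof -
    have zW: "z \<in> W" "z \<in> U" "H z \<in> W'" using z d by (auto simp: W1_def)
    then have zM: "z \<in> M" using L(6) z by blast
    then have HM: "H z \<in> M'" using H(2) by blast
    note Dz = nontransversal_derivative[OF M' l' H(1) zW(2) HM zW(3) nt[OF zM]]
    have "(jac H z *v axis j 1) $ a = jac H z $ a $ j" for a
      by (simp add: matrix_vector_mult_def axis_def if_distrib cong: if_cong)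
    then have "G j z = (\<Sum>a\<in>UNIV. wirtinger a (\<lambda>z. complex_of_real (\<rho>' z)) (H z) * (jac H z *v axis j 1) $ a)"
      by (simp add: G_def f_def)
    also have "\<dots> = 0"
      unfolding wirtinger_sum_eq[OF df'[OF zW(3)]] clin_def matrix_mult_smult[symmetric] by (simp add: Dz)
    finally show ?thesis .
  qed
  have \<rho>p: "\<rho> p = 0" using L(6)[OF L(2)] p by blast
  have cont: "continuous_on (ball p d) \<rho>" using L(7) d(2) continuous_on_subset unfolding W1_def by blast
  \<comment> \<open>As \<open>G j\<close> vanishes on \<open>M\<close>, its differential at
    \<open>p\<close> kills the real tangent space and is therefore a complex multiple of
    d\<rho>.\<close>
  have tan: "G' j v = 0" if "?D v = 0" for j v
    by (rule derivative_vanishes_tangential[OF L(4)[OF L(2)] \<rho>p d(1) cont L(5)[OF L(2)] dG Gz that])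
  have linG: "linear (G' j)" for j using dG by (rule has_derivative_linear)
  have G'eq: "G' j v = of_real (?D v) * G' j N" for j v
  proof -
    have "?D (v - ?D v *\<^sub>R N) = 0" using linD N by (simp add: linear_diff linear_cmul)
    from tan[OF this, of j] show ?thesis using linG[of j] by (simp add: linear_diff linear_cmul scaleR_conv_of_real[where 'a = complex])
  qed
  \<comment> \<open>The antilinear part of the product rule: the entries of \<open>jac H\<close>
    contribute nothing, and what remains is the Levi form of \<open>M'\<close> with one argument
    replaced by Jv.\<close>
  have cG: "canti (G' j) v = (\<Sum>a\<in>UNIV. ?J $ a $ j * canti (T a) (?J *v v))" for j v
  proof -
    have "canti (G' j) v = (\<Sum>a\<in>UNIV. f a (H p) * canti (\<lambda>v. \<Sum>i\<in>UNIV. K a j i * v $ i) v + canti (T a) (?J *v v) * ?J $ a $ j)"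
      unfolding G'_def[abs_def] canti_sum canti_add canti_cmult
      by (intro sum.cong refl arg_cong2[where f = "(+)"]) (simp add: canti_def matrix_mult_smult algebra_simps add_divide_distrib)
    then show ?thesis unfolding canti_zero_of_complex_linear by (simp add: mult.commute)
  qed
  \<comment> \<open>The same antilinear part from the other side: d\<rho> is real, so its antilinear
    part is the conjugate of its complex-linear part.\<close>
  have cG2: "canti (G' j) v = G' j N * cnj (clin (\<lambda>v. of_real (?D v)) v)" for j v
    unfolding canti_def clin_def G'eq[of j v] G'eq[of j "\<i> *s v"] by (simp add: algebra_simps add_divide_distrib)
  show ?thesis
  proof (intro exI[of _ "\<lambda>j. G' j N"] allI)
    fix u v
    have "hform (levi_matrix \<rho>' (H p)) (?J *v u) (?J *v v) =
      (\<Sum>a\<in>UNIV. (?J *v u) $ a * (\<Sum>b\<in>UNIV. (T a (axis b 1) + \<i> * T a (axis b \<i>)) / 2 * cnj ((?J *v v) $ b)))"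
      unfolding hform_def levi_matrix_eq[OF L'(1,3,2) T[unfolded f_def]]
      by (simp add: sum_distrib_left mult_ac)
    also have "\<dots> = (\<Sum>a\<in>UNIV. (?J *v u) $ a * canti (T a) (?J *v v))"
      unfolding canti_expansion[OF linT] ..
    also have "\<dots> = (\<Sum>a\<in>UNIV. \<Sum>j\<in>UNIV. u $ j * (?J $ a $ j * canti (T a) (?J *v v)))"
      by (simp add: matrix_vector_mult_def sum_distrib_right mult_ac)
    also have "\<dots> = (\<Sum>j\<in>UNIV. u $ j * canti (G' j) v)"
      unfolding cG by (subst sum.swap) (simp add: sum_distrib_left)
    also have "\<dots> = (\<Sum>j\<in>UNIV. u $ j * G' j N) * cnj (clin (\<lambda>v. of_real (?D v)) v)"
      unfolding cG2 by (simp add: sum_distrib_right mult.assoc)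
    finally show "hform (levi_matrix \<rho>' (H p)) (?J *v u) (?J *v v) =
      (\<Sum>j\<in>UNIV. u $ j * G' j N) * cnj (clin (\<lambda>v. of_real (?D v)) v)" .
  qed
qed

text \<open>The Levi form at \<open>H p\<close> is tested on two subspaces of the complex tangent
  space of \<open>M'\<close>: the image of all of the source and the image of the complex tangent
  space of \<open>M\<close>. Injectivity makes their dimensions n + 1 and n, which forces more
  eigenvalues than \<open>cond\<close> permits.\<close>

lemma nontransversal_not_immersion:
  fixes M U :: "(complex ^ 'm) set" and M' :: "(complex ^ 'k) set" and n n' :: nat
  assumes card: "CARD('m) = n + 1" "CARD('k) = n' + 1"
    and M: "real_analytic_hypersurface M" and M': "real_analytic_hypersurface M'" and U: "open U" "M \<subseteq> U"
    and H: "holomorphic_map_on H U" "H ` M \<subseteq> M'"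
    and cond: "int (levi_e M' (H p)) + int (levi_e0 M' (H p)) \<le> int n - 1 \<or> n' + levi_e0 M' (H p) \<le> 2 * n"
    and p: "p \<in> M" and inj: "\<And>v. jac H p *v v = 0 \<Longrightarrow> v = 0"
    and nt: "\<And>z. z \<in> M \<Longrightarrow> \<not> transversal_at H M' z"
  shows False
proof -
  let ?J = "jac H p" and ?\<rho>' = "defining_function_at M' (H p)"
  have pU: "p \<in> U" using p U by blast
  have Hp: "H p \<in> M'" using p H by blast
  obtain W' where l': "local_defining_function M' (H p) W' ?\<rho>'" using defining_function_at_works[OF M' Hp] .
  obtain W \<rho> where l: "local_defining_function M p W \<rho>" using M p unfolding real_analytic_hypersurface_def by blast
  note L = local_defining_functionD[OF l] and L' = local_defining_functionD[OF l']
  let ?C = "levi_matrix ?\<rho>' (H p)" and ?V = "levi_space ?\<rho>' (H p)"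
  let ?\<theta> = "clin (\<lambda>v. complex_of_real (frechet_derivative \<rho> (at p) v))"
  obtain c0 where c0: "\<And>u v. hform ?C (?J *v u) (?J *v v) = (\<Sum>j\<in>UNIV. u $ j * c0 j) * cnj (?\<theta> v)"
    using levi_form_pullback[OF M' U H l p l' nt] by blast
  define c where "c u = (\<Sum>j\<in>UNIV. u $ j * c0 j)" for u :: "complex ^ 'm"
  have cf: "hform ?C (?J *v u) (?J *v v) = c u * cnj (?\<theta> v)" for u v unfolding c_def by (rule c0)
  have herm: "?C k j = cnj (?C j k)" for k j by (rule levi_matrix_hermitian[OF L'(1,3,2)])
  have diff: "\<rho> differentiable (at p)" using L(4)[OF L(2)] by (auto simp: differentiable_def)
  have diff': "?\<rho>' differentiable (at (H p))" using L'(4)[OF L'(2)] by (auto simp: differentiable_def)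
  have \<theta>lin: "?\<theta> (u + v) = ?\<theta> u + ?\<theta> v" "?\<theta> (a *s u) = a * ?\<theta> u" for u v a
    unfolding wirtinger_sum_eq[OF diff, symmetric] by (simp_all add: algebra_simps sum.distrib sum_distrib_left)
  have ne: "\<exists>x. clin (\<lambda>v. complex_of_real (frechet_derivative f (at q) v)) x \<noteq> 0"
    if "frechet_derivative f (at q) \<noteq> (\<lambda>v. 0)" for f and q :: "complex ^ 'a"
  proof -
    obtain x where "frechet_derivative f (at q) x \<noteq> 0" using \<open>_ \<noteq> (\<lambda>v. 0)\<close> by auto
    then have "Re (clin (\<lambda>v. complex_of_real (frechet_derivative f (at q) v)) x) \<noteq> 0" by (simp add: clin_def)
    then show ?thesis by (intro exI[of _ x]) auto
  qed
  obtain x0 where x0: "?\<theta> x0 \<noteq> 0" using ne[OF L(5)[OF L(2)]] by blast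
  define x1 where "x1 = (1 / ?\<theta> x0) *s x0"
  have x1: "?\<theta> x1 = 1" unfolding x1_def \<theta>lin using x0 by simp
  \<comment> \<open>Hermitian symmetry determines the first factor: with \<open>x1\<close>
    normalized so that \<open>?\<theta>\<close> is 1 there, exchanging the arguments shows that
    \<open>c\<close> is a multiple of \<open>?\<theta>\<close>.\<close>
  have cu: "c u = cnj (c x1) * ?\<theta> u" for u
  proof -
    have "c u = hform ?C (?J *v u) (?J *v x1)" unfolding cf x1 by simp
    also have "\<dots> = cnj (hform ?C (?J *v x1) (?J *v u))" using cnj_hform[of ?C, OF herm] by simp
    also have "\<dots> = cnj (c x1) * ?\<theta> u" unfolding cf by simp
    finally show ?thesis .
  qed
  have Luu: "Re (hform ?C (?J *v u) (?J *v u)) = Re (c x1) * (norm (?\<theta> u))\<^sup>2" for u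
  proof -
    have "hform ?C (?J *v u) (?J *v u) = cnj (c x1) * of_real ((norm (?\<theta> u))\<^sup>2)"
      unfolding cf cu[of u] complex_norm_square by (simp only: mult.assoc)
    moreover have "Re (cnj a * of_real b) = Re a * b" for a b by simp
    ultimately show ?thesis by (simp only:)
  qed
  \<comment> \<open>Nontransversality kills d\<rho>' on Ju and on \<i> Ju = J(\<i> u), so the whole
    image of \<open>J\<close> lies in the complex tangent space.\<close>
  have J_V: "?J *v u \<in> ?V" for u
    unfolding levi_space_eq[OF diff'] mem_Collect_eq clin_def matrix_mult_smult[symmetric]
    by (simp add: nontransversal_derivative[OF M' l' H(1) pU Hp L'(2) nt[OF p]])
  have lJ: "Vector_Spaces.linear (*s) (*s) ((*v) ?J)" by (rule matrix_vector_mul_linear_gen)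
  have injJ: "inj ((*v) ?J)"
  proof (rule injI)
    fix u v assume "?J *v u = ?J *v v"
    then have "?J *v (u - v) = 0" by (simp add: matrix_vector_mult_diff_distrib)
    from inj[OF this] show "u = v" by simp
  qed
  have dimJ: "vec.dim ((*v) ?J ` S) = vec.dim S" for S
    by (rule vec.dim_image_eq[OF lJ]) (rule inj_on_subset[OF injJ subset_UNIV])
  define E where "E = range ((*v) ?J)"
  define K where "K = {u. ?\<theta> u = 0}"
  define E0 where "E0 = (*v) ?J ` K"
  have subK: "vec.subspace K" unfolding K_def vec.subspace_def using \<theta>lin \<theta>lin(2)[of 0 0] by auto
  have E: "vec.subspace E" "E \<subseteq> ?V"
    unfolding E_def using J_V vec.subspace_UNIV by (auto intro!: vec.linear_subspace_image[OF lJ])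
  have dimE: "vec.dim E = n + 1"
    unfolding E_def dimJ card(1)[symmetric] by (rule vec_dim_card)
  have dimK: "vec.dim K = n" using dim_kernel_functional[of ?\<theta>, OF \<theta>lin x0] card by (simp add: K_def)
  have E0: "vec.subspace E0" "E0 \<subseteq> ?V" "vec.dim E0 = n"
    unfolding E0_def using J_V dimK subK
    by (auto simp: dimJ intro!: vec.linear_subspace_image[OF lJ])
  have E0z: "Re (hform ?C w w) = 0" if "w \<in> E0" for w
    using that Luu unfolding E0_def K_def by auto
  note V = levi_space_subspace[of ?\<rho>' "H p"]
  note sig = hermitian_signature_bounds[of ?C, OF herm V]
  let ?p = "hcount ?C ?V {0<..}" and ?n = "hcount ?C ?V {..<0}" and ?z = "hcount ?C ?V {0}"
  have dimV: "vec.dim ?V \<le> n'"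
  proof -
    obtain x where "clin (\<lambda>v. complex_of_real (frechet_derivative ?\<rho>' (at (H p)) v)) x \<noteq> 0"
      using ne[OF L'(5)[OF L'(2)]] by blast
    then have "x \<notin> ?V" unfolding levi_space_eq[OF diff'] by simp
    then have "vec.span ?V \<subset> vec.span UNIV" unfolding vec.span_eq_iff[THEN iffD2, OF V] by auto
    from vec.dim_psubset[OF this] show ?thesis unfolding vec_dim_card card by simp
  qed
  have le: "levi_e M' (H p) = min ?p ?n" "levi_e0 M' (H p) = ?z"
    unfolding levi_e_def levi_e0_def num_levi_eigenvalues_eq by (rule refl, rule refl)
  have "n \<le> ?p + ?z" "n \<le> ?n + ?z"
    using sig(2)[OF E0(1,2)] sig(3)[OF E0(1,2)] E0z E0(3) by simp_all
  moreover have "n + 1 \<le> ?p + ?z \<or> n + 1 \<le> ?n + ?z"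
  proof (cases "0 \<le> Re (c x1)")
    case True
    then have "0 \<le> Re (hform ?C w w)" if "w \<in> E" for w using that Luu unfolding E_def by auto
    from sig(2)[OF E(1,2) this] show ?thesis using dimE by simp
  next
    case False
    then have "Re (hform ?C w w) \<le> 0" if "w \<in> E" for w
      using that Luu unfolding E_def by (auto simp: mult_nonpos_nonneg)
    from sig(3)[OF E(1,2) this] show ?thesis using dimE by simp
  qed
  \<comment> \<open>Both sums are at least n, so the minimum of the two counts plus e0 is at least
    n, against the first condition. Adding the sums gives e_+ + e_- + 2 e0 \<ge> 2n + 1; as e_+ +
    e_- + e0 \<le> n', this means n' + e0 \<ge> 2n + 1, against the second.\<close>
  ultimately show False using cond sig(1) dimV unfolding le by linarith
qed

section \<open>Kernel fields and the main theorem\<close>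

lemma holomorphic_map_onI:
  fixes a :: "complex ^ 'm \<Rightarrow> complex ^ 'k"
  assumes "\<And>z i. z \<in> S \<Longrightarrow> cdiff_at (\<lambda>z. a z $ i) z"
  shows "holomorphic_map_on a S"
  unfolding holomorphic_map_on_def
proof
  fix z assume z: "z \<in> S"
  define c where "c i = (SOME c. ((\<lambda>z. a z $ i) has_derivative (\<lambda>v. \<Sum>j\<in>UNIV. c j * v $ j)) (at z))" for i
  have c: "((\<lambda>z. a z $ i) has_derivative (\<lambda>v. \<Sum>j\<in>UNIV. c i j * v $ j)) (at z)" for i
    unfolding c_def by (rule someI_ex[OF assms[OF z, unfolded cdiff_at_def]])
  have bl: "bounded_linear (\<lambda>x. x *s axis i (1 :: complex))" for i :: 'k
    unfolding linear_conv_bounded_linear[symmetric] by (intro linearI) (auto simp: vec_eq_iff algebra_simps)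
  have "((\<lambda>z. \<Sum>i\<in>UNIV. a z $ i *s axis i 1) has_derivative (\<lambda>v. \<Sum>i\<in>UNIV. (\<Sum>j\<in>UNIV. c i j * v $ j) *s axis i 1)) (at z)"
    by (intro has_derivative_sum bounded_linear.has_derivative[OF bl c])
  moreover have "(\<Sum>i\<in>UNIV. x $ i *s axis i 1) = x" for x :: "complex ^ 'k"
    by (simp add: vec_eq_iff axis_def if_distrib cong: if_cong)
  moreover have "(\<Sum>i\<in>UNIV. (\<Sum>j\<in>UNIV. c i j * v $ j) *s axis i 1) = (\<chi> i j. c i j) *v v" for v
    by (simp add: vec_eq_iff axis_def matrix_vector_mult_def if_distrib cong: if_cong)
  ultimately show "\<exists>A. (a has_derivative (\<lambda>v. A *v v)) (at z)" by (intro exI[of _ "\<chi> i j. c i j"]) simp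
qed

lemma cdiff_at_imp_isCont: "cdiff_at f z \<Longrightarrow> isCont f z"
  using cdiff_at_imp_differentiable differentiable_imp_continuous_within by blast

text \<open>A holomorphic kernel field \<open>a\<close> of \<open>dH\<close> is tangent to \<open>M\<close> unless \<open>\<rho>' \<circ> H\<close> vanishes on an
  open set: where \<open>a\<close> or \<open>\<i>a\<close> is transversal to \<open>M\<close>, the zero data propagate along it.\<close>

lemma kernel_field_tangent:
  fixes M U :: "(complex ^ 'm) set" and M' :: "(complex ^ 'k) set"
  assumes l: "local_defining_function M q W \<rho>" and l': "local_defining_function M' p' W' \<rho>'"
    and H: "holomorphic_map_on H U" "H ` M \<subseteq> M'" and W: "W \<subseteq> U" "H ` W \<subseteq> W'"
    and a: "\<And>z i. z \<in> W \<Longrightarrow> cdiff_at (\<lambda>z. a z $ i) z" "\<And>z. z \<in> W \<Longrightarrow> jac H z *v a z = 0"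
    and nz: "\<And>x. x \<in> W \<Longrightarrow> \<not> (\<forall>\<^sub>F z in nhds x. \<rho>' (H z) = 0)"
    and q: "q \<in> M"
  shows "(\<Sum>j\<in>UNIV. a q $ j * wirtinger j (\<lambda>w. complex_of_real (\<rho> w)) q) = 0"
proof -
  note L = local_defining_functionD[OF l] and L' = local_defining_functionD[OF l']
  let ?D = "\<lambda>z. frechet_derivative \<rho> (at z)"
  have lin: "linear (?D q)" using L(4)[OF L(2)] by (rule has_derivative_linear)
  \<comment> \<open>The transport argument needs d\<rho>(X) > 0 and is run with X = c a for
    arbitrary complex \<open>c\<close>. Replacing \<open>c\<close> by \<open>- c\<close> gives
    equality, and the choices 1 and \<i> together give the vanishing of \<partial>\<rho>(a).\<close>
  have key: "?D q (c *s a q) \<le> 0" for c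
  proof (rule ccontr)
    assume "\<not> ?D q (c *s a q) \<le> 0"
    then have pos: "0 < ?D q (c *s a q)" by simp
    have aC: "isCont (\<lambda>z. c *s a z) q"
    proof -
      have ac: "isCont (\<lambda>z. a z $ i) q" for i by (rule cdiff_at_imp_isCont[OF a(1)[OF L(2)]])
      have "isCont (\<lambda>z. \<chi> i. c * a z $ i) q"
        unfolding isCont_def by (intro tendsto_vec_lambda tendsto_mult tendsto_const ac[unfolded isCont_def])
      moreover have "(\<lambda>z. \<chi> i. c * a z $ i) = (\<lambda>z. c *s a z)" by (simp add: fun_eq_iff vec_eq_iff)
      ultimately show ?thesis by simp
    qed
    have DC: "isCont (\<lambda>z. ?D z (c *s a z)) q"
    proof -
      have b: "isCont (\<lambda>z. ?D z b) q" if "b \<in> Basis" for b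
      proof -
        have "real_analytic_at (\<lambda>z. ?D z b) q"
          using real_analytic_on_frechet[OF L(1,3) that] L(2) unfolding real_analytic_on_def by blast
        from real_analytic_imp_differentiable[OF this] show ?thesis
          by (rule differentiable_imp_continuous_within)
      qed
      have "isCont (\<lambda>z. \<Sum>b\<in>Basis. ((c *s a z) \<bullet> b) * ?D z b) q"
        by (intro continuous_intros aC b)
      moreover have "\<forall>\<^sub>F z in nhds q. (\<Sum>b\<in>Basis. ((c *s a z) \<bullet> b) * ?D z b) = ?D z (c *s a z)"
      proof (rule eventually_nhds_in_open[THEN eventually_mono])
        show "open W" "q \<in> W" by (rule L)+
        fix z assume "z \<in> W"
        then have lz: "linear (?D z)" using L(4) has_derivative_linear by blast
        have "?D z (c *s a z) = ?D z (\<Sum>b\<in>Basis. ((c *s a z) \<bullet> b) *\<^sub>R b)" by (simp only: euclidean_representation)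
        also have "\<dots> = (\<Sum>b\<in>Basis. ((c *s a z) \<bullet> b) * ?D z b)"
          unfolding linear_sum[OF lz] linear_cmul[OF lz] by simp
        finally show "(\<Sum>b\<in>Basis. ((c *s a z) \<bullet> b) * ?D z b) = ?D z (c *s a z)" by simp
      qed
      ultimately show ?thesis using isCont_cong by force
    qed
    have "\<exists>x\<in>W. \<forall>\<^sub>F z in nhds x. \<rho>' (H z) = 0"
    proof (rule transport_vanishing[where \<rho> = \<rho> and D\<rho> = ?D and X = "\<lambda>z. c *s a z", OF L(1,2) _ L(4)])
      show "((\<lambda>z. \<rho>' (H z)) has_derivative (\<lambda>v. frechet_derivative \<rho>' (at (H z)) (jac H z *v v))) (at z)" if "z \<in> W" for z
        using that W by (intro frechet_compose_holomorphic[OF l' H(1)]) auto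
      show "\<rho>' (H z) = 0" if "z \<in> W" "\<rho> z = 0" for z
      proof -
        have "z \<in> M" using L(6) that by blast
        then have "H z \<in> M'" using H(2) by blast
        then show ?thesis using L'(6) that W by blast
      qed
      show "\<rho> q = 0" using L(6)[OF L(2)] q by blast
      show "frechet_derivative \<rho>' (at (H z)) (jac H z *v (c *s a z)) = 0" if z: "z \<in> W" for z
      proof -
        have "H z \<in> W'" using z W by blast
        then have "linear (frechet_derivative \<rho>' (at (H z)))" using L'(4) has_derivative_linear by blast
        then show ?thesis unfolding matrix_mult_smult a(2)[OF z] by (simp add: linear_0)
      qed
    qed (use pos DC aC in auto)
    then show False using nz by blast
  qed
  have zero: "?D q (c *s a q) = 0" for c
  proof -
    have "?D q ((- c) *s a q) = - ?D q (c *s a q)" using lin by (simp add: linear_neg)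
    then show ?thesis using key[of c] key[of "- c"] by linarith
  qed
  have "\<rho> differentiable (at q)" using L(4)[OF L(2)] by (auto simp: differentiable_def)
  from wirtinger_sum_eq[OF this, of "a q"]
  have "(\<Sum>j\<in>UNIV. wirtinger j (\<lambda>w. complex_of_real (\<rho> w)) q * a q $ j) = 0"
    using zero[of 1] zero[of \<i>] by (simp add: clin_def)
  then show ?thesis by (simp add: mult.commute)
qed

text \<open>\<open>S\<close> is the column set of a maximal generically independent family of columns of \<open>J\<close>; the Gram-type
  matrix \<open>Q(z) = P J(z\<^sub>0)\<^sup>* J(z) P + (I - P)\<close>, with \<open>P\<close> the projection to the coordinates in \<open>S\<close>, is
  invertible at \<open>z\<^sub>0\<close>, and Cramer's rule for \<open>Q\<close> gives the kernel field holomorphically.\<close>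

lemma gram_invertible:
  fixes J0 :: "complex ^ 'm ^ 'k"
  assumes J0: "\<And>s. (\<forall>j. j \<notin> S \<longrightarrow> s $ j = 0) \<Longrightarrow> J0 *v s = 0 \<Longrightarrow> s = 0"
  shows "det (\<chi> i j. if i \<in> S \<and> j \<in> S then (\<Sum>a\<in>UNIV. cnj (J0 $ a $ i) * J0 $ a $ j) else if i = j then 1 else 0 :: complex ^ 'm ^ 'm) \<noteq> 0"
  (is "det ?Q \<noteq> 0")
proof -
  define Q where "Q = ?Q"
  have Q_in: "Q $ i $ j = (\<Sum>a\<in>UNIV. cnj (J0 $ a $ i) * J0 $ a $ j)" if "i \<in> S" "j \<in> S" for i j
    using that by (simp add: Q_def)
  have Q_out: "Q $ i $ j = (if i = j then 1 else 0)" if "i \<notin> S" for i j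
    using that by (simp add: Q_def)
  have "s = 0" if Qs: "Q *v s = 0" for s
  proof -
    have Qi: "(\<Sum>j\<in>UNIV. Q $ i $ j * s $ j) = 0" for i
    proof -
      have "(Q *v s) $ i = (0 :: complex ^ 'm) $ i" by (simp only: Qs)
      then show ?thesis by (simp only: matrix_vector_mult_def vec_lambda_beta zero_index)
    qed
    have s0: "s $ i = 0" if "i \<notin> S" for i
    proof -
      have "(\<Sum>j\<in>UNIV. Q $ i $ j * s $ j) = (\<Sum>j\<in>UNIV. if i = j then s $ j else 0)"
        by (intro sum.cong refl) (simp add: Q_out[OF that])
      then show ?thesis using Qi[of i] by simp
    qed
    have Js: "(\<Sum>a\<in>UNIV. cnj (J0 $ a $ i) * (J0 *v s) $ a) = 0" if i: "i \<in> S" for i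
    proof -
      have "(\<Sum>a\<in>UNIV. cnj (J0 $ a $ i) * (J0 *v s) $ a) =
          (\<Sum>a\<in>UNIV. \<Sum>j\<in>UNIV. cnj (J0 $ a $ i) * J0 $ a $ j * s $ j)"
        by (simp add: matrix_vector_mult_def sum_distrib_left mult.assoc)
      also have "\<dots> = (\<Sum>j\<in>UNIV. \<Sum>a\<in>UNIV. cnj (J0 $ a $ i) * J0 $ a $ j * s $ j)" by (rule sum.swap)
      also have "\<dots> = (\<Sum>j\<in>UNIV. Q $ i $ j * s $ j)"
      proof (intro sum.cong refl)
        fix j
        show "(\<Sum>a\<in>UNIV. cnj (J0 $ a $ i) * J0 $ a $ j * s $ j) = Q $ i $ j * s $ j"
        proof (cases "j \<in> S")
          case True
          then show ?thesis by (simp only: Q_in[OF i] sum_distrib_right)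
        next
          case False
          then show ?thesis by (simp add: s0)
        qed
      qed
      finally show ?thesis by (simp only: Qi)
    qed
    \<comment> \<open>For \<open>s\<close> supported in \<open>S\<close>, the squared norm of J0 s
      is the pairing of Q s with \<open>s\<close>, which is 0; on such vectors \<open>J0\<close> is
      injective.\<close>
    have "hip (J0 *v s) (J0 *v s) = (\<Sum>i\<in>UNIV. cnj (s $ i) * (\<Sum>a\<in>UNIV. cnj (J0 $ a $ i) * (J0 *v s) $ a))"
    proof -
      have "hip (J0 *v s) (J0 *v s) = (\<Sum>a\<in>UNIV. \<Sum>i\<in>UNIV. cnj (s $ i) * (cnj (J0 $ a $ i) * (J0 *v s) $ a))"
        unfolding hip_def
        by (intro sum.cong refl) (simp add: matrix_vector_mult_def[of J0 s] sum_distrib_left sum_distrib_right mult_ac)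
      then show ?thesis by (subst (asm) sum.swap) (simp add: sum_distrib_left)
    qed
    also have "\<dots> = 0"
    proof (intro sum.neutral ballI)
      fix i
      show "cnj (s $ i) * (\<Sum>a\<in>UNIV. cnj (J0 $ a $ i) * (J0 *v s) $ a) = 0"
      proof (cases "i \<in> S")
        case True
        show ?thesis unfolding Js[OF True] by simp
      next
        case False
        show ?thesis unfolding s0[OF False] by simp
      qed
    qed
    finally have "J0 *v s = 0" by (simp add: hip_self_eq_0)
    moreover have "\<forall>j. j \<notin> S \<longrightarrow> s $ j = 0" using s0 by blast
    ultimately show ?thesis by (intro J0)
  qed
  then have "\<exists>B. B ** Q = mat 1" unfolding matrix_left_invertible_ker by blast
  then have "det Q \<noteq> 0" unfolding invertible_left_inverse[symmetric] invertible_det_nz .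
  then show ?thesis unfolding Q_def .
qed

text \<open>The assumption on \<open>N\<close> makes it a set of uniqueness; applied to det Q it
  moves from the generic point \<open>z0\<close> to a point of \<open>N\<close>. There either
  \<open>S\<close> contains all columns and \<open>J\<close> is injective, or a further column is a
  combination of those in \<open>S\<close> and the relation between them is the field.\<close>

lemma generic_kernel_or_immersion:
  fixes J :: "complex ^ 'm \<Rightarrow> complex ^ 'm ^ 'k"
  assumes "open B" "B \<noteq> {}" and J: "\<And>z a j. z \<in> B \<Longrightarrow> cdiff_at (\<lambda>z. J z $ a $ j) z"
    and N: "\<And>f. (\<And>z. z \<in> B \<Longrightarrow> cdiff_at f z) \<Longrightarrow> (\<And>z. z \<in> B \<Longrightarrow> z \<in> N \<Longrightarrow> f z = 0) \<Longrightarrow> (\<And>z. z \<in> B \<Longrightarrow> f z = 0)"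
  shows "(\<exists>z\<in>B \<inter> N. \<forall>v. J z *v v = 0 \<longrightarrow> v = 0) \<or>
    (\<exists>z\<in>B \<inter> N. \<exists>W a. open W \<and> z \<in> W \<and> W \<subseteq> B \<and> (\<forall>w\<in>W. \<forall>i. cdiff_at (\<lambda>z. a z $ i) w) \<and>
      (\<forall>w\<in>W. J w *v a w = 0) \<and> (\<forall>w\<in>W. a w \<noteq> 0))"
proof -
  \<comment> \<open>Linear independence of the columns of \<open>J z\<close> with index in
    \<open>S\<close>. The empty family always qualifies, so one of maximal size over all of
    \<open>B\<close> exists.\<close>
  define good where "good S z \<longleftrightarrow> (\<forall>s. (\<forall>j. j \<notin> S \<longrightarrow> s $ j = 0) \<longrightarrow> J z *v s = 0 \<longrightarrow> s = 0)" for S z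
  obtain z where "z \<in> B" using \<open>B \<noteq> {}\<close> by blast
  moreover have "good {} z" by (auto simp: good_def vec_eq_iff)
  ultimately have ex: "\<exists>z\<in>B. good {} z" by blast
  have bd: "card S \<le> CARD('m)" for S :: "'m set" by (rule card_mono) simp_all
  have "\<exists>S. (\<exists>z\<in>B. good S z) \<and> (\<forall>T. (\<exists>z\<in>B. good T z) \<longrightarrow> card T \<le> card S)"
    by (rule ex_has_greatest_nat[where P = "\<lambda>S. \<exists>z\<in>B. good S z" and b = "CARD('m) + 1", OF ex])
      (simp add: bd le_imp_less_Suc)
  then obtain S where S: "\<exists>z\<in>B. good S z" and max: "\<And>T. \<exists>z\<in>B. good T z \<Longrightarrow> card T \<le> card S"
    by blast
  obtain z0 where z0: "z0 \<in> B" "good S z0" using S by blast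
  define Q where "Q z = (\<chi> i j. if i \<in> S \<and> j \<in> S then (\<Sum>a\<in>UNIV. cnj (J z0 $ a $ i) * J z $ a $ j) else if i = j then 1 else 0 :: complex ^ 'm ^ 'm)" for z
  have Qc: "cdiff_at (\<lambda>z. Q z $ i $ j) z" if "z \<in> B" for i j z
    unfolding Q_def by (cases "i \<in> S \<and> j \<in> S") (auto intro!: cdiff_at_sum cdiff_at_mult J that)
  have detc: "cdiff_at (\<lambda>z. det (Q z)) z" if "z \<in> B" for z by (rule cdiff_at_det[OF Qc[OF that]])
  have Q0: "det (Q z0) \<noteq> 0" unfolding Q_def by (rule gram_invertible) (use z0(2) in \<open>auto simp: good_def\<close>)
  obtain z1 where z1: "z1 \<in> B" "z1 \<in> N" "det (Q z1) \<noteq> 0" using N[OF detc _ z0(1)] Q0 by blast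
  have Qs: "(Q z *v s) $ i = (if i \<in> S then (\<Sum>a\<in>UNIV. cnj (J z0 $ a $ i) * (J z *v s) $ a) else 0)"
    if s: "\<forall>j. j \<notin> S \<longrightarrow> s $ j = 0" for z s i
  proof (cases "i \<in> S")
    case True
    have "(Q z *v s) $ i = (\<Sum>j\<in>UNIV. (\<Sum>a\<in>UNIV. cnj (J z0 $ a $ i) * J z $ a $ j) * s $ j)"
      unfolding matrix_vector_mult_def vec_lambda_beta by (intro sum.cong) (use s True in \<open>auto simp: Q_def\<close>)
    also have "\<dots> = (\<Sum>a\<in>UNIV. cnj (J z0 $ a $ i) * (J z *v s) $ a)"
      by (simp add: matrix_vector_mult_def sum_distrib_left sum_distrib_right mult.assoc) (rule sum.swap)
    finally show ?thesis using True by simp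
  next
    case False
    have "(Q z *v s) $ i = (\<Sum>j\<in>(UNIV :: 'm set). 0)"
      unfolding matrix_vector_mult_def vec_lambda_beta by (intro sum.cong) (use s False in \<open>auto simp: Q_def\<close>)
    then show ?thesis using False by simp
  qed
  have Qinj: "s = 0" if "det (Q z) \<noteq> 0" "Q z *v s = 0" for z s
    using that unfolding invertible_det_nz[symmetric] invertible_left_inverse matrix_left_invertible_ker by blast
  have goodQ: "good S z" if "det (Q z) \<noteq> 0" for z
    unfolding good_def
  proof (intro allI impI)
    fix s assume s: "\<forall>j. j \<notin> S \<longrightarrow> s $ j = 0" "J z *v s = 0"
    have "Q z *v s = 0" unfolding vec_eq_iff using Qs[OF s(1)] s(2) by simp
    then show "s = 0" using Qinj that by blast
  qed
  show ?thesis
  proof (cases "S = UNIV")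
    case True
    then show ?thesis using goodQ[OF z1(3)] z1 unfolding good_def by blast
  next
    case False
    then obtain j0 where j0: "j0 \<notin> S" by blast
    \<comment> \<open>If t expresses column \<open>j0\<close> of J(z) through the columns in
      \<open>S\<close>, then Q t = r. Cramer's numerators \<open>x\<close> are det Q times t, so the
      field det Q * (t - e_j0) is obtained without division and is holomorphic; its entry at
      \<open>j0\<close> is - det Q, hence it has no zeros on \<open>W\<close>.\<close>
    define r where "r z = (\<chi> i. if i \<in> S then (\<Sum>a\<in>UNIV. cnj (J z0 $ a $ i) * J z $ a $ j0) else 0)" for z
    define x where "x z = (\<chi> k. det (\<chi> i j. if j = k then r z $ i else Q z $ i $ j))" for z
    define a where "a z = x z - det (Q z) *s axis j0 1" for z
    define W where "W = {z \<in> B. det (Q z) \<noteq> 0}"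
    have "open W"
    proof -
      have "continuous_on B (\<lambda>z. det (Q z))"
        by (intro continuous_at_imp_continuous_on ballI cdiff_at_imp_isCont detc)
      then have "open (B \<inter> (\<lambda>z. det (Q z)) -` (- {0}))"
        by (intro continuous_open_preimage \<open>open B\<close>) auto
      moreover have "W = B \<inter> (\<lambda>z. det (Q z)) -` (- {0})" by (auto simp: W_def)
      ultimately show ?thesis by simp
    qed
    have ker: "J z *v a z = 0 \<and> a z $ j0 = - det (Q z)" if z: "z \<in> W" for z
    proof -
      have zB: "z \<in> B" "det (Q z) \<noteq> 0" using z by (auto simp: W_def)
      have "finite S" by simp
      \<comment> \<open>Maximality of \<open>S\<close> refers to every point of \<open>B\<close>, so
        column \<open>j0\<close> is dependent on the columns in \<open>S\<close> at this
        \<open>z\<close> as well.\<close>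
      then have "\<not> good (insert j0 S) z" using max[of "insert j0 S"] zB j0 by auto
      then obtain s where s: "\<forall>j. j \<notin> insert j0 S \<longrightarrow> s $ j = 0" "J z *v s = 0" "s \<noteq> 0"
        unfolding good_def by blast
      have sj: "s $ j0 \<noteq> 0"
      proof
        assume "s $ j0 = 0"
        then have "\<forall>j. j \<notin> S \<longrightarrow> s $ j = 0" using s(1) by auto
        then show False using goodQ[OF zB(2)] s unfolding good_def by blast
      qed
      define t where "t = (- 1 / s $ j0) *s s + axis j0 1"
      have tS: "\<forall>j. j \<notin> S \<longrightarrow> t $ j = 0" using s(1) sj by (auto simp: t_def axis_def)
      have "J z *v t = (- 1 / s $ j0) *s (J z *v s) + J z *v axis j0 1"
        unfolding t_def by (simp only: matrix_vector_right_distrib matrix_mult_smult)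
      then have Jt: "J z *v t = J z *v axis j0 1" using s(2) by simp
      have col: "(J z *v axis j0 1) $ b = J z $ b $ j0" for b
        by (simp add: matrix_vector_mult_def axis_def if_distrib cong: if_cong)
      have "Q z *v t = r z" unfolding vec_eq_iff using Qs[OF tS] by (simp add: r_def Jt col)
      then have "t = (\<chi> k. det (\<chi> i j. if j = k then r z $ i else Q z $ i $ j) / det (Q z))"
        using cramer[OF zB(2)] by blast
      then have xt: "x z = det (Q z) *s t" using zB(2) by (simp add: x_def vec_eq_iff)
      have "J z *v a z = det (Q z) *s (J z *v t) - det (Q z) *s (J z *v axis j0 1)"
        unfolding a_def xt by (simp only: matrix_vector_mult_diff_distrib matrix_mult_smult)
      moreover have "a z $ j0 = - det (Q z)" using tS j0 by (simp add: a_def xt axis_def)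
      ultimately show ?thesis by (simp add: Jt)
    qed
    have rc: "cdiff_at (\<lambda>z. r z $ i) z" if "z \<in> B" for i z
      unfolding r_def by (cases "i \<in> S") (auto intro!: cdiff_at_sum cdiff_at_mult J that)
    have xc: "cdiff_at (\<lambda>z. x z $ k) z" if "z \<in> B" for k z
    proof -
      have "cdiff_at (\<lambda>z. (\<chi> i j. if j = k then r z $ i else Q z $ i $ j) $ i $ j) z" for i j
        by (cases "j = k") (simp_all add: rc Qc that)
      from cdiff_at_det[OF this] show ?thesis by (simp add: x_def)
    qed
    have ac: "cdiff_at (\<lambda>z. a z $ i) z" if "z \<in> B" for i z
    proof -
      have "cdiff_at (\<lambda>z. x z $ i + - (det (Q z) * axis j0 1 $ i)) z"
        by (intro cdiff_at_add cdiff_at_minus cdiff_at_mult cdiff_at_const xc detc that)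
      then show ?thesis by (simp add: a_def)
    qed
    have "open W \<and> z1 \<in> W \<and> W \<subseteq> B \<and> (\<forall>w\<in>W. \<forall>i. cdiff_at (\<lambda>z. a z $ i) w) \<and>
      (\<forall>w\<in>W. J w *v a w = 0) \<and> (\<forall>w\<in>W. a w \<noteq> 0)"
    proof (intro conjI ballI allI)
      show "a w \<noteq> 0" if "w \<in> W" for w
      proof
        assume "a w = 0"
        then show False using ker[OF that] that by (simp add: W_def)
      qed
    qed (use \<open>open W\<close> z1 ac ker in \<open>auto simp: W_def\<close>)
    then show ?thesis using z1 by blast
  qed
qed

lemma nontransversal_imp_mapped_locally:
  fixes M U :: "(complex ^ 'm) set" and M' :: "(complex ^ 'k) set" and n n' :: nat
  assumes card: "CARD('m) = n + 1" "CARD('k) = n' + 1"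
    and M: "real_analytic_hypersurface M" and M': "real_analytic_hypersurface M'" and U: "open U" "M \<subseteq> U"
    and nondeg: "holomorphically_nondegenerate M"
    and cond: "\<And>p. p \<in> M' \<Longrightarrow> int (levi_e M' p) + int (levi_e0 M' p) \<le> int n - 1 \<or> n' + levi_e0 M' p \<le> 2 * n"
    and H: "holomorphic_map_on H U" "H ` M \<subseteq> M'"
    and p: "p \<in> M" and nt: "\<And>z. z \<in> M \<Longrightarrow> \<not> transversal_at H M' z"
  shows "\<exists>V. open V \<and> V \<subseteq> U \<and> p \<in> V \<and> H ` V \<subseteq> M'"
proof (rule ccontr)
  assume no: "\<not> ?thesis"
  have Hp: "H p \<in> M'" using p H by blast
  obtain W \<rho> where l: "local_defining_function M p W \<rho>" using M p unfolding real_analytic_hypersurface_def by blast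
  obtain W' \<rho>' where l': "local_defining_function M' (H p) W' \<rho>'" using M' Hp unfolding real_analytic_hypersurface_def by blast
  note L = local_defining_functionD[OF l] and L' = local_defining_functionD[OF l']
  have "open (W \<inter> (U \<inter> H -` W'))"
    by (intro open_Int L(1) continuous_open_preimage[OF holomorphic_map_continuous[OF H(1)] U(1) L'(1)])
  moreover have "p \<in> W \<inter> (U \<inter> H -` W')" using L(2) L'(2) p U by auto
  ultimately obtain d where d: "0 < d" "ball p d \<subseteq> W \<inter> (U \<inter> H -` W')" using open_contains_ball by blast
  define B where "B = ball p d"
  have B: "open B" "connected B" "p \<in> B" "B \<subseteq> W" "B \<subseteq> U" "H ` B \<subseteq> W'" using d by (auto simp: B_def)
  let ?g = "\<lambda>z. \<rho>' (H z)"
  have ga: "real_analytic_on ?g B"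
    unfolding real_analytic_on_def
  proof
    fix z assume "z \<in> B"
    then have z: "z \<in> U" "H z \<in> W'" using B by auto
    have "real_analytic_at \<rho>' (H z)" using L'(3) z(2) unfolding real_analytic_on_def by blast
    then show "real_analytic_at ?g z" by (rule real_analytic_at_compose_holomorphic[OF H(1) U(1) z(1)])
  qed
  \<comment> \<open>By the identity theorem on the connected ball, vanishing near one point would
    spread to \<open>B\<close>, and \<open>B\<close> would be a neighbourhood of the kind that
    \<open>no\<close> excludes.\<close>
  have nz: "\<not> (\<forall>\<^sub>F z in nhds x. ?g z = 0)" if "x \<in> B" for x
  proof
    assume "\<forall>\<^sub>F z in nhds x. ?g z = 0"
    from real_analytic_identity[OF B(1,2) ga that this] have "?g z = 0" if "z \<in> B" for z using that .
    then have "H ` B \<subseteq> M'" using L'(6) B(6) by blast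
    then show False using no B by blast
  qed
  have uniq: "f z = 0" if f: "\<And>z. z \<in> B \<Longrightarrow> cdiff_at f z" "\<And>z. z \<in> B \<Longrightarrow> z \<in> M \<Longrightarrow> f z = 0" and z: "z \<in> B" for f z
  proof -
    have cont: "continuous_on (ball p d) \<rho>" using L(7) B(4) continuous_on_subset unfolding B_def by blast
    have \<rho>p: "\<rho> p = 0" using L(6)[OF L(2)] p by blast
    have "\<forall>\<^sub>F z in nhds p. f z = 0"
    proof (rule cdiff_vanishing_on_hypersurface[OF d(1) L(4)[OF L(2)] \<rho>p L(5)[OF L(2)] cont f(1)[unfolded B_def]])
      show "f y = 0" if "y \<in> ball p d" "\<rho> y = 0" for y
      proof -
        have "y \<in> B" using that by (simp add: B_def)
        then show ?thesis using f(2) L(6) B(4) that(2) by blast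
      qed
    qed
    then show "f z = 0"
    proof (rule cdiff_identity_ball[rotated])
      show "z \<in> ball p d" using z by (simp add: B_def)
      show "cdiff_at f y" if "y \<in> ball p d" for y using f(1) that by (simp add: B_def)
    qed
  qed
  have "(\<exists>z\<in>B \<inter> M. \<forall>v. jac H z *v v = 0 \<longrightarrow> v = 0) \<or>
    (\<exists>z\<in>B \<inter> M. \<exists>W a. open W \<and> z \<in> W \<and> W \<subseteq> B \<and> (\<forall>w\<in>W. \<forall>i. cdiff_at (\<lambda>z. a z $ i) w) \<and>
      (\<forall>w\<in>W. jac H w *v a w = 0) \<and> (\<forall>w\<in>W. a w \<noteq> 0))"
  proof (rule generic_kernel_or_immersion[where J = "jac H" and N = M, OF B(1)])
    show "f z = 0" if "\<And>z. z \<in> B \<Longrightarrow> cdiff_at f z" "\<And>z. z \<in> B \<Longrightarrow> z \<in> M \<Longrightarrow> f z = 0" "z \<in> B" for f z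
      using that by (rule uniq)
    show "B \<noteq> {}" using B(3) by blast
    show "cdiff_at (\<lambda>z. jac H z $ a $ j) z" if "z \<in> B" for z a j
      using that B(5) by (intro cdiff_at_jac[OF H(1) U(1)]) blast
  qed
  then show False
  proof
    assume "\<exists>z\<in>B \<inter> M. \<forall>v. jac H z *v v = 0 \<longrightarrow> v = 0"
    then obtain z where z: "z \<in> M" "\<And>v. jac H z *v v = 0 \<Longrightarrow> v = 0" by blast
    have "H z \<in> M'" using z(1) H(2) by blast
    from nontransversal_not_immersion[OF card M M' U H cond[OF this] z nt] show False .
  next
    assume "\<exists>z\<in>B \<inter> M. \<exists>W a. open W \<and> z \<in> W \<and> W \<subseteq> B \<and> (\<forall>w\<in>W. \<forall>i. cdiff_at (\<lambda>z. a z $ i) w) \<and>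
      (\<forall>w\<in>W. jac H w *v a w = 0) \<and> (\<forall>w\<in>W. a w \<noteq> 0)"
    then obtain z O1 a where z: "z \<in> M" "z \<in> O1" and O1: "open O1" "O1 \<subseteq> B"
      and a: "\<And>w i. w \<in> O1 \<Longrightarrow> cdiff_at (\<lambda>z. a z $ i) w" "\<And>w. w \<in> O1 \<Longrightarrow> jac H w *v a w = 0"
        "\<And>w. w \<in> O1 \<Longrightarrow> a w \<noteq> 0" by blast
    have O1W: "O1 \<subseteq> W" "O1 \<subseteq> U" "H ` O1 \<subseteq> W'" using O1(2) B(4-6) by blast+
    \<comment> \<open>Tangency has to be tested along \<open>M\<close> with one defining function;
      on the smaller open set the given \<rho> still serves at every point.\<close>
    have lO: "local_defining_function M q O1 \<rho>" if "q \<in> O1" for q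
      by (rule local_defining_function_subset[OF l O1(1) O1W(1) that])
    have "(\<Sum>j\<in>UNIV. a q $ j * wirtinger j (\<lambda>w. complex_of_real (\<rho> w)) q) = 0" if "q \<in> M \<inter> O1" for q
      using that O1 nz by (intro kernel_field_tangent[OF lO l' H O1W(2,3) a(1,2)]) auto
    moreover have "holomorphic_map_on a O1" by (rule holomorphic_map_onI[OF a(1)])
    moreover have "\<not> (\<forall>\<^sub>F w in nhds z. a w = 0)" using a(3)[OF z(2)] eventually_nhds_x_imp_x by blast
    ultimately show False using nondeg lO[OF z(2)] z(1) unfolding holomorphically_nondegenerate_def by blast
  qed
qed

theorem theorem1p1:
  fixes M U :: "(complex ^ 'm) set"
    and M' :: "(complex ^ 'k) set"
    and H :: "complex ^ 'm \<Rightarrow> complex ^ 'k"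
    and n n' :: nat
  assumes "CARD('m) = n + 1" and "CARD('k) = n' + 1"
    and "real_analytic_hypersurface M" and "connected M"
    and "real_analytic_hypersurface M'" and "connected M'"
    and "open U" and "M \<subseteq> U"
    and "holomorphically_nondegenerate M"
    and "(\<forall>p'\<in>M'. int (levi_e M' p') + int (levi_e0 M' p') \<le> int n - 1) \<or>
         (\<forall>p'\<in>M'. n' + levi_e0 M' p' \<le> 2 * n)"
    and "holomorphic_map_on H U" and "H ` M \<subseteq> M'"
  shows "let cond_i = (\<exists>V. open V \<and> V \<subseteq> U \<and> M \<subseteq> V \<and> H ` V \<subseteq> M');
             cond_ii = (\<exists>A. real_analytic_subset M A \<and> A \<noteq> M \<and> (\<forall>p\<in>M - A. transversal_at H M' p))
         in (cond_i \<or> cond_ii) \<and> \<not> (cond_i \<and> cond_ii)"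
proof -
  define ci where "ci \<longleftrightarrow> (\<exists>V. open V \<and> V \<subseteq> U \<and> M \<subseteq> V \<and> H ` V \<subseteq> M')"
  define cii where "cii \<longleftrightarrow> (\<exists>A. real_analytic_subset M A \<and> A \<noteq> M \<and> (\<forall>p\<in>M - A. transversal_at H M' p))"
  have "ci \<or> cii"
  proof (cases "{z \<in> M. \<not> transversal_at H M' z} = M")
    case False
    have "real_analytic_subset M {z \<in> M. \<not> transversal_at H M' z}"
      by (rule nontransversal_real_analytic_subset[OF assms(5,7,8,11,12)])
    then have cii unfolding cii_def using False by (intro exI[of _ "{z \<in> M. \<not> transversal_at H M' z}"]) simp
    then show ?thesis ..
  next
    case True
    have nt: "\<not> transversal_at H M' z" if "z \<in> M" for z using that True by auto
    have cond: "int (levi_e M' p) + int (levi_e0 M' p) \<le> int n - 1 \<or> n' + levi_e0 M' p \<le> 2 * n" if "p \<in> M'" for p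
      using assms(10) that by blast
    \<comment> \<open>The condition on \<open>V\<close> is stable under unions, so the largest
      candidate collects all the local neighbourhoods.\<close>
    define V where "V = \<Union> {V. open V \<and> V \<subseteq> U \<and> H ` V \<subseteq> M'}"
    have "\<exists>V. open V \<and> V \<subseteq> U \<and> p \<in> V \<and> H ` V \<subseteq> M'" if "p \<in> M" for p
      by (rule nontransversal_imp_mapped_locally[OF assms(1,2,3,5,7,8,9) cond assms(11,12) that nt])
    then have "M \<subseteq> V" unfolding V_def by blast
    moreover have "open V" "V \<subseteq> U" "H ` V \<subseteq> M'" unfolding V_def by (auto intro: open_Union)
    ultimately have ci unfolding ci_def by blast
    then show ?thesis ..
  qed
  moreover have "\<not> (ci \<and> cii)"
  proof
    assume "ci \<and> cii"
    then obtain V A where V: "open V" "V \<subseteq> U" "M \<subseteq> V" "H ` V \<subseteq> M'"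
      and A: "real_analytic_subset M A" "A \<noteq> M" "\<And>p. p \<in> M - A \<Longrightarrow> transversal_at H M' p"
      unfolding ci_def cii_def by blast
    have "A \<subseteq> M" using A(1) unfolding real_analytic_subset_def by blast
    then obtain p where p: "p \<in> M - A" using A(2) by blast
    then have "\<not> transversal_at H M' p"
      using V by (intro not_transversal_of_mapped_neighborhood[OF assms(5,11) _ V(1) _ V(4)]) auto
    with A(3)[OF p] show False by simp
  qed
  ultimately show ?thesis unfolding Let_def ci_def cii_def by simp
qed

end
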